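(* Let $d\ge2$, $X=(0,1)^d$, $\rho\equiv1$ on $X$, and let $\epsilon_n>0$ be any sequence converging to zero. Let $\xi_1,\xi_2,\dots$ be i.i.d. with density $\rho$ on $X$ and $\Psi_n=\{\xi_i\}_{i=1}^n$. Let $\eta=\mathbb{I}_{B(0,1)}$, $\eta_{\epsilon_n}(x)=\frac{1}{\epsilon_n^d}\mathbb{I}_{|x|\le\epsilon_n}$ and, for $n\ge2$, $$GTV_n(\mu)=\frac{1}{\epsilon_n}\frac{1}{n(n-1)}\sum_{i,j=1}^n\eta_{\epsilon_n}(\xi_i-\xi_j)\,|\mu(\xi_i)-\mu(\xi_j)|.$$ Let $\mu=\mathbb{I}_E$ be a polyhedral function on $X$. Then, as $n\to\infty$, $$\big|\mathbb{E}\,GTV_n(\mu)-TV(\mu;\rho,\eta)\big|=O(\epsilon_n).$$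
   Context: $|\cdot|$ is the Euclidean norm, $B(0,1)$ the unit ball of $\mathbb{R}^d$, $\mathcal{H}^{d-1}$ the $(d-1)$-dimensional Hausdorff measure. **Polyhedral function.** A ($d$-dimensional) polyhedral set in $\mathbb{R}^d$ is an open set $F$ whose boundary is a Lipschitz manifold contained in the union of finitely many affine hyperplanes. A function $\mu\in BV(X;\{0,1\})$ is a polyhedral function if there is a polyhedral set $F$ with $\partial F$ transversal to $\partial X$, meaning $\mathcal{H}^{d-1}(\partial F\cap\partial X)=0$, such that $\mu=1$ on $X\cap F$ and $\mu=0$ on $X\setminus F$; we write $\mu=\mathbb{I}_E$ with $E=F$. **Weighted total variation.** For $\nu\in\mathbb{R}^d$ let $\sigma(\nu)=\int_{\mathbb{R}^d}\eta(x)|x\cdot\nu|\,dx$ and $\sigma^*(p)=\sup\{\nu\cdot p-\sigma(\nu):\nu\in\mathbb{R}^d\}\in\{0,\infty\}$. For $\mu\in L^1(X)$, $$TV(\mu;\rho,\eta)=\sup\Big\{\int_X\mu\,\mathrm{div}(\phi)\,dx:\ \phi\in C_c^\infty(X;\mathbb{R}^d),\ \sup_{x\in X}\sigma^*\big(-\rho^{-2}(x)\phi(x)\big)<\infty\Big\}.$$ *)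

theory Defs
  imports "HOL-Probability.Probability"
begin

section \<open>Hausdorff measure\<close>

text \<open>The usual normalisation, in which the \<open>k\<close>-dimensional Hausdorff measure agrees with
  Lebesgue measure on \<open>\<real>\<^sup>k\<close>.  Covering sets are required to be bounded because
  \<^const>\<open>diameter\<close> is not meaningful on unbounded sets; empty covering sets
  contribute \<open>0\<close>, also for \<open>k = 0\<close>.\<close>

definition hausdorff_pre :: "nat \<Rightarrow> real \<Rightarrow> 'a::metric_space set \<Rightarrow> ennreal" where
  "hausdorff_pre k \<delta> A =
     (INF U \<in> {U :: nat \<Rightarrow> 'a set. A \<subseteq> (\<Union>i. U i) \<and> (\<forall>i. bounded (U i) \<and> diameter (U i) \<le> \<delta>)}.
        \<Sum>i. if U i = {} then 0 else ennreal (unit_ball_vol (real k) * (diameter (U i) / 2) ^ k))"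

definition hausdorff_measure :: "nat \<Rightarrow> 'a::metric_space set \<Rightarrow> ennreal" where
  "hausdorff_measure k A = (SUP \<delta> \<in> {0<..}. hausdorff_pre k \<delta> A)"


section \<open>Smooth compactly supported vector fields\<close>

primrec Ck_on :: "nat \<Rightarrow> 'a::real_normed_vector set \<Rightarrow> ('a \<Rightarrow> 'b::real_normed_vector) \<Rightarrow> bool" where
  "Ck_on 0 S f \<longleftrightarrow> continuous_on S f"
| "Ck_on (Suc k) S f \<longleftrightarrow>
     (\<forall>x\<in>S. f differentiable (at x)) \<and> (\<forall>v. Ck_on k S (\<lambda>x. frechet_derivative f (at x) v))"

text \<open>Only meaningful for open \<open>S\<close>.\<close>

definition smooth_on :: "'a::real_normed_vector set \<Rightarrow> ('a \<Rightarrow> 'b::real_normed_vector) \<Rightarrow> bool" where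
  "smooth_on S f \<longleftrightarrow> (\<forall>k. Ck_on k S f)"

text \<open>For functions on \<open>X\<close>, values of the total HOL function outside \<open>X\<close> are irrelevant.\<close>

definition test_fields :: "(real^'d) set \<Rightarrow> (real^'d \<Rightarrow> real^'d) set" where
  "test_fields X = {\<phi>. smooth_on X \<phi> \<and>
     compact (closure {x\<in>X. \<phi> x \<noteq> 0}) \<and> closure {x\<in>X. \<phi> x \<noteq> 0} \<subseteq> X}"

definition divergence :: "(real^'d \<Rightarrow> real^'d) \<Rightarrow> real^'d \<Rightarrow> real" where
  "divergence \<phi> x = (\<Sum>i\<in>UNIV. frechet_derivative \<phi> (at x) (axis i 1) $ i)"


section \<open>Functions of bounded variation and the weighted total variation\<close>

text \<open>\<open>BV_01 X\<close> is the set of functions of bounded variation on \<open>X\<close> with values in \<open>{0,1}\<close>.\<close>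

definition BV_01 :: "(real^'d) set \<Rightarrow> (real^'d \<Rightarrow> real) set" where
  "BV_01 X = {\<mu>. set_integrable lebesgue X \<mu> \<and>
     (SUP \<phi> \<in> {\<phi> \<in> test_fields X. \<forall>x\<in>X. norm (\<phi> x) \<le> 1}.
        ereal (LINT x:X|lebesgue. \<mu> x * divergence \<phi> x)) < \<infinity> \<and>
     (\<forall>x\<in>X. \<mu> x \<in> {0, 1})}"

definition sigma :: "(real^'d \<Rightarrow> real) \<Rightarrow> real^'d \<Rightarrow> real" where
  "sigma \<eta> \<nu> = (LINT x|lebesgue. \<eta> x * \<bar>x \<bullet> \<nu>\<bar>)"

definition sigma_star :: "(real^'d \<Rightarrow> real) \<Rightarrow> real^'d \<Rightarrow> ereal" where
  "sigma_star \<eta> p = (SUP \<nu>. ereal (\<nu> \<bullet> p - sigma \<eta> \<nu>))"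

definition TV :: "(real^'d) set \<Rightarrow> (real^'d \<Rightarrow> real) \<Rightarrow> (real^'d \<Rightarrow> real) \<Rightarrow> (real^'d \<Rightarrow> real) \<Rightarrow> ereal" where
  "TV X \<mu> \<rho> \<eta> =
     (SUP \<phi> \<in> {\<phi> \<in> test_fields X.
                (SUP x\<in>X. sigma_star \<eta> (- ((1 / (\<rho> x)\<^sup>2) *\<^sub>R \<phi> x))) < \<infinity>}.
        ereal (LINT x:X|lebesgue. \<mu> x * divergence \<phi> x))"


section \<open>Polyhedral sets and polyhedral functions\<close>

text \<open>\<open>k\<close>-dimensional Lipschitz submanifolds (without boundary): locally bi-Lipschitz to a
  relatively open subset of a \<open>k\<close>-dimensional linear subspace, which serves as the model of
  \<open>\<real>\<^sup>k\<close>.\<close>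

definition lipschitz_manifold :: "nat \<Rightarrow> (real^'d) set \<Rightarrow> bool" where
  "lipschitz_manifold k S \<longleftrightarrow>
     (\<forall>p\<in>S. \<exists>U T V f g L. open U \<and> p \<in> U \<and>
        subspace (T :: (real^'d) set) \<and> dim T = k \<and> openin (top_of_set T) V \<and>
        homeomorphism (S \<inter> U) V f g \<and> L-lipschitz_on (S \<inter> U) f \<and> L-lipschitz_on V g)"

definition affine_hyperplane :: "(real^'d) set \<Rightarrow> bool" where
  "affine_hyperplane H \<longleftrightarrow> (\<exists>a b. a \<noteq> 0 \<and> H = {x. a \<bullet> x = b})"

definition polyhedral_set :: "(real^'d) set \<Rightarrow> bool" where
  "polyhedral_set F \<longleftrightarrow> open F \<and> lipschitz_manifold (CARD('d) - 1) (frontier F) \<and>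
     (\<exists>\<H>. finite \<H> \<and> (\<forall>H\<in>\<H>. affine_hyperplane H) \<and> frontier F \<subseteq> \<Union>\<H>)"

definition polyhedral_function :: "(real^'d) set \<Rightarrow> (real^'d \<Rightarrow> real) \<Rightarrow> bool" where
  "polyhedral_function X \<mu> \<longleftrightarrow> \<mu> \<in> BV_01 X \<and>
     (\<exists>F. polyhedral_set F \<and>
          hausdorff_measure (CARD('d) - 1) (frontier F \<inter> frontier X) = 0 \<and>
          (\<forall>x \<in> X \<inter> F. \<mu> x = 1) \<and> (\<forall>x \<in> X - F. \<mu> x = 0))"


section \<open>The graph total variation\<close>

definition eta_scaled :: "real \<Rightarrow> real^'d \<Rightarrow> real" where
  "eta_scaled \<epsilon> x = 1 / \<epsilon> ^ CARD('d) * indicator {x. norm x \<le> \<epsilon>} x"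

text \<open>The graph total variation on the points \<open>\<xi> 1, \<dots>, \<xi> n\<close>; intended for \<open>n \<ge> 2\<close>.\<close>

definition GTV :: "real \<Rightarrow> nat \<Rightarrow> (nat \<Rightarrow> real^'d) \<Rightarrow> (real^'d \<Rightarrow> real) \<Rightarrow> real" where
  "GTV \<epsilon> n \<xi> \<mu> = 1 / \<epsilon> * (1 / (real n * (real n - 1))) *
     (\<Sum>i\<in>{1..n}. \<Sum>j\<in>{1..n}. eta_scaled \<epsilon> (\<xi> i - \<xi> j) * \<bar>\<mu> (\<xi> i) - \<mu> (\<xi> j)\<bar>)"

end

theory Submission
  imports Defs
begin

text \<open>Let \<open>u\<close> be the indicator function of the polyhedral set \<open>F\<close>, restricted to the cube \<open>X\<close>.  Since the sample
points are independent and uniform, the expected graph total variation is exactly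
\<open>1 / \<epsilon>\<close> times the nonlocal energy
\<open>\<integral>\<^bsub>|z| \<le> 1\<^esub> \<integral> |u (x + \<epsilon> z) - u x| dx dz\<close>, where \<open>x\<close> and \<open>x + \<epsilon> z\<close> range over \<open>X\<close>; the
sample size cancels.  It remains to compare this energy with the total variation.

The frontier of \<open>F\<close> lies in finitely many hyperplanes.  Adding the hyperplanes that carry the
facets of the cube gives an arrangement such that membership in \<open>F\<close> and in \<open>X\<close> is constant on each
open cell.  Hence the pair \<open>x\<close>, \<open>x + \<epsilon> z\<close> contributes only if a hyperplane separates
the two points.  Points within distance \<open>O(\<epsilon>)\<close> of two different hyperplanes fill a volume \<open>O(\<epsilon>\<^sup>2)\<close>
only; at every other point at most one hyperplane is crossed, and the jump that is seen does not
change if \<open>x + \<epsilon> z\<close> is replaced by the mirror image of \<open>x\<close> in that hyperplane.  So the inner integral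
is \<open>\<epsilon> (\<Sum>\<^sub>i |n\<^sub>i \<bullet> z| P\<^sub>i) + O(\<epsilon>\<^sup>2)\<close>, where \<open>n\<^sub>i\<close> is the unit normal of the \<open>i\<close>-th hyperplane and \<open>P\<^sub>i\<close>
is the area of the part of it, inside \<open>X\<close>, across which \<open>u\<close> jumps.  The area enters
as the limit of the volume of a one-sided layer of thickness \<open>t\<close> over this part, divided by
\<open>t\<close>, and comparing layers of different thickness by a stretching in the direction of the normal
gives both the existence of the limit and the rate (\<open>translation_jump_expansion\<close>).  Integration
over \<open>z\<close> replaces each \<open>|n\<^sub>i \<bullet> z|\<close> by the constant \<open>c\<close> with \<open>\<sigma> \<nu> = c |\<nu>|\<close>, which exists because \<open>\<eta>\<close> is
radial.  This gives the expansion \<open>\<epsilon> c (\<Sum>\<^sub>i P\<^sub>i) + O(\<epsilon>\<^sup>2)\<close> of the energy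
(\<open>nonlocal_energy_expansion\<close>).

The total variation is equal to \<open>c (\<Sum>\<^sub>i P\<^sub>i)\<close> (\<open>TV_eq\<close>).  The same expansion, for the signed jump and
with the components of a test field as weights, is a Gauss formula: it expresses the integral of
\<open>u div \<phi>\<close> by limits of integrals over thin layers (\<open>integral_divergence\<close>).
The constraint on \<open>\<phi>\<close> says \<open>|\<phi>| \<le> c\<close> on \<open>X\<close>, which yields the upper bound.
The lower bound comes from explicit smooth fields equal to \<open>-c\<close> times the jump times the
normal near the jump part of each hyperplane, and cut off within distance \<open>\<delta>\<close> of the other
hyperplanes (\<open>calibration_divergence_ge\<close>).\<close>

section \<open>Lebesgue measure under isometries and stretchings\<close>

lemma nn_integral_lborel_translation:
  fixes f :: "'a::euclidean_space \<Rightarrow> ennreal"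
  assumes [measurable]: "f \<in> borel_measurable borel"
  shows "(\<integral>\<^sup>+x. f (a + x) \<partial>lborel) = (\<integral>\<^sup>+x. f x \<partial>lborel)"
proof -
  have "(\<integral>\<^sup>+x. f x \<partial>lborel) = (\<integral>\<^sup>+x. f x \<partial>distr lborel borel ((+) a))"
    by (simp add: lborel_distr_plus)
  also have "\<dots> = (\<integral>\<^sup>+x. f (a + x) \<partial>lborel)"
    by (subst nn_integral_distr) auto
  finally show ?thesis ..
qed

lemma nn_integral_lborel_reflect:
  fixes f :: "'a::euclidean_space \<Rightarrow> ennreal"
  assumes [measurable]: "f \<in> borel_measurable borel"
  shows "(\<integral>\<^sup>+x. f (a - x) \<partial>lborel) = (\<integral>\<^sup>+x. f x \<partial>lborel)"
proof -
  have "(\<integral>\<^sup>+x. f x \<partial>lborel) = (\<integral>\<^sup>+x. f x \<partial>(density (distr lborel borel (\<lambda>x. a + (-1) *\<^sub>R x)) (\<lambda>_. ennreal (\<bar>-1\<bar>^DIM('a)))))"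
    by (subst lborel_affine[of "-1" a]) auto
  also have "\<dots> = (\<integral>\<^sup>+x. f (a - x) \<partial>lborel)"
    by (subst nn_integral_density) (auto simp: nn_integral_distr)
  finally show ?thesis ..
qed

text \<open>The image of Lebesgue measure under an isometry is again invariant under translations, and two
such measures are proportional: writing a product of an integral of \<open>f\<close> and the volume of the unit
ball as a double integral and shifting the variables once by \<open>T y\<close> and once by \<open>S x\<close>, where \<open>S\<close> inverts \<open>T\<close>,
exchanges the two measures.  The unit ball is mapped to itself, so the factor is \<open>1\<close>.\<close>

lemma nn_integral_lborel_orthogonal:
  fixes T :: "'a::euclidean_space \<Rightarrow> 'a" and f :: "'a \<Rightarrow> ennreal"
  assumes T: "orthogonal_transformation T" and [measurable]: "f \<in> borel_measurable borel"
  shows "(\<integral>\<^sup>+x. f (T x) \<partial>lborel) = (\<integral>\<^sup>+x. f x \<partial>lborel)"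
proof -
  let ?B = "ball (0::'a) 1" and ?g = "indicator (ball (0::'a) 1) :: 'a \<Rightarrow> ennreal"
  have lin: "linear T" and nrm: "\<And>x. norm (T x) = norm x"
    using T by (auto simp: orthogonal_transformation)
  have [measurable]: "ball (0::'a) 1 \<in> sets borel" by simp
  have [measurable]: "T \<in> borel_measurable borel"
    using lin by (intro borel_measurable_continuous_onI linear_continuous_on) (simp add: linear_linear)
  obtain S where S: "orthogonal_transformation S" "\<And>x. T (S x) = x"
    using T orthogonal_transformation_inv orthogonal_transformation_surj surj_f_inv_f by metis
  have [measurable]: "S \<in> borel_measurable borel"
    using S by (intro borel_measurable_continuous_onI linear_continuous_on)
      (simp add: linear_linear orthogonal_transformation_linear)
  have gT: "?g (T y) = ?g y" for y
    by (simp add: nrm indicator_def)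
  have "(\<integral>\<^sup>+x. f x \<partial>lborel) * emeasure lborel ?B = (\<integral>\<^sup>+y. (\<integral>\<^sup>+x. f x \<partial>lborel) * ?g (T y) \<partial>lborel)"
    by (simp add: gT nn_integral_cmult_indicator)
  also have "\<dots> = (\<integral>\<^sup>+y. (\<integral>\<^sup>+x. f (T y + x) * ?g (T y) \<partial>lborel) \<partial>lborel)"
    by (simp add: nn_integral_lborel_translation nn_integral_multc)
  also have "\<dots> = (\<integral>\<^sup>+x. (\<integral>\<^sup>+y. f (T y + x) * ?g (T y) \<partial>lborel) \<partial>lborel)"
    by (rule lborel_pair.Fubini') measurable
  also have "\<dots> = (\<integral>\<^sup>+x. (\<integral>\<^sup>+y. f (T y) * ?g (T y - x) \<partial>lborel) \<partial>lborel)"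
  proof (rule nn_integral_cong)
    fix x
    have "(\<integral>\<^sup>+y. f (T y) * ?g (T y - x) \<partial>lborel) = (\<integral>\<^sup>+y. f (T (S x + y)) * ?g (T (S x + y) - x) \<partial>lborel)"
      by (subst nn_integral_lborel_translation[of _ "S x", symmetric]) auto
    then show "(\<integral>\<^sup>+y. f (T y + x) * ?g (T y) \<partial>lborel) = (\<integral>\<^sup>+y. f (T y) * ?g (T y - x) \<partial>lborel)"
      by (simp add: linear_add[OF lin] S add.commute)
  qed
  also have "\<dots> = (\<integral>\<^sup>+y. (\<integral>\<^sup>+x. f (T y) * ?g (T y - x) \<partial>lborel) \<partial>lborel)"
    by (rule lborel_pair.Fubini') measurable
  also have "\<dots> = (\<integral>\<^sup>+y. f (T y) * emeasure lborel ?B \<partial>lborel)"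
    by (subst nn_integral_cmult) (auto simp: nn_integral_lborel_reflect[where f = ?g])
  also have "\<dots> = (\<integral>\<^sup>+x. f (T x) \<partial>lborel) * emeasure lborel ?B"
    by (simp add: nn_integral_multc)
  finally have eq: "(\<integral>\<^sup>+x. f x \<partial>lborel) * emeasure lborel ?B = (\<integral>\<^sup>+x. f (T x) \<partial>lborel) * emeasure lborel ?B" .
  have "emeasure lborel ?B \<noteq> 0" "emeasure lborel ?B \<noteq> \<infinity>"
    using content_ball_pos[of 1 "0::'a"] emeasure_lborel_ball_finite[of "0::'a" 1]
    by (auto simp: measure_def)
  with eq show ?thesis
    by (auto simp: mult.commute[of _ "emeasure lborel ?B"] ennreal_mult_cancel_left)
qed

lemma lborel_distr_orthogonal:
  fixes T :: "'a::euclidean_space \<Rightarrow> 'a"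
  assumes T: "orthogonal_transformation T"
  shows "distr lborel borel T = lborel"
proof (rule measure_eqI)
  have [measurable]: "T \<in> borel_measurable borel"
    using T by (intro borel_measurable_continuous_onI linear_continuous_on)
      (simp add: linear_linear orthogonal_transformation_linear)
  fix A assume "A \<in> sets (distr lborel borel T)"
  then have [measurable]: "A \<in> sets borel" by simp
  show "emeasure (distr lborel borel T) A = emeasure lborel A"
    using nn_integral_lborel_orthogonal[OF T, of "indicator A"]
    by (simp add: nn_integral_distr flip: nn_integral_indicator)
qed simp

text \<open>For a unit vector \<open>n\<close>, the distances from the hyperplane \<open>n \<bullet> x = b\<close> are multiplied by \<open>l\<close>: the
identity for \<open>l = 1\<close>, the orthogonal projection for \<open>l = 0\<close>, the reflection for \<open>l = -1\<close>.\<close>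

definition stretch :: "'a::real_inner \<Rightarrow> real \<Rightarrow> real \<Rightarrow> 'a \<Rightarrow> 'a" where
  "stretch n b l x = x + ((l - 1) * (n \<bullet> x - b)) *\<^sub>R n"

lemma borel_measurable_stretch [measurable]: "stretch (n::'a::euclidean_space) b l \<in> borel_measurable borel"
  unfolding stretch_def[abs_def] by measurable

lemma lborel_distr_stretch_axis:
  fixes k :: "'d::finite"
  shows "l \<noteq> 0 \<Longrightarrow> density (distr lborel borel (stretch (axis k 1 :: real^'d) 0 l)) (\<lambda>_. ennreal \<bar>l\<bar>) = lborel"
proof -
  assume "l \<noteq> 0"
  let ?c = "\<lambda>j::real^'d. if j = axis k 1 then l else 1"
  have T: "stretch (axis k 1 :: real^'d) 0 l = (\<lambda>x. 0 + (\<Sum>j\<in>Basis. (?c j * (x \<bullet> j)) *\<^sub>R j))"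
  proof
    fix x :: "real^'d"
    have "stretch (axis k 1) 0 l x = (\<Sum>j\<in>Basis. (x \<bullet> j) *\<^sub>R j) + ((l - 1) * (axis k 1 \<bullet> x)) *\<^sub>R axis k 1"
      by (simp add: stretch_def euclidean_representation)
    also have "((l - 1) * (axis k 1 \<bullet> x)) *\<^sub>R axis k 1 =
        (\<Sum>j\<in>Basis. if j = axis k 1 then ((l-1) * (x \<bullet> j)) *\<^sub>R j else 0)"
      by (simp add: inner_commute axis_in_Basis_iff)
    also have "(\<Sum>j\<in>Basis. (x \<bullet> j) *\<^sub>R j) + \<dots> = (\<Sum>j\<in>Basis. (?c j * (x \<bullet> j)) *\<^sub>R j)"
      unfolding sum.distrib[symmetric] by (intro sum.cong) (auto simp: algebra_simps)
    finally show "stretch (axis k 1) 0 l x = 0 + (\<Sum>j\<in>Basis. (?c j * (x \<bullet> j)) *\<^sub>R j)" by simp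
  qed
  have "(\<Prod>j\<in>(Basis::(real^'d) set). \<bar>?c j\<bar>) = (\<Prod>j\<in>(Basis::(real^'d) set). if j = axis k 1 then \<bar>l\<bar> else 1)"
    by (intro prod.cong) auto
  then have p: "(\<Prod>j\<in>(Basis::(real^'d) set). \<bar>?c j\<bar>) = \<bar>l\<bar>"
    by (simp add: axis_in_Basis_iff)
  show ?thesis
    unfolding T by (subst lborel_affine_euclidean[of ?c 0]) (use \<open>l \<noteq> 0\<close> p in auto)
qed

text \<open>An isometry that takes a coordinate axis to \<open>n\<close>, followed by a translation, conjugates the
stretching to one of a single coordinate.\<close>

lemma nn_integral_stretch:
  fixes n :: "real^'d" and f :: "real^'d \<Rightarrow> ennreal"
  assumes n: "norm n = 1" and l: "l \<noteq> 0" and [measurable]: "f \<in> borel_measurable borel"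
  shows "(\<integral>\<^sup>+x. f x \<partial>lborel) = ennreal \<bar>l\<bar> * (\<integral>\<^sup>+x. f (stretch n b l x) \<partial>lborel)"
proof -
  fix k :: 'd
  let ?e = "axis k 1 :: real^'d"
  obtain Q where Q: "orthogonal_transformation Q" "Q ?e = n"
    using orthogonal_transformation_exists_1[of ?e n] n by auto
  have linQ: "linear Q" using Q by (simp add: orthogonal_transformation_linear)
  have [measurable]: "Q \<in> borel_measurable borel"
    using linQ by (intro borel_measurable_continuous_onI linear_continuous_on) (simp add: linear_linear)
  have conj: "(b *\<^sub>R n) + Q (stretch ?e 0 l x) = stretch n b l ((b *\<^sub>R n) + Q x)" for x
  proof -
    have "n \<bullet> Q x = ?e \<bullet> x" using Q by (metis orthogonal_transformation_def)
    moreover have "n \<bullet> n = 1" using n by (simp add: norm_eq_1)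
    ultimately show ?thesis
      by (simp add: stretch_def linear_add[OF linQ] linear_cmul[OF linQ] Q inner_add_right)
  qed
  have "(\<integral>\<^sup>+x. f x \<partial>lborel) = (\<integral>\<^sup>+x. f (b *\<^sub>R n + Q x) \<partial>lborel)"
    using nn_integral_lborel_orthogonal[OF Q(1), of "\<lambda>x. f (b *\<^sub>R n + x)"]
    by (simp add: nn_integral_lborel_translation)
  also have "\<dots> = (\<integral>\<^sup>+x. f (b *\<^sub>R n + Q x) \<partial>density (distr lborel borel (stretch ?e 0 l)) (\<lambda>_. ennreal \<bar>l\<bar>))"
    using l by (simp add: lborel_distr_stretch_axis)
  also have "\<dots> = ennreal \<bar>l\<bar> * (\<integral>\<^sup>+x. f (b *\<^sub>R n + Q (stretch ?e 0 l x)) \<partial>lborel)"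
    by (simp add: nn_integral_density nn_integral_distr nn_integral_cmult)
  also have "(\<integral>\<^sup>+x. f (b *\<^sub>R n + Q (stretch ?e 0 l x)) \<partial>lborel) = (\<integral>\<^sup>+x. f (stretch n b l x) \<partial>lborel)"
    unfolding conj
    using nn_integral_lborel_orthogonal[OF Q(1), of "\<lambda>x. f (stretch n b l (b *\<^sub>R n + x))"]
     nn_integral_lborel_translation[of "\<lambda>x. f (stretch n b l x)" "b *\<^sub>R n"]
    by simp
  finally show ?thesis .
qed

lemma lborel_distr_stretch:
  fixes n :: "real^'d"
  assumes n: "norm n = 1" and l: "l \<noteq> 0"
  shows "density (distr lborel borel (stretch n b l)) (\<lambda>_. ennreal \<bar>l\<bar>) = lborel"
proof (rule measure_eqI)
  fix A assume "A \<in> sets (density (distr lborel borel (stretch n b l)) (\<lambda>_. ennreal \<bar>l\<bar>))"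
  then have [measurable]: "A \<in> sets borel" by simp
  have "emeasure (density (distr lborel borel (stretch n b l)) (\<lambda>_. ennreal \<bar>l\<bar>)) A
      = (\<integral>\<^sup>+x. ennreal \<bar>l\<bar> * indicator A x \<partial>distr lborel borel (stretch n b l))"
    by (rule emeasure_density) auto
  also have "\<dots> = ennreal \<bar>l\<bar> * (\<integral>\<^sup>+x. indicator A (stretch n b l x) \<partial>lborel)"
    by (subst nn_integral_distr) (auto intro: nn_integral_cmult)
  also have "\<dots> = emeasure lborel A"
    using nn_integral_stretch[OF n l, of "indicator A" b] by simp
  finally show "emeasure (density (distr lborel borel (stretch n b l)) (\<lambda>_. ennreal \<bar>l\<bar>)) A = emeasure lborel A" .
qed simp

lemma integral_stretch:
  fixes n :: "real^'d" and f :: "real^'d \<Rightarrow> real"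
  assumes n: "norm n = 1" and l: "l \<noteq> 0" and [measurable]: "f \<in> borel_measurable borel"
  shows "(\<integral>x. f x \<partial>lborel) = \<bar>l\<bar> * (\<integral>x. f (stretch n b l x) \<partial>lborel)"
proof -
  have "(\<integral>x. f x \<partial>lborel) = (\<integral>x. f x \<partial>density (distr lborel borel (stretch n b l)) (\<lambda>_. ennreal \<bar>l\<bar>))"
    by (simp add: lborel_distr_stretch[OF n l])
  also have "\<dots> = (\<integral>x. \<bar>l\<bar> *\<^sub>R f x \<partial>distr lborel borel (stretch n b l))"
    by (rule integral_density) auto
  also have "\<dots> = (\<integral>x. \<bar>l\<bar> *\<^sub>R f (stretch n b l x) \<partial>lborel)"
    by (rule integral_distr) auto
  finally show ?thesis by simp
qed

text \<open>The translates of \<open>A\<close> by \<open>s *\<^sub>R p\<close> with \<open>|s| \<le> 1\<close> stay in \<open>A'\<close>, and a given point lies in the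
translated strip for a set of parameters \<open>s\<close> of length at most \<open>2 t\<close>.  Averaging over \<open>s\<close> gives the
bound.  As \<open>A\<close> may itself be a strip parallel to \<open>p\<close>, the lemma can be applied repeatedly.\<close>

lemma emeasure_strip_le:
  fixes n p :: "'a::euclidean_space"
  assumes [measurable]: "A \<in> sets borel" "A' \<in> sets borel"
    and p: "n \<bullet> p = 1" and sub: "\<And>x s. x \<in> A \<Longrightarrow> \<bar>s\<bar> \<le> 1 \<Longrightarrow> x + s *\<^sub>R p \<in> A'"
    and t: "0 \<le> t"
  shows "emeasure lborel (A \<inter> {x. \<bar>n \<bullet> x - b\<bar> \<le> t}) \<le> ennreal t * emeasure lborel A'"
proof -
  let ?S = "A \<inter> {x. \<bar>n \<bullet> x - b\<bar> \<le> t}"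
  have "2 * emeasure lborel ?S = (\<integral>\<^sup>+s. emeasure lborel ?S * indicator {-1..1} s \<partial>(lborel::real measure))"
    by (subst nn_integral_cmult_indicator) (auto simp: mult.commute)
  also have "\<dots> = (\<integral>\<^sup>+s. (\<integral>\<^sup>+x. indicator ?S (- (s *\<^sub>R p) + x) * indicator {-1..1} s \<partial>lborel) \<partial>lborel)"
    by (intro nn_integral_cong, subst nn_integral_multc)
       (auto simp: nn_integral_lborel_translation[where f = "indicator ?S"] simp del: add_uminus_conv_diff uminus_add_conv_diff)
  also have "\<dots> = (\<integral>\<^sup>+x. (\<integral>\<^sup>+s. indicator ?S (- (s *\<^sub>R p) + x) * indicator {-1..1} s \<partial>lborel) \<partial>lborel)"
    by (rule lborel_pair.Fubini') measurable
  also have "\<dots> \<le> (\<integral>\<^sup>+x. 2 * ennreal t * indicator A' x \<partial>lborel)"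
  proof (intro nn_integral_mono)
    fix x
    have "indicator ?S (- (s *\<^sub>R p) + x) * indicator {-1..1} s
        \<le> (indicator A' x :: ennreal) * indicator {n \<bullet> x - b - t .. n \<bullet> x - b + t} s" for s
      using sub[of "- (s *\<^sub>R p) + x" s] p by (auto simp: indicator_def inner_diff_right abs_le_iff)
    then have "(\<integral>\<^sup>+s. indicator ?S (- (s *\<^sub>R p) + x) * indicator {-1..1} s \<partial>lborel)
      \<le> (\<integral>\<^sup>+s. (indicator A' x :: ennreal) * indicator {n \<bullet> x - b - t .. n \<bullet> x - b + t} s \<partial>lborel)"
      by (intro nn_integral_mono) auto
    also have "\<dots> = 2 * ennreal t * indicator A' x"
      using t by (subst nn_integral_cmult_indicator) (auto simp: indicator_def ennreal_mult' simp flip: ennreal_numeral)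
    finally show "(\<integral>\<^sup>+s. indicator ?S (- (s *\<^sub>R p) + x) * indicator {-1..1} s \<partial>lborel) \<le> 2 * ennreal t * indicator A' x" .
  qed
  also have "\<dots> = 2 * (ennreal t * emeasure lborel A')"
    by (subst nn_integral_cmult_indicator) (auto simp: mult.assoc)
  finally show ?thesis
    by (subst (asm) ennreal_mult_le_mult_iff) auto
qed

section \<open>Strips and hyperplane arrangements\<close>

lemma lmeasurable_subset_cball:
  fixes A :: "'a::euclidean_space set"
  assumes "A \<in> sets borel" "A \<subseteq> cball 0 R"
  shows "A \<in> fmeasurable lborel"
proof (rule fmeasurableI)
  show "emeasure lborel A < \<infinity>"
    using emeasure_mono[of A "cball 0 R" lborel] assms emeasure_lborel_cball_finite[of "0::'a" R]
    by (simp add: order.strict_trans1)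
qed (use assms in simp)

lemma measure_mono_cball:
  fixes A B :: "'a::euclidean_space set"
  assumes "A \<in> sets borel" "B \<in> sets borel" "A \<subseteq> B" "B \<subseteq> cball 0 R"
  shows "measure lborel A \<le> measure lborel B"
  using assms lmeasurable_subset_cball[of B R] by (intro measure_mono_fmeasurable) auto

lemma measure_leI_ennreal:
  assumes "emeasure M A \<le> ennreal c" "0 \<le> c"
  shows "measure M A \<le> c"
  using assms enn2real_mono[of "emeasure M A" "ennreal c"] by (simp add: measure_def)

lemma strip_measure_le:
  fixes n :: "'a::euclidean_space"
  assumes n: "norm n = 1" and t: "0 \<le> t"
  shows "measure lborel (cball 0 R \<inter> {x. \<bar>n \<bullet> x - b\<bar> \<le> t}) \<le> t * measure lborel (cball (0::'a) (R + 1))"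
proof -
  have "emeasure lborel (cball 0 R \<inter> {x. \<bar>n \<bullet> x - b\<bar> \<le> t}) \<le> ennreal t * emeasure lborel (cball (0::'a) (R + 1))"
  proof (rule emeasure_strip_le[where p = n])
    show "x + s *\<^sub>R n \<in> cball 0 (R + 1)" if "x \<in> cball 0 R" "\<bar>s\<bar> \<le> 1" for x s
      using norm_triangle_ineq[of x "s *\<^sub>R n"] n that by auto
  qed (use n t in \<open>auto simp: norm_eq_1\<close>)
  also have "\<dots> = ennreal (t * measure lborel (cball (0::'a) (R + 1)))"
    using t by (simp add: emeasure_eq_measure2[OF lmeasurable_subset_cball[OF _ order_refl]] ennreal_mult')
  finally show ?thesis
    using t by (intro measure_leI_ennreal) auto
qed

text \<open>For hyperplanes that are not parallel, a direction \<open>p\<close> parallel to the second one but not to the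
first allows the strip estimate to be applied twice.  Parallel hyperplanes have a positive distance
\<open>e\<close>, so the strips meet only if one of them has half-width at least \<open>e / 2\<close>, and then the estimate for
the other strip suffices.\<close>

lemma two_strips_measure_le:
  fixes n m :: "'a::euclidean_space"
  assumes n: "norm n = 1" and m: "norm m = 1" and ne: "{x. n \<bullet> x = b} \<noteq> {x. m \<bullet> x = c}"
  obtains C where "\<And>s t. 0 \<le> s \<Longrightarrow> 0 \<le> t \<Longrightarrow>
    measure lborel (cball 0 R \<inter> {x. \<bar>n \<bullet> x - b\<bar> \<le> s \<and> \<bar>m \<bullet> x - c\<bar> \<le> t}) \<le> C * (s * t)"
proof (cases "\<bar>n \<bullet> m\<bar> = 1")
  case True
  define V where "V = measure lborel (cball (0::'a) (R + 1))"
  define k where "k = n \<bullet> m"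
  have nn: "n \<bullet> n = 1" "m \<bullet> m = 1" using n m by (auto simp: norm_eq_1)
  have k: "k = 1 \<or> k = -1" using True by (auto simp: k_def)
  have "(m - k *\<^sub>R n) \<bullet> (m - k *\<^sub>R n) = 0"
    using nn k by (auto simp: inner_diff_left inner_diff_right k_def[symmetric] inner_commute[of m n])
  then have mk: "m = k *\<^sub>R n" by simp
  define e where "e = \<bar>k * b - c\<bar>"
  have "e \<noteq> 0"
  proof
    assume "e = 0"
    then have "c = k * b" by (simp add: e_def)
    then have "{x. n \<bullet> x = b} = {x. m \<bullet> x = c}" using k mk by auto
    with ne show False by simp
  qed
  then have e: "e > 0" by (simp add: e_def)
  have V: "V \<ge> 0" by (simp add: V_def)
  show ?thesis
  proof (rule that[of "2 / e * V"])
    fix s t :: real assume st: "0 \<le> s" "0 \<le> t"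
    let ?S = "cball 0 R \<inter> {x. \<bar>n \<bullet> x - b\<bar> \<le> s \<and> \<bar>m \<bullet> x - c\<bar> \<le> t}"
    show "measure lborel ?S \<le> 2 / e * V * (s * t)"
    proof (cases "?S = {}")
      case True
      then show ?thesis using e V st by (simp only: True) simp
    next
      case False
      then obtain x where x: "\<bar>n \<bullet> x - b\<bar> \<le> s" "\<bar>k * (n \<bullet> x) - c\<bar> \<le> t" by (auto simp: mk)
      then have "e \<le> s + t" using k by (auto simp: e_def abs_if split: if_splits)
      have 1: "measure lborel ?S \<le> s * V"
        unfolding V_def by (rule order_trans[OF measure_mono_cball strip_measure_le[OF n st(1), of R b]]) auto
      have 2: "measure lborel ?S \<le> t * V"
        unfolding V_def by (rule order_trans[OF measure_mono_cball strip_measure_le[OF m st(2), of R c]]) auto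
      have "s \<ge> e / 2 \<or> t \<ge> e / 2" using \<open>e \<le> s + t\<close> by linarith
      then show ?thesis
      proof
        assume "s \<ge> e / 2"
        then have "t * V * 1 \<le> t * V * (2 / e * s)" using e V st by (intro mult_left_mono) (auto simp: field_simps)
        with 2 show ?thesis by (simp add: mult_ac)
      next
        assume "t \<ge> e / 2"
        then have "s * V * 1 \<le> s * V * (2 / e * t)" using e V st by (intro mult_left_mono) (auto simp: field_simps)
        with 1 show ?thesis by (simp add: mult_ac)
      qed
    qed
  qed
next
  case False
  define k where "k = n \<bullet> m"
  have nn: "n \<bullet> n = 1" "m \<bullet> m = 1" "m \<bullet> n = k" using n m by (auto simp: norm_eq_1 k_def inner_commute)
  have "\<bar>k\<bar> \<le> 1" using Cauchy_Schwarz_ineq2[of n m] n m by (simp add: k_def)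
  with False have k: "1 - k\<^sup>2 > 0" by (auto simp: abs_square_less_1 k_def[symmetric])
  define p where "p = (1 / (1 - k\<^sup>2)) *\<^sub>R (n - k *\<^sub>R m)"
  have p: "n \<bullet> p = 1" "m \<bullet> p = 0"
    using k nn by (auto simp: p_def inner_diff_right k_def[symmetric] power2_eq_square)
  define V where "V = measure lborel (cball (0::'a) (R + norm p + 1))"
  show ?thesis
  proof (rule that[of V])
    fix s t :: real assume st: "0 \<le> s" "0 \<le> t"
    let ?A = "cball 0 R \<inter> {x. \<bar>m \<bullet> x - c\<bar> \<le> t}"
    let ?A' = "cball 0 (R + norm p) \<inter> {x. \<bar>m \<bullet> x - c\<bar> \<le> t}"
    have "emeasure lborel (?A \<inter> {x. \<bar>n \<bullet> x - b\<bar> \<le> s}) \<le> ennreal s * emeasure lborel ?A'"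
    proof (rule emeasure_strip_le[where p = p])
      show "x + r *\<^sub>R p \<in> ?A'" if "x \<in> ?A" "\<bar>r\<bar> \<le> 1" for x r
        using norm_triangle_ineq[of x "r *\<^sub>R p"] that p mult_right_mono[of "\<bar>r\<bar>" 1 "norm p"]
        by (auto simp: inner_add_right)
    qed (use st p in auto)
    also have "emeasure lborel ?A' \<le> ennreal (t * V)"
    proof -
      have "emeasure lborel ?A' = ennreal (measure lborel ?A')"
        by (rule emeasure_eq_measure2, rule lmeasurable_subset_cball[of _ "R + norm p"]) auto
      also have "\<dots> \<le> ennreal (t * V)"
        unfolding V_def using strip_measure_le[OF m st(2), of "R + norm p" c] by (intro ennreal_leI) auto
      finally show ?thesis .
    qed
    also have "ennreal s * ennreal (t * V) = ennreal (V * (s * t))"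
      using st by (simp add: ennreal_mult' mult_ac V_def)
    finally have "emeasure lborel (?A \<inter> {x. \<bar>n \<bullet> x - b\<bar> \<le> s}) \<le> ennreal (V * (s * t))"
      by (simp add: mult_left_mono)
    then have "measure lborel (?A \<inter> {x. \<bar>n \<bullet> x - b\<bar> \<le> s}) \<le> V * (s * t)"
      using st by (intro measure_leI_ennreal) (auto simp: V_def)
    also have "?A \<inter> {x. \<bar>n \<bullet> x - b\<bar> \<le> s} = cball 0 R \<inter> {x. \<bar>n \<bullet> x - b\<bar> \<le> s \<and> \<bar>m \<bullet> x - c\<bar> \<le> t}"
      by auto
    finally show "measure lborel (cball 0 R \<inter> {x. \<bar>n \<bullet> x - b\<bar> \<le> s \<and> \<bar>m \<bullet> x - c\<bar> \<le> t}) \<le> V * (s * t)" .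
  qed
qed

text \<open>The hyperplanes may be parallel, but they have to differ as sets: every point near a
hyperplane listed twice would count as close to two hyperplanes.\<close>

locale hyperplane_arrangement =
  fixes I :: "'i set" and n :: "'i \<Rightarrow> real^'d" and b :: "'i \<Rightarrow> real"
  assumes finite_index: "finite I"
    and norm_normal: "i \<in> I \<Longrightarrow> norm (n i) = 1"
    and hyperplanes_distinct: "i \<in> I \<Longrightarrow> j \<in> I \<Longrightarrow> i \<noteq> j \<Longrightarrow> {x. n i \<bullet> x = b i} \<noteq> {x. n j \<bullet> x = b j}"
begin

abbreviation height :: "'i \<Rightarrow> real^'d \<Rightarrow> real" where
  "height i x \<equiv> n i \<bullet> x - b i"

text \<open>A point of a hyperplane belongs to no open cell, so the relation is reflexive only off the
hyperplanes.\<close>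

definition same_cell :: "real^'d \<Rightarrow> real^'d \<Rightarrow> bool" where
  "same_cell x y \<longleftrightarrow> (\<forall>i\<in>I. height i x * height i y > 0)"

text \<open>Two different widths are allowed because the lower bound for the total variation lets the thickness
\<open>s\<close> of a layer tend to \<open>0\<close> while the distance \<open>t\<close> from the other hyperplanes stays fixed.\<close>

definition near_two :: "real \<Rightarrow> real \<Rightarrow> real \<Rightarrow> (real^'d) set" where
  "near_two R s t = (\<Union>i\<in>I. \<Union>j\<in>I - {i}. cball 0 R \<inter> {x. \<bar>height i x\<bar> \<le> s \<and> \<bar>height j x\<bar> \<le> t})"

lemma near_two_borel [measurable]: "near_two R s t \<in> sets borel"
  unfolding near_two_def using finite_index by (intro sets.finite_UN) auto

text \<open>This is what makes the error terms quadratic: the points that are close to two hyperplanes at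
once are negligible compared with the thickness of one strip.\<close>

lemma near_two_measure_le:
  obtains C where "C \<ge> 0"
    "\<And>s t. 0 \<le> s \<Longrightarrow> 0 \<le> t \<Longrightarrow> measure lborel (near_two R s t) \<le> C * (s * t)"
proof -
  let ?S = "\<lambda>i j s t. cball 0 R \<inter> {x. \<bar>height i x\<bar> \<le> s \<and> \<bar>height j x\<bar> \<le> t}"
  have "\<forall>i\<in>I. \<forall>j\<in>I - {i}. \<exists>C. \<forall>s t. 0 \<le> s \<longrightarrow> 0 \<le> t \<longrightarrow> measure lborel (?S i j s t) \<le> C * (s * t)"
  proof (intro ballI)
    fix i j assume ij: "i \<in> I" "j \<in> I - {i}"
    then have "{x. n i \<bullet> x = b i} \<noteq> {x. n j \<bullet> x = b j}"
      using hyperplanes_distinct by auto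
    from two_strips_measure_le[OF norm_normal norm_normal this, of R] ij
    obtain C where "\<And>s t. 0 \<le> s \<Longrightarrow> 0 \<le> t \<Longrightarrow> measure lborel (?S i j s t) \<le> C * (s * t)"
      by auto
    then show "\<exists>C. \<forall>s t. 0 \<le> s \<longrightarrow> 0 \<le> t \<longrightarrow> measure lborel (?S i j s t) \<le> C * (s * t)"
      by auto
  qed
  then obtain C where C: "\<forall>i\<in>I. \<forall>j\<in>I - {i}. \<forall>s t. 0 \<le> s \<longrightarrow> 0 \<le> t \<longrightarrow> measure lborel (?S i j s t) \<le> C i j * (s * t)"
    by (auto simp only: bchoice_iff)
  define D where "D = (\<Sum>i\<in>I. \<Sum>j\<in>I - {i}. \<bar>C i j\<bar>)"
  show ?thesis
  proof (rule that[of D])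
    show "D \<ge> 0" by (auto simp: D_def intro!: sum_nonneg)
    fix s t :: real assume st: "0 \<le> s" "0 \<le> t"
    have fm: "?S i j s t \<in> fmeasurable lborel" for i j
      by (rule lmeasurable_subset_cball[of _ R]) auto
    have "measure lborel (near_two R s t) \<le> (\<Sum>i\<in>I. measure lborel (\<Union>j\<in>I - {i}. ?S i j s t))"
      unfolding near_two_def using finite_index fm
      by (intro measure_UNION_le) (auto intro!: sets.finite_UN)
    also have "\<dots> \<le> (\<Sum>i\<in>I. \<Sum>j\<in>I - {i}. measure lborel (?S i j s t))"
      using finite_index fm by (intro sum_mono measure_UNION_le) auto
    also have "\<dots> \<le> (\<Sum>i\<in>I. \<Sum>j\<in>I - {i}. \<bar>C i j\<bar> * (s * t))"
      using st by (intro sum_mono order_trans[OF C[rule_format]] mult_right_mono) auto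
    also have "\<dots> = D * (s * t)"
      by (simp add: D_def sum_distrib_right)
    finally show "measure lborel (near_two R s t) \<le> D * (s * t)" .
  qed
qed

end

section \<open>Jumps across an arrangement\<close>

lemma AE_not_on_hyperplane:
  fixes a :: "'a::euclidean_space"
  assumes "a \<noteq> 0"
  shows "AE x in lborel. a \<bullet> x \<noteq> c"
proof (rule AE_I')
  have "{x. a \<bullet> x = c} \<in> null_sets lebesgue"
    using assms negligible_hyperplane[of a c] by (simp add: negligible_iff_null_sets)
  then show "{x. a \<bullet> x = c} \<in> null_sets lborel"
    by (simp add: null_sets_def emeasure_completion)
qed auto

lemma integrable_bounded_on_cball:
  fixes f :: "'a::euclidean_space \<Rightarrow> real"
  assumes [measurable]: "f \<in> borel_measurable borel"
    and bound: "\<And>x. \<bar>f x\<bar> \<le> B" and supp: "\<And>x. f x \<noteq> 0 \<Longrightarrow> x \<in> cball 0 R"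
  shows "integrable lborel f"
proof (rule Bochner_Integration.integrable_bound)
  show "integrable lborel (\<lambda>x. B * indicator (cball (0::'a) R) x)"
    by (intro integrable_mult_right integrable_real_indicator) (use lmeasurable_subset_cball[of "cball (0::'a) R" R] in \<open>auto simp: fmeasurable_def\<close>)
  have "norm (f x) \<le> norm (B * indicator (cball (0::'a) R) x)" for x
    using bound[of x] supp[of x] by (cases "f x = 0") auto
  then show "AE x in lborel. norm (f x) \<le> norm (B * indicator (cball (0::'a) R) x)" by simp
qed simp

lemma abs_integral_le_two_sets:
  fixes f :: "'a \<Rightarrow> real"
  assumes "A \<in> fmeasurable M" "E \<in> fmeasurable M"
    and "AE x in M. \<bar>f x\<bar> \<le> a * indicator A x + c * indicator E x"
  shows "\<bar>\<integral>x. f x \<partial>M\<bar> \<le> a * measure M A + c * measure M E"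
proof -
  have int: "integrable M (\<lambda>x. a * indicator A x + c * indicator E x)"
    using assms by (intro Bochner_Integration.integrable_add integrable_mult_right integrable_real_indicator)
      (auto simp: fmeasurable_def)
  have nn: "AE x in M. 0 \<le> a * indicator A x + c * indicator E x"
    using assms(3) by eventually_elim (use abs_ge_zero order_trans in blast)
  have "\<bar>\<integral>x. f x \<partial>M\<bar> \<le> (\<integral>x. a * indicator A x + c * indicator E x \<partial>M)"
  proof (cases "integrable M f")
    case True
    have "\<bar>\<integral>x. f x \<partial>M\<bar> \<le> (\<integral>x. \<bar>f x\<bar> \<partial>M)" by (rule integral_abs_bound)
    also have "\<dots> \<le> (\<integral>x. a * indicator A x + c * indicator E x \<partial>M)"
      using True int assms(3) by (intro integral_mono_AE) auto
    finally show ?thesis .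
  next
    case False
    \<comment> \<open>The integral of a function that is not integrable is \<open>0\<close> by convention.\<close>
    then show ?thesis using nn by (simp add: not_integrable_integral_eq integral_nonneg_AE)
  qed
  also have "\<dots> = a * measure M A + c * measure M E"
    using assms by (subst Bochner_Integration.integral_add)
      (auto simp: fmeasurable_def intro!: integrable_mult_right integrable_real_indicator)
  finally show ?thesis .
qed

text \<open>The difference \<open>k s - k t\<close> is controlled by the larger argument, so \<open>k\<close> is Cauchy at \<open>0\<close>, and letting
\<open>s\<close> tend to \<open>0\<close> in the hypothesis gives the rate.\<close>

lemma limit_from_Cauchy_at_0:
  fixes k :: "real \<Rightarrow> real"
  assumes C: "\<And>s t. 0 < s \<Longrightarrow> s \<le> t \<Longrightarrow> t \<le> 1 \<Longrightarrow> \<bar>k s - k t\<bar> \<le> C * t"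
  obtains P where "(k \<longlongrightarrow> P) (at_right 0)" "\<And>t. 0 < t \<Longrightarrow> t \<le> 1 \<Longrightarrow> \<bar>k t - P\<bar> \<le> C * t"
proof -
  have C0: "C \<ge> 0" using C[of 1 1] by simp
  define u where "u m = k (1 / real (Suc m))" for m
  have u: "\<bar>u m' - u m\<bar> \<le> C * (1 / real (Suc m))" if "m \<le> m'" for m m'
    unfolding u_def using that by (intro C) (auto simp: field_simps)
  have "Cauchy u"
  proof (rule metric_CauchyI)
    fix e :: real assume "e > 0"
    have "(\<lambda>m. C * (1 / real (Suc m))) \<longlonglongrightarrow> C * 0"
      by (intro tendsto_intros LIMSEQ_inverse_real_of_nat[unfolded inverse_eq_divide])
    then obtain M where M: "C * (1 / real (Suc M)) < e / 2"
      using \<open>e > 0\<close> by (metis (no_types, lifting) eventually_sequentially half_gt_zero mult_zero_right order_refl order_tendstoD(2))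
    have "dist (u m) (u m') < e" if "m \<ge> M" "m' \<ge> M" for m m'
      using u[OF that(1)] u[OF that(2)] M unfolding dist_real_def by linarith
    then show "\<exists>M. \<forall>m\<ge>M. \<forall>n\<ge>M. dist (u m) (u n) < e" by blast
  qed
  then obtain P where P: "u \<longlonglongrightarrow> P"
    by (auto simp: Cauchy_convergent_iff convergent_def)
  have est: "\<bar>k t - P\<bar> \<le> C * t" if t: "0 < t" "t \<le> 1" for t
  proof -
    have "(\<lambda>m. \<bar>k t - u m\<bar>) \<longlonglongrightarrow> \<bar>k t - P\<bar>" by (intro tendsto_intros P)
    moreover have "eventually (\<lambda>m. \<bar>k t - u m\<bar> \<le> C * t) sequentially"
    proof -
      have "eventually (\<lambda>m. 1 / real (Suc m) < t) sequentially"
        using LIMSEQ_inverse_real_of_nat[unfolded inverse_eq_divide] t by (auto dest: order_tendstoD)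
      then show ?thesis
      proof eventually_elim
        case (elim m)
        then show ?case using C[of "1 / real (Suc m)" t] t by (simp add: u_def abs_minus_commute)
      qed
    qed
    ultimately show ?thesis by (rule tendsto_upperbound) simp
  qed
  moreover have "(k \<longlongrightarrow> P) (at_right 0)"
  proof (rule LIM_zero_cancel, rule Lim_null_comparison)
    have "eventually (\<lambda>t. t \<in> {0<..<1::real}) (at_right 0)"
      by (rule eventually_at_right_real) simp
    then show "eventually (\<lambda>t. norm (k t - P) \<le> C * t) (at_right 0)"
      by eventually_elim (use est in auto)
    show "((\<lambda>t. C * t) \<longlongrightarrow> 0) (at_right 0)"
      by (auto intro!: tendsto_eq_intros)
  qed
  ultimately show ?thesis using that by blast
qed

context hyperplane_arrangement
begin

lemma near_two_fmeasurable: "near_two R s t \<in> fmeasurable lborel"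
  by (rule lmeasurable_subset_cball[OF near_two_borel, of _ _ _ R]) (auto simp: near_two_def)

abbreviation mirror :: "'i \<Rightarrow> real^'d \<Rightarrow> real^'d" where
  "mirror i \<equiv> stretch (n i) (b i) (-1)"

lemma height_stretch: "i \<in> I \<Longrightarrow> height i (stretch (n i) (b i) l x) = l * height i x"
  using norm_normal[of i] by (simp add: stretch_def inner_add_right norm_eq_1 algebra_simps)

lemma dist_stretch: "i \<in> I \<Longrightarrow> dist x (stretch (n i) (b i) l x) = \<bar>l - 1\<bar> * \<bar>height i x\<bar>"
  by (simp add: stretch_def dist_norm norm_normal abs_mult)

lemma height_Lipschitz: "i \<in> I \<Longrightarrow> \<bar>height i x - height i y\<bar> \<le> dist x y"
  using Cauchy_Schwarz_ineq2[of "n i" "x - y"] norm_normal[of i]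
  by (simp add: inner_diff_right dist_norm)

lemma same_sideI:
  assumes "i \<in> I" "dist x y < \<bar>height i x\<bar>"
  shows "height i x * height i y > 0"
  using height_Lipschitz[OF assms(1), of x y] assms(2)
  by (cases "height i x > 0") (auto simp: zero_less_mult_iff)

lemma stretch_stretch:
  assumes "i \<in> I"
  shows "stretch (n i) (b i) l (stretch (n i) (b i) l' x) = stretch (n i) (b i) (l * l') x"
proof -
  have "stretch (n i) (b i) l (stretch (n i) (b i) l' x)
      = x + (((l' - 1) * height i x) *\<^sub>R n i + ((l - 1) * (l' * height i x)) *\<^sub>R n i)"
    unfolding stretch_def[of _ _ l] height_stretch[OF assms] by (simp add: stretch_def)
  also have "((l' - 1) * height i x) *\<^sub>R n i + ((l - 1) * (l' * height i x)) *\<^sub>R n i = ((l * l' - 1) * height i x) *\<^sub>R n i"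
    unfolding scaleR_left_distrib[symmetric] by (simp add: algebra_simps)
  finally show ?thesis by (simp add: stretch_def)
qed

lemma mirror_mirror: "i \<in> I \<Longrightarrow> mirror i (mirror i x) = x"
  by (simp add: stretch_stretch) (simp add: stretch_def)

end

text \<open>A weight \<open>D x y\<close> for the jump of a function between \<open>x\<close> and \<open>y\<close>.  The unsigned jump (\<open>\<kappa> = 1\<close>) and
the signed jump (\<open>\<kappa> = -1\<close>) are treated together: the first one gives the nonlocal energy, the second
one the divergence theorem.\<close>

locale jump_density = hyperplane_arrangement I n b
  for I :: "'i set" and n :: "'i \<Rightarrow> real^'d" and b :: "'i \<Rightarrow> real" +
  fixes D :: "real^'d \<Rightarrow> real^'d \<Rightarrow> real" and R \<kappa> :: real
  assumes D_borel: "(\<lambda>p. D (fst p) (snd p)) \<in> borel_measurable (borel \<Otimes>\<^sub>M borel)"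
    and D_bound: "\<bar>D x y\<bar> \<le> 1"
    and D_support: "D x y \<noteq> 0 \<Longrightarrow> x \<in> cball 0 R \<and> y \<in> cball 0 R"
    and D_same_cell: "same_cell x y \<Longrightarrow> D x y = 0"
    and D_cong: "same_cell x x' \<Longrightarrow> same_cell y y' \<Longrightarrow> D x y = D x' y'"
    and D_swap: "D y x = \<kappa> * D x y"
    and sign: "\<kappa> = 1 \<or> \<kappa> = -1"
begin

lemma D_measurable [measurable (raw)]:
  "f \<in> borel_measurable M \<Longrightarrow> g \<in> borel_measurable M \<Longrightarrow> (\<lambda>x. D (f x) (g x)) \<in> borel_measurable M"
  using measurable_compose[OF measurable_Pair[of f M borel g borel] D_borel] by simp

text \<open>Divided by \<open>t\<close>, this approximates the surface integral of \<open>\<psi>\<close> times the jump from the lower to the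
upper side of the \<open>i\<close>-th hyperplane.\<close>

definition slab_integral :: "(real^'d \<Rightarrow> real) \<Rightarrow> 'i \<Rightarrow> real \<Rightarrow> real" where
  "slab_integral \<psi> i t =
     (\<integral>x. indicator {x. 0 < height i x \<and> height i x < t} x * (D (mirror i x) x * \<psi> x) \<partial>lborel)"

context
  fixes \<psi> :: "real^'d \<Rightarrow> real" and L B :: real
  assumes lip: "L-lipschitz_on UNIV \<psi>" and bd: "\<And>x. \<bar>\<psi> x\<bar> \<le> B"
begin

lemma psi_borel [measurable]: "\<psi> \<in> borel_measurable borel"
  using lip by (intro borel_measurable_continuous_onI lipschitz_on_continuous_on)

lemma L_nonneg: "L \<ge> 0" and B_nonneg: "B \<ge> 0"
  using lipschitz_on_nonneg[OF lip] order_trans[OF abs_ge_zero bd[of 0]] by auto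

lemma psi_diff: "\<bar>\<psi> x - \<psi> y\<bar> \<le> L * dist x y"
  using lipschitz_onD[OF lip, of x y] by (simp add: dist_real_def)

lemma D_psi_bound: "\<bar>D x y * \<psi> z\<bar> \<le> B"
  using mult_mono[OF D_bound[of x y] bd[of z]] B_nonneg by (simp add: abs_mult)

lemma integrable_D_psi:
  assumes [measurable]: "S \<in> sets borel" "f \<in> borel_measurable borel" "g \<in> borel_measurable borel" "h \<in> borel_measurable borel"
    and supp: "\<And>x. D (f x) (g x) \<noteq> 0 \<Longrightarrow> x \<in> cball 0 R'"
  shows "integrable lborel (\<lambda>x. indicator S x * (D (f x) (g x) * \<psi> (h x)))"
proof (rule integrable_bounded_on_cball)
  show "\<bar>indicator S x * (D (f x) (g x) * \<psi> (h x))\<bar> \<le> B" for x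
    using D_psi_bound[of "f x" "g x" "h x"] B_nonneg by (auto simp: indicator_def abs_mult)
qed (use supp in auto)

text \<open>Stretching by \<open>l\<close> maps the layer of thickness \<open>t\<close> onto the one of thickness \<open>l * t\<close>.  It moves
neither \<open>x\<close> nor its mirror image to a different cell unless \<open>x\<close> is close to a second hyperplane,
so the integrand changes by \<open>O(t)\<close> on a set of volume \<open>O(t)\<close>, and by a bounded amount on a set
of volume \<open>O(t\<^sup>2)\<close>.\<close>

lemma slab_integral_scaling:
  obtains C where "C \<ge> 0" "\<And>i t l. i \<in> I \<Longrightarrow> 0 < t \<Longrightarrow> t \<le> 1 \<Longrightarrow> 0 < l \<Longrightarrow> l \<le> 1 \<Longrightarrow>
    \<bar>slab_integral \<psi> i (l * t) - l * slab_integral \<psi> i t\<bar> \<le> l * (C * t\<^sup>2)"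
proof -
  \<comment> \<open>The radius is enlarged because the stretched point, and not \<open>x\<close>, may be the one in the support of \<open>D\<close>.\<close>
  obtain A where A: "A \<ge> 0" "\<And>s t. 0 \<le> s \<Longrightarrow> 0 \<le> t \<Longrightarrow> measure lborel (near_two (R + 2) s t) \<le> A * (s * t)"
    using near_two_measure_le[of "R + 2"] by metis
  define V where "V = measure lborel (cball (0::real^'d) (R + 2 + 1))"
  show thesis
  proof (rule that[of "2 * B * (A * 2) + L * V"])
    show "2 * B * (A * 2) + L * V \<ge> 0"
      using A B_nonneg L_nonneg by (simp add: V_def)
    fix i t l assume i: "i \<in> I" and t: "0 < t" "t \<le> (1::real)" and l: "0 < l" "l \<le> (1::real)"
    let ?S = "stretch (n i) (b i) l" and ?J = "{x. 0 < height i x \<and> height i x < t}"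
    let ?q = "\<lambda>x. D (mirror i x) x * \<psi> x"
    let ?N = "near_two (R + 2) t (2 * t)" and ?E = "cball 0 (R + 2) \<inter> {x. \<bar>height i x\<bar> \<le> t}"
    have "slab_integral \<psi> i (l * t) = l * (\<integral>x. indicator {x. 0 < height i x \<and> height i x < l * t} (?S x) * ?q (?S x) \<partial>lborel)"
      unfolding slab_integral_def using l i
      by (subst integral_stretch[where b = "b i" and n = "n i" and l = l]) (auto simp: norm_normal)
    also have "(\<lambda>x. indicator {x. 0 < height i x \<and> height i x < l * t} (?S x) :: real) = indicator ?J"
    proof
      fix x
      show "indicator {x. 0 < height i x \<and> height i x < l * t} (?S x) = (indicator ?J x :: real)"
        unfolding indicator_def mem_Collect_eq height_stretch[OF i] using l by (simp add: zero_less_mult_iff)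
    qed
    finally have "slab_integral \<psi> i (l * t) - l * slab_integral \<psi> i t =
        l * ((\<integral>x. indicator ?J x * ?q (?S x) \<partial>lborel) - (\<integral>x. indicator ?J x * ?q x \<partial>lborel))"
      by (simp add: slab_integral_def right_diff_distrib)
    also have "(\<integral>x. indicator ?J x * ?q (?S x) \<partial>lborel) - (\<integral>x. indicator ?J x * ?q x \<partial>lborel)
       = (\<integral>x. indicator ?J x * (?q (?S x) - ?q x) \<partial>lborel)"
    proof -
      have "integrable lborel (\<lambda>x. indicator ?J x * ?q x)"
        by (rule integrable_D_psi[where R' = R]) (auto dest: D_support)
      moreover have "integrable lborel (\<lambda>x. indicator ?J x * ?q (?S x))"
      proof (rule integrable_bounded_on_cball[where R = "R + 2"])
        show "\<bar>indicator ?J x * ?q (?S x)\<bar> \<le> B" for x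
          using D_psi_bound[of "mirror i (?S x)" "?S x" "?S x"] B_nonneg by (auto simp: indicator_def abs_mult)
        fix x assume "indicator ?J x * ?q (?S x) \<noteq> 0"
        then have x: "\<bar>height i x\<bar> \<le> 1" "?S x \<in> cball 0 R" using t D_support by (auto simp: indicator_def split: if_splits)
        have "dist x (?S x) \<le> 1 * 1"
          unfolding dist_stretch[OF i] using x l by (intro mult_mono) auto
        with x(2) show "x \<in> cball 0 (R + 2)"
          using norm_triangle_ineq2[of x "?S x"] by (auto simp: dist_norm)
      qed simp
      ultimately show ?thesis
        by (subst Bochner_Integration.integral_diff[symmetric]) (auto simp: right_diff_distrib)
    qed
    finally have eq: "slab_integral \<psi> i (l * t) - l * slab_integral \<psi> i t = l * (\<integral>x. indicator ?J x * (?q (?S x) - ?q x) \<partial>lborel)" .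
    have pt: "\<bar>indicator ?J x * (?q (?S x) - ?q x)\<bar> \<le> (2 * B) * indicator ?N x + (L * t) * indicator ?E x" for x
    proof (cases "x \<in> ?J \<and> ?q (?S x) - ?q x \<noteq> 0")
      case False
      then show ?thesis using B_nonneg L_nonneg t by (auto simp: indicator_def)
    next
      case True
      then have h: "0 < height i x" "height i x < t" by auto
      have d: "dist x (?S x) \<le> t" "dist x (mirror i x) < 2 * t" "dist x (mirror i (?S x)) < 2 * t"
      proof -
        have "dist x (?S x) \<le> 1 * t"
          unfolding dist_stretch[OF i] using h l by (intro mult_mono) auto
        then show "dist x (?S x) \<le> t" by simp
        show "dist x (mirror i x) < 2 * t" using h by (simp add: dist_stretch[OF i])
        have "mirror i (?S x) = stretch (n i) (b i) (- l) x"
          by (simp add: stretch_stretch[OF i])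
        then have "dist x (mirror i (?S x)) = (1 + l) * height i x"
          using h l by (simp add: dist_stretch[OF i])
        also have "\<dots> \<le> 2 * height i x" using h l by (intro mult_right_mono) auto
        also have "\<dots> < 2 * t" using h by simp
        finally show "dist x (mirror i (?S x)) < 2 * t" .
      qed
      have "x \<in> cball 0 (R + 2)"
      proof -
        have "x \<in> cball 0 R \<or> ?S x \<in> cball 0 R"
          using True D_support[of "mirror i x" x] D_support[of "mirror i (?S x)" "?S x"]
          by (cases "D (mirror i x) x = 0"; cases "D (mirror i (?S x)) (?S x) = 0") auto
        then show ?thesis using d(1) t norm_triangle_ineq2[of x "?S x"] by (auto simp: dist_norm)
      qed
      then have E: "x \<in> ?E" using h by auto
      show ?thesis
      proof (cases "x \<in> ?N")
        case True
        have "\<bar>?q (?S x) - ?q x\<bar> \<le> 2 * B"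
          using D_psi_bound[of "mirror i (?S x)" "?S x" "?S x"] D_psi_bound[of "mirror i x" x x] by linarith
        moreover have "0 \<le> L * t" using L_nonneg t by simp
        ultimately show ?thesis using True E h by (auto simp: indicator_def)
      next
        case False
        have far: "\<bar>height j x\<bar> > 2 * t" if "j \<in> I" "j \<noteq> i" for j
          using False E i h that by (auto simp: near_two_def not_le)
        have sc: "same_cell x (?S x)" 
          unfolding same_cell_def
        proof
          fix j assume j: "j \<in> I"
          show "height j x * height j (?S x) > 0"
          proof (cases "j = i")
            case True then show ?thesis using h l by (simp add: height_stretch i)
          next
            case False then show ?thesis using far[OF j False] d t by (intro same_sideI j) auto
          qed
        qed
        have sm: "same_cell (mirror i x) (mirror i (?S x))"
          unfolding same_cell_def
        proof
          fix j assume j: "j \<in> I"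
          show "height j (mirror i x) * height j (mirror i (?S x)) > 0"
          proof (cases "j = i")
            case True
            have "height i (mirror i x) * height i (mirror i (?S x)) = l * (height i x * height i x)"
              unfolding height_stretch[OF i] by (simp add: algebra_simps)
            then show ?thesis using True h l by simp
          next
            case False
            then have "height j x * height j (mirror i x) > 0" "height j x * height j (mirror i (?S x)) > 0"
              using far[OF j False] d t by (auto intro!: same_sideI j)
            then show ?thesis by (auto simp: zero_less_mult_iff)
          qed
        qed
        have "?q (?S x) - ?q x = D (mirror i x) x * (\<psi> (?S x) - \<psi> x)"
          using D_cong[OF sm sc] by (simp add: algebra_simps)
        also have "\<bar>\<dots>\<bar> \<le> 1 * (L * t)"
          unfolding abs_mult
        proof (intro mult_mono D_bound)
          show "\<bar>\<psi> (?S x) - \<psi> x\<bar> \<le> L * t"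
            using psi_diff[of "?S x" x] mult_left_mono[OF d(1) L_nonneg] by (simp add: dist_commute)
        qed auto
        finally show ?thesis using E B_nonneg h by (auto simp: indicator_def)
      qed
    qed
    have "\<bar>\<integral>x. indicator ?J x * (?q (?S x) - ?q x) \<partial>lborel\<bar> \<le> (2 * B) * measure lborel ?N + (L * t) * measure lborel ?E"
      by (rule abs_integral_le_two_sets[OF near_two_fmeasurable lmeasurable_subset_cball[of _ "R + 2"]]) (use pt in auto)
    also have "\<dots> \<le> (2 * B) * (A * (t * (2 * t))) + (L * t) * (t * V)"
      using A(2)[of t "2 * t"] strip_measure_le[OF norm_normal[OF i], of t "R + 2" "b i"] B_nonneg L_nonneg t
      by (intro add_mono mult_left_mono) (auto simp: V_def)
    also have "\<dots> = (2 * B * (A * 2) + L * V) * t\<^sup>2"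
      by (simp add: power2_eq_square algebra_simps)
    finally show "\<bar>slab_integral \<psi> i (l * t) - l * slab_integral \<psi> i t\<bar> \<le> l * ((2 * B * (A * 2) + L * V) * t\<^sup>2)"
      unfolding eq using l by (simp add: abs_mult)
  qed
qed

lemma slab_integral_flux:
  obtains C P where "C \<ge> 0" "\<And>i. i \<in> I \<Longrightarrow> ((\<lambda>t. slab_integral \<psi> i t / t) \<longlongrightarrow> P i) (at_right 0)"
    "\<And>i t. i \<in> I \<Longrightarrow> 0 < t \<Longrightarrow> t \<le> 1 \<Longrightarrow> \<bar>slab_integral \<psi> i t - t * P i\<bar> \<le> C * t\<^sup>2"
proof -
  obtain C where C: "C \<ge> 0" "\<And>i t l. i \<in> I \<Longrightarrow> 0 < t \<Longrightarrow> t \<le> 1 \<Longrightarrow> 0 < l \<Longrightarrow> l \<le> 1 \<Longrightarrow>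
    \<bar>slab_integral \<psi> i (l * t) - l * slab_integral \<psi> i t\<bar> \<le> l * (C * t\<^sup>2)"
    using slab_integral_scaling by metis
  have "\<exists>P. ((\<lambda>t. slab_integral \<psi> i t / t) \<longlongrightarrow> P) (at_right 0) \<and>
      (\<forall>t. 0 < t \<longrightarrow> t \<le> 1 \<longrightarrow> \<bar>slab_integral \<psi> i t / t - P\<bar> \<le> C * t)" if i: "i \<in> I" for i
  proof -
    have "\<bar>slab_integral \<psi> i s / s - slab_integral \<psi> i t / t\<bar> \<le> C * t" if "0 < s" "s \<le> t" "t \<le> 1" for s t
    proof -
      have "\<bar>slab_integral \<psi> i s - (s / t) * slab_integral \<psi> i t\<bar> \<le> (s / t) * (C * t\<^sup>2)"
        using C(2)[OF i, of t "s / t"] that by simp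
      also have "(s / t) * (C * t\<^sup>2) = s * (C * t)"
        using that by (simp add: power2_eq_square)
      also have "slab_integral \<psi> i s - (s / t) * slab_integral \<psi> i t = s * (slab_integral \<psi> i s / s - slab_integral \<psi> i t / t)"
        using that by (simp add: field_simps)
      finally show ?thesis using that by (simp add: abs_mult)
    qed
    then show ?thesis
      by (rule limit_from_Cauchy_at_0[of "\<lambda>t. slab_integral \<psi> i t / t"]) auto
  qed
  then obtain P where P: "\<And>i. i \<in> I \<Longrightarrow> ((\<lambda>t. slab_integral \<psi> i t / t) \<longlongrightarrow> P i) (at_right 0)"
    "\<And>i t. i \<in> I \<Longrightarrow> 0 < t \<Longrightarrow> t \<le> 1 \<Longrightarrow> \<bar>slab_integral \<psi> i t / t - P i\<bar> \<le> C * t"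
    by metis
  have "\<bar>slab_integral \<psi> i t - t * P i\<bar> \<le> C * t\<^sup>2" if "i \<in> I" "0 < t" "t \<le> 1" for i t
  proof -
    have "slab_integral \<psi> i t - t * P i = t * (slab_integral \<psi> i t / t - P i)"
      using that by (simp add: right_diff_distrib)
    then have "\<bar>slab_integral \<psi> i t - t * P i\<bar> = t * \<bar>slab_integral \<psi> i t / t - P i\<bar>"
      using that by (simp add: abs_mult)
    also have "\<dots> \<le> t * (C * t)" using P(2)[OF that] that by (intro mult_left_mono) auto
    finally show ?thesis by (simp add: power2_eq_square algebra_simps)
  qed
  with C(1) P(1) that show ?thesis by blast
qed

definition crossing :: "real^'d \<Rightarrow> 'i \<Rightarrow> (real^'d) set" where
  "crossing v i = {x. height i x * (height i x + n i \<bullet> v) < 0}"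

lemma crossing_borel [measurable]: "crossing v i \<in> sets borel"
  unfolding crossing_def by measurable

text \<open>Away from the points that are close to two hyperplanes, a short displacement crosses at most one
of them, and its end point then lies in the cell of the mirror image of \<open>x\<close>.\<close>

lemma jump_eq_sum_crossings:
  assumes v: "norm v \<le> t" and off: "\<And>i. i \<in> I \<Longrightarrow> height i x \<noteq> 0" "\<And>i. i \<in> I \<Longrightarrow> height i (x + v) \<noteq> 0"
    and far: "x \<notin> near_two R t (2 * t)"
  shows "D x (x + v) = (\<Sum>i\<in>I. indicator (crossing v i) x * D x (mirror i x))"
proof (cases "x \<in> cball 0 R")
  case False
  then have "D x y = 0" for y using D_support[of x y] by auto
  then show ?thesis by simp
next
  case xR: True
  have hv: "height i (x + v) = height i x + n i \<bullet> v" for i by (simp add: inner_add_right)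
  show ?thesis
  proof (cases "\<exists>i\<in>I. x \<in> crossing v i")
    case False
    have "same_cell x (x + v)"
      unfolding same_cell_def
    proof
      fix i assume "i \<in> I"
      with False off[OF this] show "height i x * height i (x + v) > 0"
        unfolding crossing_def hv by (auto simp: not_less zero_less_mult_iff mult_le_0_iff le_less)
    qed
    then show ?thesis using False by (simp add: D_same_cell)
  next
    case True
    then obtain i where i: "i \<in> I" "x \<in> crossing v i" by blast
    have nv: "\<bar>n j \<bullet> v\<bar> \<le> t" if "j \<in> I" for j
      using Cauchy_Schwarz_ineq2[of "n j" v] norm_normal[OF that] v by simp
    have small: "\<bar>height j x\<bar> < t" if "j \<in> I" "x \<in> crossing v j" for j
      using nv[OF that(1)] that(2) by (auto simp: crossing_def mult_less_0_iff)
    have farj: "\<bar>height j x\<bar> > 2 * t" if "j \<in> I" "j \<noteq> i" for j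
      using far xR i small[OF i] that by (fastforce simp: near_two_def not_le)
    have t: "t > 0" using small[OF i] by linarith
    have only: "x \<notin> crossing v j" if "j \<in> I" "j \<noteq> i" for j
      using farj[OF that] small[of j] that t by fastforce
    have "same_cell (x + v) (mirror i x)"
      unfolding same_cell_def
    proof
      fix j assume j: "j \<in> I"
      show "height j (x + v) * height j (mirror i x) > 0"
      proof (cases "j = i")
        case True
        have "height i x * (height i (x + v) ) < 0" using i unfolding crossing_def hv by simp
        then show ?thesis unfolding True height_stretch[OF i(1)] by (simp add: algebra_simps)
      next
        case False
        have "height j x * height j (x + v) > 0"
          using farj[OF j False] v t by (intro same_sideI j) (auto simp: dist_norm)
        moreover have "height j x * height j (mirror i x) > 0"
          using farj[OF j False] small[OF i] t by (intro same_sideI j) (auto simp: dist_stretch[OF i(1)])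
        ultimately show ?thesis by (auto simp: zero_less_mult_iff)
      qed
    qed
    moreover have "same_cell x x"
      using off by (auto simp: same_cell_def zero_less_mult_iff linorder_neq_iff)
    ultimately have "D x (x + v) = D x (mirror i x)" by (intro D_cong)
    moreover have "(\<Sum>j\<in>I. indicator (crossing v j) x * D x (mirror j x)) = indicator (crossing v i) x * D x (mirror i x)"
      using finite_index i only by (intro sum.mono_neutral_cong_right[where S = "{i}", simplified, THEN trans]) auto
    ultimately show ?thesis using i by simp
  qed
qed

text \<open>The points at which the displacement \<open>v\<close> crosses the \<open>i\<close>-th hyperplane form a layer of thickness
\<open>|n i \<bullet> v|\<close>, on the lower side if \<open>n i \<bullet> v > 0\<close> and on the upper side otherwise.  In the
first case the reflection moves it to the upper side, at the cost of the Lipschitz error for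
\<open>\<psi>\<close>; in the second case \<open>D\<close> has to be reversed, which contributes the factor \<open>\<kappa>\<close>.\<close>

lemma crossing_integral_flux:
  assumes C: "\<And>t. 0 < t \<Longrightarrow> t \<le> 1 \<Longrightarrow> \<bar>slab_integral \<psi> i t - t * P\<bar> \<le> C * t\<^sup>2"
    and i: "i \<in> I" and v: "norm v \<le> 1"
  shows "\<bar>(\<integral>x. indicator (crossing v i) x * (D x (mirror i x) * \<psi> x) \<partial>lborel)
     - (if \<kappa> = 1 then \<bar>n i \<bullet> v\<bar> else n i \<bullet> v) * P\<bar>
    \<le> (C + 2 * L * measure lborel (cball (0::real^'d) (R + 1))) * (n i \<bullet> v)\<^sup>2"
proof -
  define s where "s = n i \<bullet> v"
  define V where "V = measure lborel (cball (0::real^'d) (R + 1))"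
  have V: "V \<ge> 0" by (simp add: V_def)
  have s1: "\<bar>s\<bar> \<le> 1"
    using Cauchy_Schwarz_ineq2[of "n i" v] norm_normal[OF i] v by (simp add: s_def)
  consider "s = 0" | "s < 0" | "s > 0" by linarith
  then show ?thesis
  proof cases
    case 1
    then have "crossing v i = {}" by (auto simp: crossing_def s_def[symmetric] not_less)
    with 1 show ?thesis by (simp add: s_def[symmetric])
  next
    case 2
    have cr: "crossing v i = {x. 0 < height i x \<and> height i x < - s}"
      using 2 by (auto simp: crossing_def s_def[symmetric] mult_less_0_iff)
    have "(\<integral>x. indicator (crossing v i) x * (D x (mirror i x) * \<psi> x) \<partial>lborel) = \<kappa> * slab_integral \<psi> i (- s)"
      unfolding slab_integral_def cr Bochner_Integration.integral_mult_right_zero[symmetric]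
      using sign by (intro Bochner_Integration.integral_cong) (auto simp: D_swap[of "mirror i _"])
    moreover have "(if \<kappa> = 1 then \<bar>s\<bar> else s) = \<kappa> * (- s)" using sign 2 by auto
    moreover have "\<bar>\<kappa> * slab_integral \<psi> i (- s) - \<kappa> * (- s) * P\<bar> \<le> C * s\<^sup>2"
    proof -
      have "\<kappa> * slab_integral \<psi> i (- s) - \<kappa> * (- s) * P = \<kappa> * (slab_integral \<psi> i (- s) - (- s) * P)"
        by (simp add: algebra_simps)
      then show ?thesis using C[of "- s"] sign 2 s1 by (auto simp: abs_mult)
    qed
    moreover have "C * s\<^sup>2 \<le> (C + 2 * L * V) * s\<^sup>2"
      using L_nonneg V by (simp add: distrib_right)
    ultimately show ?thesis unfolding s_def[symmetric] V_def[symmetric] by simp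
  next
    case 3
    let ?J = "{x. 0 < height i x \<and> height i x < s}" and ?E = "cball 0 R \<inter> {x. \<bar>height i x\<bar> \<le> s}"
    have cr: "crossing v i = {x. - s < height i x \<and> height i x < 0}"
      using 3 by (auto simp: crossing_def s_def[symmetric] mult_less_0_iff)
    have cm: "indicator {x. - s < height i x \<and> height i x < 0} (mirror i x) = (indicator ?J x :: real)" for x
      unfolding indicator_def mem_Collect_eq height_stretch[OF i] by auto
    have "(\<integral>x. indicator (crossing v i) x * (D x (mirror i x) * \<psi> x) \<partial>lborel)
        = (\<integral>x. indicator ?J x * (D (mirror i x) x * \<psi> (mirror i x)) \<partial>lborel)"
      using integral_stretch[where n = "n i" and b = "b i" and l = "-1"
          and f = "\<lambda>x. indicator (crossing v i) x * (D x (mirror i x) * \<psi> x)"] norm_normal[OF i]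
      by (simp only: mirror_mirror[OF i] cr cm) simp
    then have "(\<integral>x. indicator (crossing v i) x * (D x (mirror i x) * \<psi> x) \<partial>lborel) - slab_integral \<psi> i s
       = (\<integral>x. indicator ?J x * (D (mirror i x) x * \<psi> (mirror i x)) - indicator ?J x * (D (mirror i x) x * \<psi> x) \<partial>lborel)"
      unfolding slab_integral_def
      by (subst Bochner_Integration.integral_diff) (auto intro!: integrable_D_psi[where R' = R] dest: D_support)
    moreover have "\<bar>\<integral>x. indicator ?J x * (D (mirror i x) x * \<psi> (mirror i x)) - indicator ?J x * (D (mirror i x) x * \<psi> x) \<partial>lborel\<bar>
       \<le> 0 * measure lborel ({}::(real^'d) set) + (2 * L * s) * measure lborel ?E"
    proof (rule abs_integral_le_two_sets)
      show "?E \<in> fmeasurable lborel" by (rule lmeasurable_subset_cball[of _ R]) auto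
      have "\<bar>indicator ?J x * (D (mirror i x) x * \<psi> (mirror i x)) - indicator ?J x * (D (mirror i x) x * \<psi> x)\<bar>
          \<le> (2 * L * s) * indicator ?E x" for x
      proof (cases "x \<in> ?J \<and> x \<in> cball 0 R")
        case True
        have "\<bar>D (mirror i x) x * (\<psi> (mirror i x) - \<psi> x)\<bar> \<le> 1 * (L * (2 * s))"
          unfolding abs_mult
        proof (intro mult_mono D_bound)
          have "dist (mirror i x) x \<le> 2 * s"
            using True by (simp add: dist_commute[of _ x] dist_stretch[OF i])
          then show "\<bar>\<psi> (mirror i x) - \<psi> x\<bar> \<le> L * (2 * s)"
            using psi_diff[of "mirror i x" x] L_nonneg by (meson mult_left_mono order_trans)
        qed auto
        then show ?thesis using True by (simp add: right_diff_distrib)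
      next
        case False
        then have "x \<notin> ?J \<or> D (mirror i x) x = 0" using D_support[of "mirror i x" x] by auto
        then show ?thesis using L_nonneg 3 by (auto simp: indicator_def)
      qed
      then show "AE x in lborel. \<bar>indicator ?J x * (D (mirror i x) x * \<psi> (mirror i x)) - indicator ?J x * (D (mirror i x) x * \<psi> x)\<bar>
          \<le> 0 * indicator {} x + (2 * L * s) * indicator ?E x" by simp
    qed simp
    moreover have "(2 * L * s) * measure lborel ?E \<le> (2 * L * s) * (s * V)"
      unfolding V_def using strip_measure_le[OF norm_normal[OF i], of s R "b i"] L_nonneg 3 by (intro mult_left_mono) auto
    moreover have "(2 * L * s) * (s * V) = 2 * L * V * s\<^sup>2" by (simp add: power2_eq_square)
    moreover have "\<bar>slab_integral \<psi> i s - s * P\<bar> \<le> C * s\<^sup>2" using C 3 s1 by simp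
    moreover have "(if \<kappa> = 1 then \<bar>s\<bar> else s) = s" using 3 by simp
    ultimately show ?thesis unfolding s_def[symmetric] V_def[symmetric] by (simp add: distrib_right)
  qed
qed

text \<open>Up to a quadratic error, a displacement by \<open>t *\<^sub>R z\<close> sees the jump across each hyperplane on a layer
whose thickness is \<open>t\<close> times the normal component of \<open>z\<close>.  The constant does not depend on \<open>z\<close>, so
the estimate can be integrated over the unit ball.\<close>

theorem translation_jump_expansion:
  shows "\<exists>C P. C \<ge> 0 \<and> (\<forall>i\<in>I. ((\<lambda>t. slab_integral \<psi> i t / t) \<longlongrightarrow> P i) (at_right 0)) \<and>
    (\<forall>t z. 0 < t \<longrightarrow> t \<le> 1 \<longrightarrow> norm z \<le> 1 \<longrightarrow>
      \<bar>(\<integral>x. D x (x + t *\<^sub>R z) * \<psi> x \<partial>lborel)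
        - t * (\<Sum>i\<in>I. (if \<kappa> = 1 then \<bar>n i \<bullet> z\<bar> else n i \<bullet> z) * P i)\<bar> \<le> C * t\<^sup>2)"
proof -
  obtain C P where C: "C \<ge> 0" and P: "\<And>i. i \<in> I \<Longrightarrow> ((\<lambda>t. slab_integral \<psi> i t / t) \<longlongrightarrow> P i) (at_right 0)"
    and CP: "\<And>i t. i \<in> I \<Longrightarrow> 0 < t \<Longrightarrow> t \<le> 1 \<Longrightarrow> \<bar>slab_integral \<psi> i t - t * P i\<bar> \<le> C * t\<^sup>2"
    by (rule slab_integral_flux) (rule that; blast)
  obtain A where A: "A \<ge> 0" "\<And>s t. 0 \<le> s \<Longrightarrow> 0 \<le> t \<Longrightarrow> measure lborel (near_two R s t) \<le> A * (s * t)"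
    using near_two_measure_le[of R] by metis
  define C1 where "C1 = C + 2 * L * measure lborel (cball (0::real^'d) (R + 1))"
  define N where "N = real (card I)"
  have C1: "C1 \<ge> 0" using C L_nonneg by (simp add: C1_def)
  show ?thesis
  proof (rule exI[of _ "(1 + N) * B * (A * 2) + N * C1"], rule exI[of _ P], intro conjI ballI allI impI)
    show "(1 + N) * B * (A * 2) + N * C1 \<ge> 0" using A B_nonneg C1 by (simp add: N_def)
    fix t z assume t: "0 < t" "t \<le> (1::real)" and z: "norm (z::real^'d) \<le> 1"
    let ?v = "t *\<^sub>R z"
    let ?F = "\<lambda>x. D x (x + ?v) * \<psi> x" and ?G = "\<lambda>i x. indicator (crossing ?v i) x * (D x (mirror i x) * \<psi> x)"
    let ?w = "\<lambda>i z. if \<kappa> = 1 then \<bar>n i \<bullet> z\<bar> else n i \<bullet> z"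
    let ?N = "near_two R t (2 * t)"
    have nv: "norm ?v \<le> t" using z t by (simp add: mult_left_le)
    have "integrable lborel (\<lambda>x. indicator UNIV x * ?F x)"
      by (rule integrable_D_psi[where R' = R]) (auto dest: D_support)
    then have intF: "integrable lborel ?F" by simp
    have intG: "integrable lborel (?G i)" for i
      by (rule integrable_D_psi[where R' = R]) (auto dest: D_support)
    have "AE x in lborel. \<forall>i\<in>I. height i x \<noteq> 0 \<and> height i (x + ?v) \<noteq> 0"
    proof (intro AE_finite_allI finite_index)
      fix i assume "i \<in> I"
      then have "n i \<noteq> 0" using norm_normal[of i] by auto
      from AE_not_on_hyperplane[OF this, of "b i"] AE_not_on_hyperplane[OF this, of "b i - n i \<bullet> ?v"]
      show "AE x in lborel. height i x \<noteq> 0 \<and> height i (x + ?v) \<noteq> 0"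
        by eventually_elim (auto simp: inner_add_right)
    qed
    then have pt: "AE x in lborel. \<bar>?F x - (\<Sum>i\<in>I. ?G i x)\<bar> \<le> ((1 + N) * B) * indicator ?N x + 0 * indicator {} x"
    proof eventually_elim
      case (elim x)
      show ?case
      proof (cases "x \<in> ?N")
        case False
        then have "D x (x + ?v) = (\<Sum>i\<in>I. indicator (crossing ?v i) x * D x (mirror i x))"
          using elim by (intro jump_eq_sum_crossings[OF nv]) auto
        then have "?F x = (\<Sum>i\<in>I. ?G i x)"
          by (simp add: sum_distrib_right mult.assoc)
        then show ?thesis using False by simp
      next
        case True
        have "\<bar>?G i x\<bar> \<le> B" for i
          using D_psi_bound[of x "mirror i x" x] B_nonneg by (auto simp: indicator_def)
        then have "\<bar>\<Sum>i\<in>I. ?G i x\<bar> \<le> (\<Sum>i\<in>I. B)"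
          by (rule order_trans[OF sum_abs sum_mono])
        also have "\<dots> = N * B" by (simp add: N_def)
        finally have "\<bar>?F x - (\<Sum>i\<in>I. ?G i x)\<bar> \<le> B + N * B"
          using D_psi_bound[of x "x + ?v" x] abs_triangle_ineq4[of "?F x" "\<Sum>i\<in>I. ?G i x"] by linarith
        then show ?thesis using True by (simp add: distrib_right)
      qed
    qed
    have "\<bar>\<integral>x. ?F x - (\<Sum>i\<in>I. ?G i x) \<partial>lborel\<bar> \<le> ((1 + N) * B) * measure lborel ?N + 0 * measure lborel ({}::(real^'d) set)"
      by (rule abs_integral_le_two_sets[OF near_two_fmeasurable _ pt]) simp
    also have "\<dots> \<le> ((1 + N) * B) * (A * (t * (2 * t))) + 0 * 0"
      using A(2)[of t "2 * t"] t B_nonneg by (intro add_mono mult_left_mono) (auto simp: N_def)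
    also have "\<dots> = (1 + N) * B * (A * 2) * t\<^sup>2" by (simp add: power2_eq_square)
    also have "(\<integral>x. ?F x - (\<Sum>i\<in>I. ?G i x) \<partial>lborel) = (\<integral>x. ?F x \<partial>lborel) - (\<Sum>i\<in>I. \<integral>x. ?G i x \<partial>lborel)"
      by (simp only: Bochner_Integration.integral_diff[OF intF Bochner_Integration.integrable_sum[OF intG]]
          Bochner_Integration.integral_sum[OF intG])
    finally have 1: "\<bar>(\<integral>x. ?F x \<partial>lborel) - (\<Sum>i\<in>I. \<integral>x. ?G i x \<partial>lborel)\<bar> \<le> (1 + N) * B * (A * 2) * t\<^sup>2" .
    have "\<bar>(\<Sum>i\<in>I. \<integral>x. ?G i x \<partial>lborel) - (\<Sum>i\<in>I. ?w i ?v * P i)\<bar> \<le> (\<Sum>i\<in>I. C1 * t\<^sup>2)"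
      unfolding sum_subtractf[symmetric]
    proof (rule order_trans[OF sum_abs], rule sum_mono)
      fix i assume i: "i \<in> I"
      have "\<bar>(\<integral>x. ?G i x \<partial>lborel) - ?w i ?v * P i\<bar> \<le> C1 * (n i \<bullet> ?v)\<^sup>2"
        unfolding C1_def by (intro crossing_integral_flux[OF _ i order_trans[OF nv t(2)]] CP[OF i])
      also have "\<dots> \<le> C1 * t\<^sup>2"
      proof (intro mult_left_mono C1)
        have "\<bar>n i \<bullet> ?v\<bar> \<le> t"
          using Cauchy_Schwarz_ineq2[of "n i" ?v] nv unfolding norm_normal[OF i] by linarith
        then show "(n i \<bullet> ?v)\<^sup>2 \<le> t\<^sup>2"
          using power_mono[of "\<bar>n i \<bullet> ?v\<bar>" t 2] unfolding power2_abs by simp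
      qed
      finally show "\<bar>(\<integral>x. ?G i x \<partial>lborel) - ?w i ?v * P i\<bar> \<le> C1 * t\<^sup>2" .
    qed
    also have "(\<Sum>i\<in>I. ?w i ?v * P i) = t * (\<Sum>i\<in>I. ?w i z * P i)"
      unfolding sum_distrib_left using t by (intro sum.cong) (auto simp: abs_mult)
    finally have 2: "\<bar>(\<Sum>i\<in>I. \<integral>x. ?G i x \<partial>lborel) - t * (\<Sum>i\<in>I. ?w i z * P i)\<bar> \<le> N * C1 * t\<^sup>2"
      by (simp add: N_def)
    show "\<bar>(\<integral>x. ?F x \<partial>lborel) - t * (\<Sum>i\<in>I. ?w i z * P i)\<bar> \<le> ((1 + N) * B * (A * 2) + N * C1) * t\<^sup>2"
      using 1 2 unfolding distrib_right[of _ _ "t\<^sup>2"] by linarith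
  qed (rule P)
qed

end

end

section \<open>Smooth cut-off functions\<close>

text \<open>The functions of this form are closed under differentiation and vanish to infinite order at \<open>0\<close>;
\<open>flat_exp 1\<close> is the standard smooth function that is \<open>0\<close> on the negative half-line and positive on
the positive one.\<close>

definition flat_exp :: "real poly \<Rightarrow> real \<Rightarrow> real" where
  "flat_exp p t = (if 0 < t then poly p (1 / t) * exp (- 1 / t) else 0)"

lemma poly_mult_exp_neg_tendsto_0: "((\<lambda>y::real. poly p y * exp (- y)) \<longlongrightarrow> 0) at_top"
proof -
  have eq: "poly p y * exp (- y) = (\<Sum>i\<le>degree p. coeff p i * (y ^ i / exp y))" for y :: real
    by (simp add: poly_altdef sum_distrib_left exp_minus divide_inverse mult_ac)
  have "((\<lambda>y::real. \<Sum>i\<le>degree p. coeff p i * (y ^ i / exp y)) \<longlongrightarrow> (\<Sum>i\<le>degree p. coeff p i * 0)) at_top"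
    by (intro tendsto_intros tendsto_power_div_exp_0)
  then show ?thesis by (simp add: eq)
qed

text \<open>With \<open>y = 1 / t\<close>, differentiation turns the coefficient \<open>p\<close> into \<open>y\<^sup>2 (p - p')\<close>.  At \<open>0\<close> the
difference quotient is again a polynomial in \<open>y\<close> times \<open>exp (- y)\<close>, and \<open>y\<close> tends to infinity.\<close>

lemma flat_exp_has_derivative:
  "(flat_exp p has_real_derivative flat_exp (monom 1 2 * (p - pderiv p)) t) (at t)"
proof -
  consider "t > 0" | "t < 0" | "t = 0" by linarith
  then show ?thesis
  proof cases
    case 1
    have "((\<lambda>t. poly p (1 / t) * exp (- 1 / t)) has_real_derivative
        flat_exp (monom 1 2 * (p - pderiv p)) t) (at t)"
      using 1 by (auto intro!: derivative_eq_intros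
          simp: flat_exp_def poly_monom power2_eq_square field_simps)
    then show ?thesis
      by (rule has_field_derivative_transform_within_open[where S = "{0<..}"]) (use 1 in \<open>auto simp: flat_exp_def\<close>)
  next
    case 2
    have "((\<lambda>t. 0) has_real_derivative flat_exp (monom 1 2 * (p - pderiv p)) t) (at t)"
      using 2 by (auto simp: flat_exp_def)
    then show ?thesis
      by (rule has_field_derivative_transform_within_open[where S = "{..<0}"]) (use 2 in \<open>auto simp: flat_exp_def\<close>)
  next
    case 3
    have "((\<lambda>h. (flat_exp p (0 + h) - flat_exp p 0) / h) \<longlongrightarrow> 0) (at 0)"
    proof (rule filterlim_split_at)
      have "eventually (\<lambda>h::real. h < 0) (at_left 0)" by (simp add: eventually_at_filter)
      then have "eventually (\<lambda>h::real. 0 = (flat_exp p (0 + h) - flat_exp p 0) / h) (at_left 0)"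
        by eventually_elim (simp add: flat_exp_def)
      then show "((\<lambda>h. (flat_exp p (0 + h) - flat_exp p 0) / h) \<longlongrightarrow> 0) (at_left 0)"
        by (rule Lim_transform_eventually[OF tendsto_const])
      have "((\<lambda>h::real. poly (pCons 0 p) (inverse h) * exp (- inverse h)) \<longlongrightarrow> 0) (at_right 0)"
        by (rule filterlim_compose[OF poly_mult_exp_neg_tendsto_0 filterlim_inverse_at_top_right])
      moreover have "eventually (\<lambda>h::real. 0 < h) (at_right 0)" by (simp add: eventually_at_filter)
      then have "eventually (\<lambda>h::real. poly (pCons 0 p) (inverse h) * exp (- inverse h)
          = (flat_exp p (0 + h) - flat_exp p 0) / h) (at_right 0)"
        by eventually_elim (simp add: flat_exp_def field_simps)
      ultimately show "((\<lambda>h. (flat_exp p (0 + h) - flat_exp p 0) / h) \<longlongrightarrow> 0) (at_right 0)"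
        by (rule Lim_transform_eventually)
    qed
    then show ?thesis using 3 by (simp add: DERIV_def flat_exp_def)
  qed
qed

text \<open>A class of functions that contains the partial derivatives of each of its members.  Its members
are therefore smooth, and all cut-off functions needed below belong to it.\<close>

inductive elementary_smooth :: "('a::real_inner \<Rightarrow> real) \<Rightarrow> bool" where
  const: "elementary_smooth (\<lambda>_. c)"
| inner: "elementary_smooth (\<lambda>x. a \<bullet> x)"
| add: "elementary_smooth f \<Longrightarrow> elementary_smooth g \<Longrightarrow> elementary_smooth (\<lambda>x. f x + g x)"
| mult: "elementary_smooth f \<Longrightarrow> elementary_smooth g \<Longrightarrow> elementary_smooth (\<lambda>x. f x * g x)"
| flat_exp: "elementary_smooth f \<Longrightarrow> elementary_smooth (\<lambda>x. flat_exp p (f x))"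

lemma elementary_smooth_derivative:
  assumes "elementary_smooth f"
  shows "\<exists>f'. (\<forall>x. (f has_derivative f' x) (at x)) \<and> (\<forall>v. elementary_smooth (\<lambda>x. f' x v))"
  using assms
proof induction
  case (const c)
  show ?case by (rule exI[of _ "\<lambda>_ _. 0"]) (auto intro: elementary_smooth.const)
next
  case (inner a)
  show ?case
    by (rule exI[of _ "\<lambda>_ v. a \<bullet> v"]) (auto intro!: elementary_smooth.const derivative_eq_intros)
next
  case (add f g)
  then obtain f' g' where "\<And>x. (f has_derivative f' x) (at x)" "\<And>v. elementary_smooth (\<lambda>x. f' x v)"
    "\<And>x. (g has_derivative g' x) (at x)" "\<And>v. elementary_smooth (\<lambda>x. g' x v)" by blast
  then show ?case
    by (intro exI[of _ "\<lambda>x v. f' x v + g' x v"]) (auto intro!: elementary_smooth.add has_derivative_add)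
next
  case (mult f g)
  then obtain f' g' where "\<And>x. (f has_derivative f' x) (at x)" "\<And>v. elementary_smooth (\<lambda>x. f' x v)"
    "\<And>x. (g has_derivative g' x) (at x)" "\<And>v. elementary_smooth (\<lambda>x. g' x v)" by blast
  with mult.hyps show ?case
    by (intro exI[of _ "\<lambda>x v. f x * g' x v + f' x v * g x"])
      (auto intro!: elementary_smooth.add elementary_smooth.mult has_derivative_mult)
next
  case (flat_exp f p)
  then obtain f' where f': "\<And>x. (f has_derivative f' x) (at x)" "\<And>v. elementary_smooth (\<lambda>x. f' x v)"
    by blast
  let ?q = "monom 1 2 * (p - pderiv p)"
  have "((\<lambda>x. flat_exp p (f x)) has_derivative (\<lambda>v. flat_exp ?q (f x) * f' x v)) (at x)" for x
    using has_derivative_compose[OF f'(1) flat_exp_has_derivative[unfolded has_field_derivative_def]] by simp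
  moreover have "elementary_smooth (\<lambda>x. flat_exp ?q (f x) * f' x v)" for v
    using flat_exp.hyps f'(2) by (intro elementary_smooth.mult elementary_smooth.flat_exp)
  ultimately show ?case by (intro exI[of _ "\<lambda>x v. flat_exp ?q (f x) * f' x v"]) auto
qed

text \<open>Local agreement with elementary functions suffices, and it is inherited by directional
derivatives; so a locally constant factor, such as the value of a jump on a cell, does no harm
where it is multiplied by a cut-off function.\<close>

lemma Ck_on_if_locally_elementary:
  fixes f :: "'a::real_inner \<Rightarrow> 'b::real_normed_vector"
  assumes "\<And>x. x \<in> S \<Longrightarrow> \<exists>T g. open T \<and> x \<in> T \<and> (\<forall>j\<in>J. elementary_smooth (g j)) \<and>
      (\<forall>y\<in>T. f y = (\<Sum>j\<in>J. g j y *\<^sub>R w j))"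
  shows "Ck_on k S f"
  using assms
proof (induction k arbitrary: f)
  case 0
  have "isCont f x" if x: "x \<in> S" for x
  proof -
    from 0[OF x] obtain T g where T: "open T" "x \<in> T" "\<And>j. j \<in> J \<Longrightarrow> elementary_smooth (g j)"
      "\<And>y. y \<in> T \<Longrightarrow> f y = (\<Sum>j\<in>J. g j y *\<^sub>R w j)" by blast
    have "isCont (g j) y" if "j \<in> J" for j y
      using elementary_smooth_derivative[OF T(3)[OF that]] has_derivative_continuous by blast
    then have "isCont (\<lambda>y. \<Sum>j\<in>J. g j y *\<^sub>R w j) x" by (intro continuous_intros)
    moreover have "eventually (\<lambda>y. f y = (\<Sum>j\<in>J. g j y *\<^sub>R w j)) (nhds x)"
      using T by (auto simp: eventually_nhds)
    ultimately show ?thesis by (simp add: isCont_cong)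
  qed
  then show ?case by (simp add: continuous_at_imp_continuous_on)
next
  case (Suc k)
  have ex: "\<exists>T g'. open T \<and> x \<in> T \<and> (\<forall>j\<in>J. \<forall>v. elementary_smooth (\<lambda>y. g' j y v)) \<and>
      (\<forall>y\<in>T. (f has_derivative (\<lambda>v. \<Sum>j\<in>J. g' j y v *\<^sub>R w j)) (at y))" if x: "x \<in> S" for x
  proof -
    from Suc.prems[OF x] obtain T g where T: "open T" "x \<in> T" "\<And>j. j \<in> J \<Longrightarrow> elementary_smooth (g j)"
      "\<And>y. y \<in> T \<Longrightarrow> f y = (\<Sum>j\<in>J. g j y *\<^sub>R w j)" by blast
    have "\<exists>g'. (\<forall>y. (g j has_derivative g' y) (at y)) \<and> (\<forall>v. elementary_smooth (\<lambda>y. g' y v))" if "j \<in> J" for j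
      by (rule elementary_smooth_derivative[OF T(3)[OF that]])
    then have "\<exists>g'. \<forall>j\<in>J. (\<forall>y. (g j has_derivative g' j y) (at y)) \<and> (\<forall>v. elementary_smooth (\<lambda>y. g' j y v))"
      by (intro bchoice ballI)
    then obtain g' where g': "\<And>j y. j \<in> J \<Longrightarrow> (g j has_derivative g' j y) (at y)"
      "\<And>j v. j \<in> J \<Longrightarrow> elementary_smooth (\<lambda>y. g' j y v)" by blast
    have "(f has_derivative (\<lambda>v. \<Sum>j\<in>J. g' j y v *\<^sub>R w j)) (at y)" if y: "y \<in> T" for y
    proof (rule has_derivative_transform_within_open[OF _ T(1) y])
      show "((\<lambda>y. \<Sum>j\<in>J. g j y *\<^sub>R w j) has_derivative (\<lambda>v. \<Sum>j\<in>J. g' j y v *\<^sub>R w j)) (at y)"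
        by (intro has_derivative_sum has_derivative_scaleR_left g')
    qed (use T in simp)
    then show ?thesis using T(1,2) g'(2) by (intro exI[of _ T] exI[of _ g']) simp
  qed
  have "f differentiable at x" if "x \<in> S" for x
    using ex[OF that] by (auto simp: differentiable_def)
  moreover have "Ck_on k S (\<lambda>x. frechet_derivative f (at x) v)" for v
  proof (rule Suc.IH)
    fix x assume "x \<in> S"
    from ex[OF this] obtain T g' where T: "open T" "x \<in> T" "\<And>j v. j \<in> J \<Longrightarrow> elementary_smooth (\<lambda>y. g' j y v)"
      "\<And>y. y \<in> T \<Longrightarrow> (f has_derivative (\<lambda>v. \<Sum>j\<in>J. g' j y v *\<^sub>R w j)) (at y)" by blast
    have "frechet_derivative f (at y) v = (\<Sum>j\<in>J. g' j y v *\<^sub>R w j)" if "y \<in> T" for y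
      using fun_cong[OF frechet_derivative_at[OF T(4)[OF that]], of v] by simp
    then show "\<exists>T g. open T \<and> x \<in> T \<and> (\<forall>j\<in>J. elementary_smooth (g j)) \<and>
        (\<forall>y\<in>T. frechet_derivative f (at y) v = (\<Sum>j\<in>J. g j y *\<^sub>R w j))"
      using T by (intro exI[of _ T] exI[of _ "\<lambda>j y. g' j y v"]) auto
  qed
  ultimately show ?case by simp
qed

text \<open>The composition of two copies of \<open>flat_exp 1\<close> produces a smooth function that is constant on both
sides of \<open>{0<..<1}\<close> without any division: the inner term is at least \<open>exp (- 1)\<close> for \<open>t \<le> 0\<close> and
vanishes for \<open>t \<ge> 1\<close>.\<close>

definition smooth_step :: "real \<Rightarrow> real" where
  "smooth_step t = exp (exp 1) * flat_exp 1 (exp (- 1) - flat_exp 1 (1 - t))"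

lemma flat_exp_1_mono: "s \<le> t \<Longrightarrow> flat_exp 1 s \<le> flat_exp 1 t"
  by (auto simp: flat_exp_def field_simps)

lemma flat_exp_1_nonneg: "0 \<le> flat_exp 1 t"
  by (auto simp: flat_exp_def)

lemma smooth_step_eq_0: "t \<le> 0 \<Longrightarrow> smooth_step t = 0"
  using flat_exp_1_mono[of 1 "1 - t"] by (simp add: smooth_step_def) (simp add: flat_exp_def)

lemma flat_exp_at_inv_e: "flat_exp 1 (exp (- 1)) = exp (- exp 1)"
  by (simp add: flat_exp_def exp_minus inverse_eq_divide)

lemma smooth_step_eq_1: "1 \<le> t \<Longrightarrow> smooth_step t = 1"
proof -
  assume "1 \<le> t"
  then have "flat_exp 1 (1 - t) = 0" by (simp add: flat_exp_def)
  then show ?thesis by (simp add: smooth_step_def flat_exp_at_inv_e flip: exp_add)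
qed

lemma smooth_step_range: "0 \<le> smooth_step t" "smooth_step t \<le> 1"
proof -
  show "0 \<le> smooth_step t" by (simp add: smooth_step_def flat_exp_1_nonneg)
  have "smooth_step t \<le> exp (exp 1) * flat_exp 1 (exp (- 1))"
    unfolding smooth_step_def by (intro mult_left_mono flat_exp_1_mono) (auto simp: flat_exp_1_nonneg)
  then show "smooth_step t \<le> 1" by (simp add: flat_exp_at_inv_e flip: exp_add)
qed

lemma elementary_smooth_step: "elementary_smooth f \<Longrightarrow> elementary_smooth (\<lambda>x. smooth_step (f x))"
proof -
  assume f: "elementary_smooth f"
  have "elementary_smooth (\<lambda>x. exp (exp 1) * flat_exp 1 (exp (- 1) + (- 1) * flat_exp 1 (1 + (- 1) * f x)))"
    by (intro elementary_smooth.intros f)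
  then show ?thesis by (simp add: smooth_step_def)
qed

lemma elementary_smooth_prod:
  "finite A \<Longrightarrow> (\<And>i. i \<in> A \<Longrightarrow> elementary_smooth (f i)) \<Longrightarrow> elementary_smooth (\<lambda>x. \<Prod>i\<in>A. f i x)"
  by (induction A rule: finite_induct) (auto intro: elementary_smooth.intros)

section \<open>A Gauss formula for polyhedral sets\<close>

lemma integral_lborel_translation:
  fixes f :: "'a::euclidean_space \<Rightarrow> real"
  assumes [measurable]: "f \<in> borel_measurable borel"
  shows "(\<integral>x. f (a + x) \<partial>lborel) = (\<integral>x. f x \<partial>lborel)"
proof -
  have "(\<integral>x. f x \<partial>lborel) = (\<integral>x. f x \<partial>distr lborel borel ((+) a))"
    by (simp add: lborel_distr_plus)
  also have "\<dots> = (\<integral>x. f (a + x) \<partial>lborel)"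
    by (subst integral_distr) auto
  finally show ?thesis ..
qed

text \<open>A test field vanishes near the boundary of \<open>X\<close>, hence its extension by \<open>0\<close> is continuously
differentiable on the whole space with compact support, and so Lipschitz and bounded.\<close>

lemma test_field_extension:
  fixes X :: "(real^'d) set" and \<phi> :: "real^'d \<Rightarrow> real^'d"
  assumes X: "open X" and \<phi>: "\<phi> \<in> test_fields X"
    and \<psi>_def: "\<psi> = (\<lambda>x. if x \<in> X then \<phi> x else 0)"
    and \<psi>'_def: "\<psi>' = (\<lambda>x. if x \<in> X then frechet_derivative \<phi> (at x) else (\<lambda>_. 0))"
  obtains L B where "\<And>x. (\<psi> has_derivative \<psi>' x) (at x)" "\<And>v. continuous_on UNIV (\<lambda>x. \<psi>' x v)"
    "L-lipschitz_on UNIV \<psi>" "\<And>x. norm (\<psi> x) \<le> B" "\<And>x v. norm (\<psi>' x v) \<le> L * norm v"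
proof -
  define K where "K = closure {x\<in>X. \<phi> x \<noteq> 0}"
  have K: "compact K" "K \<subseteq> X" and sm: "\<And>k. Ck_on k X \<phi>"
    using \<phi> by (auto simp: test_fields_def smooth_on_def K_def)
  have oK: "open (- K)" unfolding K_def by (intro open_Compl closed_closure)
  have zero: "\<psi> y = 0" if "y \<notin> K" for y
    using that closure_subset[of "{x\<in>X. \<phi> x \<noteq> 0}"] by (auto simp: \<psi>_def K_def)
  have diff: "\<And>x. x \<in> X \<Longrightarrow> \<phi> differentiable (at x)"
    and cont: "\<And>v. continuous_on X (\<lambda>x. frechet_derivative \<phi> (at x) v)"
    using sm[of "Suc 0"] by auto
  have d1: "(\<psi> has_derivative \<psi>' x) (at x)" if "x \<in> X" for x
  proof (rule has_derivative_transform_within_open[OF _ X that])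
    show "(\<phi> has_derivative \<psi>' x) (at x)"
      using diff[OF that] that by (simp add: \<psi>'_def frechet_derivative_works)
  qed (simp add: \<psi>_def)
  have d2: "(\<psi> has_derivative (\<lambda>_. 0)) (at x)" if "x \<in> - K" for x
    by (rule has_derivative_transform_within_open[OF _ oK that, of "\<lambda>_. 0"]) (auto simp: zero)
  have z': "\<psi>' x = (\<lambda>_. 0)" if "x \<in> - K" for x
  proof (cases "x \<in> X")
    case True
    then show ?thesis using has_derivative_unique[OF d1[OF True] d2[OF that]] by simp
  qed (simp add: \<psi>'_def)
  have d: "(\<psi> has_derivative \<psi>' x) (at x)" for x
    using d1 d2 z' K by (cases "x \<in> X") (force simp: \<psi>'_def)+
  have c: "continuous_on UNIV (\<lambda>x. \<psi>' x v)" for v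
  proof -
    have "continuous_on X (\<lambda>x. \<psi>' x v)"
      using cont[of v] by (subst continuous_on_cong[OF refl, of X _ "\<lambda>x. frechet_derivative \<phi> (at x) v"]) (auto simp: \<psi>'_def)
    moreover have "continuous_on (- K) (\<lambda>x. \<psi>' x v)"
      by (subst continuous_on_cong[OF refl, of "- K" _ "\<lambda>x. 0"]) (auto simp: z')
    ultimately have "continuous_on (X \<union> - K) (\<lambda>x. \<psi>' x v)"
      using X oK by (intro continuous_on_open_Un) auto
    moreover have "X \<union> - K = UNIV" using K by auto
    ultimately show ?thesis by simp
  qed
  have "\<exists>B. \<forall>x. norm (\<psi>' x v) \<le> B" for v
  proof -
    have "bounded ((\<lambda>x. \<psi>' x v) ` K)"
      using K c continuous_on_subset by (intro compact_imp_bounded compact_continuous_image) blast+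
    then obtain B where "\<And>x. x \<in> K \<Longrightarrow> norm (\<psi>' x v) \<le> B" "B > 0"
      unfolding bounded_pos by auto
    then show ?thesis using z' by (intro exI[of _ B]) (metis ComplI less_eq_real_def norm_zero)
  qed
  then obtain B' where B': "\<And>v x. norm (\<psi>' x v) \<le> B' v" by metis
  define L where "L = (\<Sum>e\<in>Basis. B' e)"
  have op: "norm (\<psi>' x v) \<le> L * norm v" for x v
  proof -
    have lin: "linear (\<psi>' x)" using d has_derivative_linear by blast
    have "\<psi>' x v = \<psi>' x (\<Sum>e\<in>Basis. (v \<bullet> e) *\<^sub>R e)" by (simp add: euclidean_representation)
    also have "\<dots> = (\<Sum>e\<in>Basis. (v \<bullet> e) *\<^sub>R \<psi>' x e)"
      by (simp add: linear_sum[OF lin] linear_cmul[OF lin])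
    finally have eqv: "\<psi>' x v = (\<Sum>e\<in>Basis. (v \<bullet> e) *\<^sub>R \<psi>' x e)" .
    have "norm (\<psi>' x v) \<le> (\<Sum>e\<in>Basis. norm ((v \<bullet> e) *\<^sub>R \<psi>' x e))"
      unfolding eqv by (rule norm_sum)
    also have "\<dots> \<le> (\<Sum>e\<in>Basis. norm v * B' e)"
    proof (rule sum_mono)
      fix e :: "real^'d" assume "e \<in> Basis"
      then show "norm ((v \<bullet> e) *\<^sub>R \<psi>' x e) \<le> norm v * B' e"
        using Basis_le_norm[of e v] B'[of x e] by (auto intro!: mult_mono)
    qed
    also have "\<dots> = L * norm v" by (simp add: L_def sum_distrib_left mult.commute)
    finally show "norm (\<psi>' x v) \<le> L * norm v" .
  qed
  have on: "onorm (\<psi>' x) \<le> L" for x by (rule onorm_le) (rule op)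
  have L0: "0 \<le> L" using on[of 0] onorm_pos_le[OF has_derivative_bounded_linear[OF d[of 0]]] by linarith
  have lip: "L-lipschitz_on UNIV \<psi>"
  proof (rule bounded_derivative_imp_lipschitz[where f' = \<psi>'])
    show "(\<psi> has_derivative \<psi>' x) (at x within UNIV)" for x using d by simp
  qed (use on L0 in auto)
  have "bounded (\<psi> ` K)"
    using K lipschitz_on_continuous_on[OF lip] continuous_on_subset
    by (intro compact_imp_bounded compact_continuous_image) blast+
  then obtain B where "\<And>x. x \<in> K \<Longrightarrow> norm (\<psi> x) \<le> B" "B > 0"
    unfolding bounded_pos by auto
  then have "norm (\<psi> x) \<le> B" for x using zero[of x] by (cases "x \<in> K") auto
  then show thesis by (rule that[OF d c lip _ op])
qed

text \<open>The arrangement covers the frontiers of both \<open>F\<close> and \<open>X\<close>: jumps count only between points of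
\<open>X\<close>, and this restriction, too, must depend on the cells of the two points alone.\<close>

locale polyhedral_domain = hyperplane_arrangement I n b
  for I :: "'i set" and n :: "'i \<Rightarrow> real^'d" and b :: "'i \<Rightarrow> real" +
  fixes X F :: "(real^'d) set" and R :: real
  assumes X_open: "open X" and X_convex: "convex X" and X_bounded: "X \<subseteq> cball 0 R"
    and F_open: "open F"
    and frontiers: "frontier X \<union> frontier F \<subseteq> {x. \<exists>i\<in>I. height i x = 0}"
begin

lemma sets_XF [measurable]: "X \<in> sets borel" "F \<in> sets borel"
  using X_open F_open by auto

text \<open>The segment between two points of one open cell does not meet any hyperplane, hence not the
frontier of \<open>X\<close> or \<open>F\<close> either.\<close>

lemma same_cell_mem_iff:
  assumes xy: "same_cell x y" and S: "S = X \<or> S = F"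
  shows "x \<in> S \<longleftrightarrow> y \<in> S"
proof (rule ccontr)
  assume ne: "\<not> (x \<in> S \<longleftrightarrow> y \<in> S)"
  have "closed_segment x y \<inter> frontier S \<noteq> {}"
    by (rule connected_Int_frontier) (use ne in auto)
  then obtain z where z: "z \<in> closed_segment x y" "z \<in> frontier S" by auto
  then obtain i where i: "i \<in> I" "height i z = 0" using frontiers S by auto
  from z(1) obtain u where u: "0 \<le> u" "u \<le> 1" "z = (1 - u) *\<^sub>R x + u *\<^sub>R y"
    by (auto simp: in_segment)
  have hz: "height i z = (1 - u) * height i x + u * height i y"
    unfolding u(3) by (simp add: inner_add_right algebra_simps)
  have "height i x * height i y > 0" using xy i by (simp add: same_cell_def)
  then consider "height i x > 0" "height i y > 0" | "height i x < 0" "height i y < 0"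
    by (auto simp: zero_less_mult_iff)
  then show False
  proof cases
    case 1
    then have "(1 - u) * height i x \<ge> 0" "u * height i y \<ge> 0" "(1 - u) > 0 \<or> u > 0" using u by auto
    then have "(1 - u) * height i x + u * height i y > 0" using 1 u by (smt (verit) mult_pos_pos)
    then show False using hz i by simp
  next
    case 2
    then have "(1 - u) * (- height i x) + u * (- height i y) > 0"
      using u by (smt (verit) mult_pos_pos mult_nonneg_nonneg)
    then show False using hz i unfolding mult_minus_right by linarith
  qed
qed

text \<open>The factors for \<open>X\<close> encode that both points of a pair range over \<open>X\<close> in the nonlocal energy.\<close>

definition jump :: "real^'d \<Rightarrow> real^'d \<Rightarrow> real" where
  "jump x y = indicator X x * indicator X y * (indicator F y - indicator F x)"

lemma jump_borel [measurable (raw)]: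
  "f \<in> borel_measurable M \<Longrightarrow> g \<in> borel_measurable M \<Longrightarrow> (\<lambda>x. jump (f x) (g x)) \<in> borel_measurable M"
  unfolding jump_def
  by (intro borel_measurable_times borel_measurable_diff; rule measurable_compose[OF _ borel_measurable_indicator]) auto

lemma jump_cong: "same_cell x x' \<Longrightarrow> same_cell y y' \<Longrightarrow> jump x y = jump x' y'"
  using same_cell_mem_iff[of x x'] same_cell_mem_iff[of y y'] by (simp add: jump_def indicator_def)

lemma jump_same_cell: "same_cell x y \<Longrightarrow> jump x y = 0"
  using same_cell_mem_iff[of x y] by (simp add: jump_def indicator_def)

sublocale flux: jump_density I n b jump R "-1"
proof
  show "(\<lambda>p. jump (fst p) (snd p)) \<in> borel_measurable (borel \<Otimes>\<^sub>M borel)" by measurable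
  show "\<bar>jump x y\<bar> \<le> 1" for x y by (auto simp: jump_def indicator_def)
  show "x \<in> cball 0 R \<and> y \<in> cball 0 R" if "jump x y \<noteq> 0" for x y
    using that X_bounded by (auto simp: jump_def indicator_def split: if_splits)
  show "jump y x = - 1 * jump x y" for x y by (simp add: jump_def indicator_def)
qed (use jump_cong jump_same_cell in auto)

sublocale variation: jump_density I n b "\<lambda>x y. \<bar>jump x y\<bar>" R 1
proof
  show "(\<lambda>p. \<bar>jump (fst p) (snd p)\<bar>) \<in> borel_measurable (borel \<Otimes>\<^sub>M borel)" by measurable
  show "\<bar>\<bar>jump x y\<bar>\<bar> \<le> 1" for x y using flux.D_bound[of x y] by simp
  show "x \<in> cball 0 R \<and> y \<in> cball 0 R" if "\<bar>jump x y\<bar> \<noteq> 0" for x y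
    using that flux.D_support[of x y] by simp
  show "\<bar>jump y x\<bar> = 1 * \<bar>jump x y\<bar>" for x y using flux.D_swap[of x y] by simp
  show "\<bar>jump x y\<bar> = \<bar>jump x' y'\<bar>" if "same_cell x x'" "same_cell y y'" for x x' y y'
    using jump_cong[OF that] by simp
qed (use jump_same_cell in auto)

text \<open>The Gauss formula, with fluxes through thin layers in place of surface integrals.  Each partial
derivative is the limit of difference quotients; moving the translation from the field to the
indicator function of \<open>F\<close> gives the integral of the signed jump under a displacement by a multiple of
\<open>- axis k 1\<close>, to which the expansion for \<open>\<kappa> = -1\<close> applies.  Since the field vanishes near the boundary
of \<open>X\<close>, jumps across that boundary do not enter for small displacements.\<close>

lemma integral_divergence:
  assumes \<phi>: "\<phi> \<in> test_fields X"
  shows "((\<lambda>t. \<Sum>i\<in>I. flux.slab_integral (\<lambda>x. if x \<in> X then n i \<bullet> \<phi> x else 0) i t / t)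
     \<longlongrightarrow> - (LINT x:X|lebesgue. indicator F x * divergence \<phi> x)) (at_right 0)"
proof -
  define \<psi> where "\<psi> = (\<lambda>x. if x \<in> X then \<phi> x else 0)"
  define \<psi>' where "\<psi>' = (\<lambda>x. if x \<in> X then frechet_derivative \<phi> (at x) else (\<lambda>_. 0))"
  obtain L B where d: "\<And>x. (\<psi> has_derivative \<psi>' x) (at x)" and c: "\<And>v. continuous_on UNIV (\<lambda>x. \<psi>' x v)"
    and lip: "L-lipschitz_on UNIV \<psi>" and B: "\<And>x. norm (\<psi> x) \<le> B"
    and op: "\<And>x v. norm (\<psi>' x v) \<le> L * norm v"
    by (rule test_field_extension[OF X_open \<phi> \<psi>_def \<psi>'_def]) (rule that; blast)
  have supp: "compact (closure {x\<in>X. \<phi> x \<noteq> 0})" "closure {x\<in>X. \<phi> x \<noteq> 0} \<subseteq> X"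
    using \<phi> by (auto simp: test_fields_def)
  obtain \<delta> where \<delta>: "\<delta> > 0" "(\<Union>x\<in>closure {x\<in>X. \<phi> x \<noteq> 0}. cball x \<delta>) \<subseteq> X"
    by (rule compact_subset_open_imp_cball_epsilon_subset[OF supp(1) X_open supp(2)])
  have near: "y \<in> X" if "\<psi> x \<noteq> 0" "dist x y \<le> \<delta>" for x y
  proof -
    have "x \<in> closure {x\<in>X. \<phi> x \<noteq> 0}"
      using that(1) closure_subset[of "{x\<in>X. \<phi> x \<noteq> 0}"] by (auto simp: \<psi>_def split: if_splits)
    then have "y \<in> (\<Union>x\<in>closure {x\<in>X. \<phi> x \<noteq> 0}. cball x \<delta>)"
      by (rule UN_I) (use that(2) in simp)
    then show ?thesis using \<delta>(2) by (rule rev_subsetD)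
  qed
  let ?u = "indicator (F \<inter> X) :: real^'d \<Rightarrow> real"
  let ?e = "\<lambda>k::'d. axis k 1 :: real^'d"
  have lipk: "L-lipschitz_on UNIV (\<lambda>x. \<psi> x $ k)" for k
  proof (rule lipschitz_onI)
    show "dist (\<psi> x $ k) (\<psi> y $ k) \<le> L * dist x y" for x y
      using lipschitz_onD[OF lip, of x y] dist_vec_nth_le[of "\<psi> x" k "\<psi> y"] by simp
  qed (rule lipschitz_on_nonneg[OF lip])
  have bdk: "\<bar>\<psi> x $ k\<bar> \<le> B" for x k
    using component_le_norm_cart[of "\<psi> x" k] B[of x] by linarith
  have [measurable]: "(\<lambda>x. \<psi> x $ k) \<in> borel_measurable borel" for k
    by (intro borel_measurable_continuous_onI lipschitz_on_continuous_on[OF lipk])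
  have ex: "\<forall>k. \<exists>P. (\<forall>i\<in>I. ((\<lambda>t. flux.slab_integral (\<lambda>x. \<psi> x $ k) i t / t) \<longlongrightarrow> P i) (at_right 0)) \<and>
      (\<integral>x. ?u x * (\<psi>' x (?e k) $ k) \<partial>lborel) = - (\<Sum>i\<in>I. n i $ k * P i)"
  proof
    fix k
    obtain C P where C: "C \<ge> 0"
      and P: "\<forall>i\<in>I. ((\<lambda>t. flux.slab_integral (\<lambda>x. \<psi> x $ k) i t / t) \<longlongrightarrow> P i) (at_right 0)"
      and CP: "\<forall>t z. 0 < t \<longrightarrow> t \<le> 1 \<longrightarrow> norm z \<le> 1 \<longrightarrow>
        \<bar>(\<integral>x. jump x (x + t *\<^sub>R z) * \<psi> x $ k \<partial>lborel)
          - t * (\<Sum>i\<in>I. (if (-1::real) = 1 then \<bar>n i \<bullet> z\<bar> else n i \<bullet> z) * P i)\<bar> \<le> C * t\<^sup>2"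
      using flux.translation_jump_expansion[OF lipk[of k] bdk] by (elim exE conjE)
    \<comment> \<open>Displacements below \<open>\<delta>\<close> do not move the support of the field out of \<open>X\<close>.\<close>
    define s where "s m = min 1 \<delta> / real (Suc m)" for m
    have s: "0 < s m" "s m \<le> 1" "s m \<le> \<delta>" for m
    proof -
      have "min 1 \<delta> / real (Suc m) \<le> min 1 \<delta> / 1" using \<delta> by (intro divide_left_mono) auto
      then show "0 < s m" "s m \<le> 1" "s m \<le> \<delta>" using \<delta> by (auto simp: s_def)
    qed
    let ?q = "\<lambda>m x. ?u x * ((\<psi> (x + s m *\<^sub>R ?e k) $ k - \<psi> x $ k) / s m)"
    have s0: "s \<longlonglongrightarrow> 0"
      unfolding s_def[abs_def] divide_inverse
      by (rule tendsto_mult_right_zero[OF LIMSEQ_inverse_real_of_nat])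
    \<comment> \<open>The translation is moved from the field to the indicator function.\<close>
    have quot: "(\<integral>x. ?q m x \<partial>lborel)
        = (\<integral>x. jump x (x + s m *\<^sub>R (- ?e k)) * \<psi> x $ k \<partial>lborel) / s m" for m
    proof -
      let ?v = "s m *\<^sub>R ?e k"
      have i1: "integrable lborel (\<lambda>x. ?u x * \<psi> x $ k)"
      proof (rule integrable_bounded_on_cball)
        show "\<bar>?u x * \<psi> x $ k\<bar> \<le> B" for x using bdk[of x k] by (auto simp: indicator_def)
        show "x \<in> cball 0 R" if "?u x * \<psi> x $ k \<noteq> 0" for x using that X_bounded by (auto simp: indicator_def split: if_splits)
      qed measurable
      have i2: "integrable lborel (\<lambda>x. ?u x * \<psi> (x + ?v) $ k)"
      proof (rule integrable_bounded_on_cball)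
        show "\<bar>?u x * \<psi> (x + ?v) $ k\<bar> \<le> B" for x using bdk[of "x + ?v" k] by (auto simp: indicator_def)
        show "x \<in> cball 0 R" if "?u x * \<psi> (x + ?v) $ k \<noteq> 0" for x using that X_bounded by (auto simp: indicator_def split: if_splits)
        have "(\<lambda>x. \<psi> (x + ?v) $ k) \<in> borel_measurable borel"
          by (rule measurable_compose[of _ _ borel]) measurable
        then show "(\<lambda>x. ?u x * \<psi> (x + ?v) $ k) \<in> borel_measurable borel" by measurable
      qed
      have "(\<integral>x. ?u x * \<psi> (x + ?v) $ k \<partial>lborel) = (\<integral>x. ?u (x - ?v) * \<psi> x $ k \<partial>lborel)"
        using integral_lborel_translation[of "\<lambda>x. ?u (x - ?v) * \<psi> x $ k" ?v] by (simp add: add.commute)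
      have i3: "integrable lborel (\<lambda>x. ?u (x - ?v) * \<psi> x $ k)"
      proof (rule integrable_bounded_on_cball)
        show "\<bar>?u (x - ?v) * \<psi> x $ k\<bar> \<le> B" for x using bdk[of x k] by (auto simp: indicator_def)
        show "x \<in> cball 0 R" if "?u (x - ?v) * \<psi> x $ k \<noteq> 0" for x
          using that X_bounded by (auto simp: indicator_def \<psi>_def split: if_splits)
      qed measurable
      have "(\<integral>x. ?u x * ((\<psi> (x + ?v) $ k - \<psi> x $ k) / s m) \<partial>lborel)
          = (\<integral>x. (?u x * \<psi> (x + ?v) $ k - ?u x * \<psi> x $ k) / s m \<partial>lborel)"
        by (simp add: right_diff_distrib)
      also have "\<dots> = ((\<integral>x. ?u x * \<psi> (x + ?v) $ k \<partial>lborel) - (\<integral>x. ?u x * \<psi> x $ k \<partial>lborel)) / s m"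
        using Bochner_Integration.integral_diff[OF i2 i1] by simp
      also have "(\<integral>x. ?u x * \<psi> (x + ?v) $ k \<partial>lborel) = (\<integral>x. ?u (x - ?v) * \<psi> x $ k \<partial>lborel)" by fact
      also have "\<dots> - (\<integral>x. ?u x * \<psi> x $ k \<partial>lborel) = (\<integral>x. ?u (x - ?v) * \<psi> x $ k - ?u x * \<psi> x $ k \<partial>lborel)"
        using Bochner_Integration.integral_diff[OF i3 i1] by simp
      also have "(\<lambda>x. ?u (x - ?v) * \<psi> x $ k - ?u x * \<psi> x $ k) = (\<lambda>x. jump x (x + s m *\<^sub>R (- ?e k)) * \<psi> x $ k)"
      proof
        fix x
        show "?u (x - ?v) * \<psi> x $ k - ?u x * \<psi> x $ k = jump x (x + s m *\<^sub>R (- ?e k)) * \<psi> x $ k"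
        proof (cases "\<psi> x = 0")
          case False
          then have "x \<in> X" by (auto simp: \<psi>_def split: if_splits)
          moreover have "x - ?v \<in> X"
            by (rule near[OF False]) (use s[of m] in \<open>simp add: dist_norm\<close>)
          ultimately show ?thesis by (simp add: jump_def indicator_def)
        qed simp
      qed
      finally show ?thesis .
    qed
    have "(\<lambda>m. \<integral>x. ?q m x \<partial>lborel)
        \<longlonglongrightarrow> (\<integral>x. ?u x * (\<psi>' x (?e k) $ k) \<partial>lborel)"
    proof (rule integral_dominated_convergence[where w = "\<lambda>x. L * indicator X x"])
      have [measurable]: "(\<lambda>x. \<psi>' x (?e k) $ k) \<in> borel_measurable borel"
        using c[of "?e k"] by (intro borel_measurable_continuous_onI continuous_on_component)
      show "(\<lambda>x. ?u x * \<psi>' x (?e k) $ k) \<in> borel_measurable lborel" by measurable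
      have "(\<lambda>x. \<psi> (x + s m *\<^sub>R ?e k) $ k) \<in> borel_measurable borel" for m
        by (rule measurable_compose[of _ _ borel]) measurable
      then show "(\<lambda>x. ?q m x) \<in> borel_measurable lborel" for m
        by measurable
      show "integrable lborel (\<lambda>x. L * indicator X x)"
        using lmeasurable_subset_cball[of X R] X_bounded
        by (intro integrable_mult_right integrable_real_indicator) (auto simp: fmeasurable_def)
      show "AE x in lborel. norm (?q m x) \<le> L * indicator X x" for m
      proof (rule AE_I2)
        fix x
        have "\<bar>\<psi> (x + s m *\<^sub>R ?e k) $ k - \<psi> x $ k\<bar> \<le> L * s m"
          using lipschitz_onD[OF lipk, of "x + s m *\<^sub>R ?e k" x k] s[of m] by (simp add: dist_norm)
        then have "\<bar>(\<psi> (x + s m *\<^sub>R ?e k) $ k - \<psi> x $ k) / s m\<bar> \<le> L"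
          using s[of m] by (simp add: field_simps)
        then show "norm (?q m x) \<le> L * indicator X x"
          using lipschitz_on_nonneg[OF lip] by (auto simp: indicator_def)
      qed
      show "AE x in lborel. (\<lambda>m. ?q m x) \<longlonglongrightarrow> ?u x * \<psi>' x (?e k) $ k"
      proof (rule AE_I2)
        fix x
        have "((\<lambda>t. \<psi> (x + t *\<^sub>R ?e k)) has_derivative (\<lambda>t. \<psi>' x (t *\<^sub>R ?e k))) (at (0::real))"
          by (rule has_derivative_compose[where g = \<psi> and f = "\<lambda>t. x + t *\<^sub>R ?e k"])
            (use d[of x] in \<open>auto intro!: derivative_eq_intros\<close>)
        then have "((\<lambda>t. \<psi> (x + t *\<^sub>R ?e k) $ k) has_derivative (\<lambda>t. \<psi>' x (t *\<^sub>R ?e k) $ k)) (at (0::real))"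
          by (rule bounded_linear.has_derivative[OF bounded_linear_vec_nth])
        moreover have "(\<lambda>t. \<psi>' x (t *\<^sub>R ?e k) $ k) = (*) (\<psi>' x (?e k) $ k)"
          using linear_cmul[OF has_derivative_linear[OF d[of x]]] by (auto simp: fun_eq_iff)
        ultimately have "((\<lambda>t. \<psi> (x + t *\<^sub>R ?e k) $ k) has_field_derivative \<psi>' x (?e k) $ k) (at 0)"
          by (simp add: has_field_derivative_def)
        then have lim: "(\<lambda>h. (\<psi> (x + h *\<^sub>R ?e k) $ k - \<psi> x $ k) / h) \<midarrow>0\<rightarrow> \<psi>' x (?e k) $ k"
          by (simp add: DERIV_def)
        have "filterlim s (at 0) sequentially"
          using s0 s(1) by (auto simp: filterlim_at eventually_sequentially intro!: exI[of _ 0] less_imp_neq[THEN not_sym])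
        from filterlim_compose[OF lim this]
        show "(\<lambda>m. ?q m x) \<longlonglongrightarrow> ?u x * \<psi>' x (?e k) $ k"
          by (intro tendsto_mult tendsto_const)
      qed
    qed
    moreover have "(\<lambda>m. \<integral>x. ?q m x \<partial>lborel)
        \<longlonglongrightarrow> - (\<Sum>i\<in>I. n i $ k * P i)"
    proof (rule LIM_zero_cancel, rule Lim_null_comparison)
      show "eventually (\<lambda>m. norm ((\<integral>x. ?q m x \<partial>lborel)
          - - (\<Sum>i\<in>I. n i $ k * P i)) \<le> C * s m) sequentially"
      proof (rule always_eventually, rule allI)
        fix m
        define A where "A = (\<integral>x. jump x (x + s m *\<^sub>R (- ?e k)) * \<psi> x $ k \<partial>lborel)"
        define S where "S = (\<Sum>i\<in>I. n i $ k * P i)"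
        have "(\<Sum>i\<in>I. (if (-1::real) = 1 then \<bar>n i \<bullet> - ?e k\<bar> else n i \<bullet> - ?e k) * P i) = - S"
          by (simp add: S_def inner_axis sum_negf)
        then have "\<bar>A + s m * S\<bar> \<le> C * (s m)\<^sup>2"
          using CP[rule_format, OF s(1,2), of "- ?e k" m] by (simp add: A_def)
        moreover have "A / s m + S = (A + s m * S) / s m" using s[of m] by (simp add: field_simps)
        ultimately have "\<bar>A / s m + S\<bar> \<le> C * s m"
          using s(1)[of m] by (simp add: field_simps power2_eq_square)
        then show "norm ((\<integral>x. ?q m x \<partial>lborel)
          - - (\<Sum>i\<in>I. n i $ k * P i)) \<le> C * s m"
          unfolding quot A_def[symmetric] S_def[symmetric] by simp
      qed
      show "(\<lambda>m. C * s m) \<longlonglongrightarrow> 0"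
        using tendsto_mult[OF tendsto_const s0, of C] by simp
    qed
    ultimately have "(\<integral>x. ?u x * (\<psi>' x (?e k) $ k) \<partial>lborel) = - (\<Sum>i\<in>I. n i $ k * P i)"
      by (rule LIMSEQ_unique)
    with P show "\<exists>P. (\<forall>i\<in>I. ((\<lambda>t. flux.slab_integral (\<lambda>x. \<psi> x $ k) i t / t) \<longlongrightarrow> P i) (at_right 0)) \<and>
      (\<integral>x. ?u x * (\<psi>' x (?e k) $ k) \<partial>lborel) = - (\<Sum>i\<in>I. n i $ k * P i)" by blast
  qed
  obtain P where P: "\<And>i k. i \<in> I \<Longrightarrow> ((\<lambda>t. flux.slab_integral (\<lambda>x. \<psi> x $ k) i t / t) \<longlongrightarrow> P k i) (at_right 0)"
    and eq: "\<And>k. (\<integral>x. ?u x * (\<psi>' x (?e k) $ k) \<partial>lborel) = - (\<Sum>i\<in>I. n i $ k * P k i)"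
    using choice[OF ex] by blast
  have slab: "flux.slab_integral (\<lambda>x. if x \<in> X then n i \<bullet> \<phi> x else 0) i t
      = (\<Sum>k\<in>UNIV. n i $ k * flux.slab_integral (\<lambda>x. \<psi> x $ k) i t)" for i t
  proof -
    let ?J = "{x. 0 < height i x \<and> height i x < t}"
    have int: "integrable lborel (\<lambda>x. indicator ?J x * (jump (mirror i x) x * \<psi> x $ k))" for k
      by (rule flux.integrable_D_psi[OF lipk bdk, where R' = R]) (auto dest: flux.D_support)
    have "(\<lambda>x. indicator ?J x * (jump (mirror i x) x * (if x \<in> X then n i \<bullet> \<phi> x else 0)))
        = (\<lambda>x. \<Sum>k\<in>UNIV. n i $ k * (indicator ?J x * (jump (mirror i x) x * \<psi> x $ k)))"
    proof
      fix x
      have e: "(if x \<in> X then n i \<bullet> \<phi> x else 0) = (\<Sum>k\<in>UNIV. n i $ k * \<psi> x $ k)"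
        by (simp add: \<psi>_def inner_vec_def)
      show "indicator ?J x * (jump (mirror i x) x * (if x \<in> X then n i \<bullet> \<phi> x else 0))
        = (\<Sum>k\<in>UNIV. n i $ k * (indicator ?J x * (jump (mirror i x) x * \<psi> x $ k)))"
        unfolding e sum_distrib_left by (intro sum.cong refl) (simp add: mult_ac)
    qed
    then show ?thesis
      unfolding flux.slab_integral_def
      by (simp only: Bochner_Integration.integral_sum[OF integrable_mult_right[OF int]]
          Bochner_Integration.integral_mult_right_zero)
  qed
  have div: "(LINT x:X|lebesgue. indicator F x * divergence \<phi> x) = - (\<Sum>i\<in>I. \<Sum>k\<in>UNIV. n i $ k * P k i)"
  proof -
    have m [measurable]: "(\<lambda>x. \<psi>' x (?e k) $ k) \<in> borel_measurable borel" for k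
      using c[of "?e k"] by (intro borel_measurable_continuous_onI continuous_on_component)
    have int: "integrable lborel (\<lambda>x. ?u x * (\<psi>' x (?e k) $ k))" for k
    proof (rule integrable_bounded_on_cball)
      show "\<bar>?u x * (\<psi>' x (?e k) $ k)\<bar> \<le> L" for x
      proof -
        have "\<bar>\<psi>' x (?e k) $ k\<bar> \<le> norm (\<psi>' x (?e k))" by (rule component_le_norm_cart)
        also have "\<dots> \<le> L" using op[of x "?e k"] by simp
        finally show ?thesis using lipschitz_on_nonneg[OF lip] by (auto simp: indicator_def)
      qed
      show "x \<in> cball 0 R" if "?u x * (\<psi>' x (?e k) $ k) \<noteq> 0" for x
        using that X_bounded by (auto simp: indicator_def split: if_splits)
    qed measurable
    have "(LINT x:X|lebesgue. indicator F x * divergence \<phi> x) = (\<integral>x. (\<Sum>k\<in>UNIV. ?u x * (\<psi>' x (?e k) $ k)) \<partial>lebesgue)"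
      unfolding set_lebesgue_integral_def
      by (intro Bochner_Integration.integral_cong)
        (auto simp: indicator_def divergence_def \<psi>'_def)
    also have "\<dots> = (\<integral>x. (\<Sum>k\<in>UNIV. ?u x * (\<psi>' x (?e k) $ k)) \<partial>lborel)"
      by (rule integral_completion) measurable
    also have "\<dots> = (\<Sum>k\<in>UNIV. \<integral>x. ?u x * (\<psi>' x (?e k) $ k) \<partial>lborel)"
      by (rule Bochner_Integration.integral_sum) (rule int)
    also have "\<dots> = - (\<Sum>k\<in>UNIV. \<Sum>i\<in>I. n i $ k * P k i)"
      by (simp add: eq sum_negf)
    also have "(\<Sum>k\<in>UNIV. \<Sum>i\<in>I. n i $ k * P k i) = (\<Sum>i\<in>I. \<Sum>k\<in>UNIV. n i $ k * P k i)"
      by (rule sum.swap)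
    finally show ?thesis .
  qed
  have "((\<lambda>t. \<Sum>i\<in>I. \<Sum>k\<in>UNIV. n i $ k * (flux.slab_integral (\<lambda>x. \<psi> x $ k) i t / t))
      \<longlongrightarrow> (\<Sum>i\<in>I. \<Sum>k\<in>UNIV. n i $ k * P k i)) (at_right 0)"
    by (intro tendsto_sum tendsto_mult tendsto_const P)
  then show ?thesis
    unfolding slab div by (simp add: sum_divide_distrib)
qed

end

section \<open>Total variation: upper bound and calibrating field\<close>

lemma elementary_smooth_borel:
  fixes f :: "'a::euclidean_space \<Rightarrow> real"
  assumes "elementary_smooth f"
  shows "f \<in> borel_measurable borel"
proof -
  obtain f' where "\<And>x. (f has_derivative f' x) (at x)"
    using elementary_smooth_derivative[OF assms] by blast
  then have "continuous_on UNIV f"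
    by (intro continuous_at_imp_continuous_on ballI has_derivative_continuous)
  then show ?thesis by (rule borel_measurable_continuous_onI)
qed

context polyhedral_domain
begin

lemma integrable_variation_slab:
  "integrable lborel (\<lambda>x. indicator {x. 0 < height i x \<and> height i x < t} x * (\<bar>jump (mirror i x) x\<bar> * 1))"
  by (rule variation.integrable_D_psi[where L = 0 and B = 1 and \<psi> = "\<lambda>_. 1" and h = "\<lambda>x. x" and R' = R])
    (auto intro!: lipschitz_onI dest: flux.D_support)

lemma flux_le_variation:
  assumes g: "\<And>x. \<bar>g x\<bar> \<le> c"
  shows "\<bar>flux.slab_integral g i t\<bar> \<le> c * variation.slab_integral (\<lambda>_. 1) i t"
proof -
  let ?J = "{x. 0 < height i x \<and> height i x < t}"
  have c: "0 \<le> c" using order_trans[OF abs_ge_zero g] .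
  have "\<bar>flux.slab_integral g i t\<bar> \<le> (\<integral>x. \<bar>indicator ?J x * (jump (mirror i x) x * g x)\<bar> \<partial>lborel)"
    unfolding flux.slab_integral_def by (rule integral_abs_bound)
  also have "\<dots> \<le> (\<integral>x. c * (indicator ?J x * (\<bar>jump (mirror i x) x\<bar> * 1)) \<partial>lborel)"
  proof (rule integral_mono')
    show "integrable lborel (\<lambda>x. c * (indicator ?J x * (\<bar>jump (mirror i x) x\<bar> * 1)))"
      by (intro integrable_mult_right integrable_variation_slab)
    show "\<bar>indicator ?J x * (jump (mirror i x) x * g x)\<bar> \<le> c * (indicator ?J x * (\<bar>jump (mirror i x) x\<bar> * 1))" for x
      using mult_left_mono[OF g[of x] abs_ge_zero[of "jump (mirror i x) x"]]
      by (auto simp: indicator_def abs_mult mult.commute)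
  qed (use c in auto)
  also have "\<dots> = c * variation.slab_integral (\<lambda>_. 1) i t"
    unfolding variation.slab_integral_def by simp
  finally show ?thesis .
qed

lemma divergence_integral_le:
  assumes \<phi>: "\<phi> \<in> test_fields X" and c: "\<And>x. x \<in> X \<Longrightarrow> norm (\<phi> x) \<le> c" "0 \<le> c"
    and P: "\<And>i. i \<in> I \<Longrightarrow> ((\<lambda>t. variation.slab_integral (\<lambda>_. 1) i t / t) \<longlongrightarrow> P i) (at_right 0)"
  shows "(LINT x:X|lebesgue. indicator F x * divergence \<phi> x) \<le> c * (\<Sum>i\<in>I. P i)"
proof -
  let ?g = "\<lambda>i x. if x \<in> X then n i \<bullet> \<phi> x else 0"
  have lim: "((\<lambda>t. - (\<Sum>i\<in>I. flux.slab_integral (?g i) i t / t)) \<longlongrightarrow> (LINT x:X|lebesgue. indicator F x * divergence \<phi> x)) (at_right 0)"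
    using tendsto_minus[OF integral_divergence[OF \<phi>]] by simp
  have lim2: "((\<lambda>t. \<Sum>i\<in>I. c * (variation.slab_integral (\<lambda>_. 1) i t / t)) \<longlongrightarrow> (\<Sum>i\<in>I. c * P i)) (at_right 0)"
    by (intro tendsto_sum tendsto_mult tendsto_const P)
  have "eventually (\<lambda>t::real. 0 < t) (at_right 0)" by (simp add: eventually_at_filter)
  then have "eventually (\<lambda>t. - (\<Sum>i\<in>I. flux.slab_integral (?g i) i t / t)
      \<le> (\<Sum>i\<in>I. c * (variation.slab_integral (\<lambda>_. 1) i t / t))) (at_right 0)"
  proof eventually_elim
    case (elim t)
    show ?case
      unfolding sum_negf[symmetric]
    proof (rule sum_mono)
      fix i assume i: "i \<in> I"
      have gb: "\<bar>?g i x\<bar> \<le> c" for x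
        using Cauchy_Schwarz_ineq2[of "n i" "\<phi> x"] norm_normal[OF i] c by (auto intro: order_trans)
      have "- flux.slab_integral (?g i) i t \<le> c * variation.slab_integral (\<lambda>_. 1) i t"
        using flux_le_variation[of "?g i" c i t, OF gb] by linarith
      then have "(- flux.slab_integral (?g i) i t) / t \<le> (c * variation.slab_integral (\<lambda>_. 1) i t) / t"
        using elim by (intro divide_right_mono) auto
      then show "- (flux.slab_integral (?g i) i t / t) \<le> c * (variation.slab_integral (\<lambda>_. 1) i t / t)"
        by simp
    qed
  qed
  then have "(LINT x:X|lebesgue. indicator F x * divergence \<phi> x) \<le> (\<Sum>i\<in>I. c * P i)"
    by (rule tendsto_le[OF trivial_limit_at_right_real lim2 lim])
  then show ?thesis by (simp add: sum_distrib_left)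
qed

text \<open>The factors are functions of the squared heights, which keeps them smooth on both sides of each
hyperplane.  The constants are chosen such that the first factor is \<open>1\<close> up to height \<open>\<delta> / 8\<close> and
vanishes from \<open>\<delta> / 5\<close> on, while the other ones vanish up to height \<open>\<delta>\<close> and are \<open>1\<close> from \<open>2 * \<delta>\<close> on.
Hence the supports for different \<open>i\<close> are disjoint.\<close>

definition cutoff :: "real \<Rightarrow> 'i \<Rightarrow> real^'d \<Rightarrow> real" where
  "cutoff \<delta> i x = smooth_step (2 - 50 / \<delta>\<^sup>2 * (height i x)\<^sup>2) *
     (\<Prod>j\<in>I - {i}. smooth_step (1 / (3 * \<delta>\<^sup>2) * (height j x)\<^sup>2 - 1 / 3))"

text \<open>The jump is taken between two points at a fixed distance from the hyperplane, and not between \<open>x\<close>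
and its mirror image, so that it does not change sign, nor vanish, when \<open>x\<close> crosses the hyperplane.\<close>

definition face_jump :: "real \<Rightarrow> 'i \<Rightarrow> real^'d \<Rightarrow> real" where
  "face_jump \<delta> i x = jump (stretch (n i) (b i) 0 x - (\<delta> / 4) *\<^sub>R n i) (stretch (n i) (b i) 0 x + (\<delta> / 4) *\<^sub>R n i)"

text \<open>Near a hyperplane and away from the other ones this is \<open>-c\<close> times the jump times the normal,
that is, \<open>c\<close> times the outer normal of \<open>F\<close> where its frontier runs along the hyperplane
and separates it from its complement.\<close>

definition calibration :: "real \<Rightarrow> real \<Rightarrow> real^'d \<Rightarrow> real^'d" where
  "calibration c \<delta> x = (\<Sum>i\<in>I. (- c * face_jump \<delta> i x * cutoff \<delta> i x) *\<^sub>R n i)"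

lemma cutoff_elementary: "elementary_smooth (cutoff \<delta> i)"
proof -
  have h: "elementary_smooth (\<lambda>x. n j \<bullet> x + - b j)" for j by (intro elementary_smooth.intros)
  have "elementary_smooth (\<lambda>x. smooth_step (2 + (- 50 / \<delta>\<^sup>2) * ((n i \<bullet> x + - b i) * (n i \<bullet> x + - b i))) *
     (\<Prod>j\<in>I - {i}. smooth_step (1 / (3 * \<delta>\<^sup>2) * ((n j \<bullet> x + - b j) * (n j \<bullet> x + - b j)) + - 1 / 3)))"
    using finite_index by (intro elementary_smooth.mult elementary_smooth_step elementary_smooth_prod
        elementary_smooth.add elementary_smooth.const h) auto
  then show ?thesis by (simp add: cutoff_def[abs_def] power2_eq_square)
qed

lemma cutoff_borel [measurable]: "cutoff \<delta> i \<in> borel_measurable borel"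
  by (rule elementary_smooth_borel[OF cutoff_elementary])

lemma cutoff_range: "0 \<le> cutoff \<delta> i x" "cutoff \<delta> i x \<le> 1"
  unfolding cutoff_def
  by (auto intro!: mult_nonneg_nonneg prod_nonneg mult_le_one prod_le_1 simp: smooth_step_range)

lemma cutoff_support:
  assumes \<delta>: "0 < \<delta>" and nz: "cutoff \<delta> i x \<noteq> 0"
  shows "\<bar>height i x\<bar> < \<delta> / 5" and "\<And>j. j \<in> I \<Longrightarrow> j \<noteq> i \<Longrightarrow> \<delta> < \<bar>height j x\<bar>"
proof -
  have "smooth_step (2 - 50 / \<delta>\<^sup>2 * (height i x)\<^sup>2) \<noteq> 0" using nz by (auto simp: cutoff_def)
  then have "2 - 50 / \<delta>\<^sup>2 * (height i x)\<^sup>2 > 0" using smooth_step_eq_0 by (meson not_le)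
  then have "(height i x)\<^sup>2 < (\<delta> / 5)\<^sup>2" using \<delta> by (simp add: field_simps)
  then show "\<bar>height i x\<bar> < \<delta> / 5" using \<delta> power2_less_imp_less[of "\<bar>height i x\<bar>" "\<delta> / 5"] by simp
  fix j assume j: "j \<in> I" "j \<noteq> i"
  then have "smooth_step (1 / (3 * \<delta>\<^sup>2) * (height j x)\<^sup>2 - 1 / 3) \<noteq> 0"
    using nz finite_index by (auto simp: cutoff_def)
  then have "1 / (3 * \<delta>\<^sup>2) * (height j x)\<^sup>2 - 1 / 3 > 0" using smooth_step_eq_0 by (meson not_le)
  then have "\<delta>\<^sup>2 < (height j x)\<^sup>2" using \<delta> by (simp add: field_simps)
  then show "\<delta> < \<bar>height j x\<bar>" using power2_less_imp_less[of \<delta> "\<bar>height j x\<bar>"] by simp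
qed

lemma cutoff_eq_1:
  assumes \<delta>: "0 < \<delta>" and i: "\<bar>height i x\<bar> \<le> \<delta> / 8" and j: "\<And>j. j \<in> I \<Longrightarrow> j \<noteq> i \<Longrightarrow> 2 * \<delta> \<le> \<bar>height j x\<bar>"
  shows "cutoff \<delta> i x = 1"
proof -
  have "(height i x)\<^sup>2 \<le> (\<delta> / 8)\<^sup>2" using power_mono[OF i, of 2] by simp
  then have "64 * (height i x)\<^sup>2 \<le> \<delta>\<^sup>2" by (simp add: power_divide)
  then have "50 * (height i x)\<^sup>2 \<le> \<delta>\<^sup>2" using zero_le_power2[of "height i x"] by linarith
  then have "1 \<le> 2 - 50 / \<delta>\<^sup>2 * (height i x)\<^sup>2" using \<delta> by (simp add: field_simps)
  then have 1: "smooth_step (2 - 50 / \<delta>\<^sup>2 * (height i x)\<^sup>2) = 1" by (rule smooth_step_eq_1)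
  have "smooth_step (1 / (3 * \<delta>\<^sup>2) * (height k x)\<^sup>2 - 1 / 3) = 1" if "k \<in> I - {i}" for k
  proof (rule smooth_step_eq_1)
    have "(2 * \<delta>)\<^sup>2 \<le> (height k x)\<^sup>2" using power_mono[OF j[of k], of 2] that \<delta> by simp
    then show "1 \<le> 1 / (3 * \<delta>\<^sup>2) * (height k x)\<^sup>2 - 1 / 3" using \<delta> by (simp add: field_simps)
  qed
  then have "(\<Prod>j\<in>I - {i}. smooth_step (1 / (3 * \<delta>\<^sup>2) * (height j x)\<^sup>2 - 1 / 3)) = 1"
    by (intro prod.neutral ballI)
  then show ?thesis unfolding cutoff_def 1 by simp
qed

lemma same_cell_face_points:
  assumes i: "i \<in> I" and s: "s \<noteq> 0" and hy: "s * height i y > 0"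
    and x: "\<bar>height i x\<bar> + \<bar>s\<bar> < r" "\<And>j. j \<in> I \<Longrightarrow> j \<noteq> i \<Longrightarrow> r \<le> \<bar>height j x\<bar>"
    and y: "\<And>j. j \<in> I \<Longrightarrow> j \<noteq> i \<Longrightarrow> height j x * height j y > 0"
  shows "same_cell y (stretch (n i) (b i) 0 x + s *\<^sub>R n i)"
  unfolding same_cell_def
proof
  fix j assume j: "j \<in> I"
  let ?p = "stretch (n i) (b i) 0 x + s *\<^sub>R n i"
  show "height j y * height j ?p > 0"
  proof (cases "j = i")
    case True
    have "height i ?p = height i (stretch (n i) (b i) 0 x) + s * (n i \<bullet> n i)"
      by (simp add: inner_add_right)
    also have "\<dots> = s" using norm_normal[OF i] height_stretch[OF i, of 0 x] by (simp add: norm_eq_1)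
    finally show ?thesis using True hy by (simp add: mult.commute)
  next
    case False
    have "dist x ?p \<le> dist x (stretch (n i) (b i) 0 x) + dist (stretch (n i) (b i) 0 x) ?p"
      by (rule dist_triangle)
    also have "\<dots> = \<bar>height i x\<bar> + \<bar>s\<bar>"
      using norm_normal[OF i] dist_stretch[OF i, of x 0] by (simp add: dist_norm)
    finally have "height j x * height j ?p > 0"
      using x(1) x(2)[OF j False] by (intro same_sideI j) linarith
    then show ?thesis using y[OF j False] by (auto simp: zero_less_mult_iff)
  qed
qed

text \<open>Close to the \<open>i\<close>-th hyperplane and far from all others there are just two cells, one on each side;
any point of the lower and any point of the upper one give the same jump.\<close>

lemma face_jump_eq:
  assumes \<delta>: "0 < \<delta>" and i: "i \<in> I" and x: "\<bar>height i x\<bar> < \<delta> / 2"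
    and far: "\<And>j. j \<in> I \<Longrightarrow> j \<noteq> i \<Longrightarrow> 3 * \<delta> / 4 \<le> \<bar>height j x\<bar>"
    and p: "height i p < 0" "\<And>j. j \<in> I \<Longrightarrow> j \<noteq> i \<Longrightarrow> height j x * height j p > 0"
    and q: "height i q > 0" "\<And>j. j \<in> I \<Longrightarrow> j \<noteq> i \<Longrightarrow> height j x * height j q > 0"
  shows "face_jump \<delta> i x = jump p q"
proof -
  have "same_cell p (stretch (n i) (b i) 0 x + (- (\<delta> / 4)) *\<^sub>R n i)"
    by (rule same_cell_face_points[OF i _ _ _ far p(2)]) (use \<delta> x p in \<open>auto simp: mult_pos_neg\<close>)
  moreover have "same_cell q (stretch (n i) (b i) 0 x + (\<delta> / 4) *\<^sub>R n i)"
    by (rule same_cell_face_points[OF i _ _ _ far q(2)]) (use \<delta> x q in auto)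
  ultimately have "jump p q = jump (stretch (n i) (b i) 0 x + (- (\<delta> / 4)) *\<^sub>R n i)
      (stretch (n i) (b i) 0 x + (\<delta> / 4) *\<^sub>R n i)"
    by (rule jump_cong)
  then show ?thesis by (simp add: face_jump_def)
qed

lemma face_jump_locally_constant:
  assumes \<delta>: "0 < \<delta>" and i: "i \<in> I"
    and x: "\<bar>height i x\<bar> < \<delta> / 2" "\<And>j. j \<in> I \<Longrightarrow> j \<noteq> i \<Longrightarrow> 3 * \<delta> / 4 < \<bar>height j x\<bar>"
    and y: "\<bar>height i y\<bar> < \<delta> / 2" "\<And>j. j \<in> I \<Longrightarrow> j \<noteq> i \<Longrightarrow> 3 * \<delta> / 4 < \<bar>height j y\<bar>"
    and xy: "\<And>j. j \<in> I \<Longrightarrow> j \<noteq> i \<Longrightarrow> height j x * height j y > 0"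
  shows "face_jump \<delta> i y = face_jump \<delta> i x"
proof -
  let ?p = "\<lambda>s. stretch (n i) (b i) 0 x + s *\<^sub>R n i"
  have hi: "height i (?p s) = s" for s
    using norm_normal[OF i] height_stretch[OF i, of 0 x] by (simp add: inner_add_right norm_eq_1)
  have hj: "height j y * height j (?p s) > 0" if j: "j \<in> I" "j \<noteq> i" and s: "\<bar>s\<bar> \<le> \<delta> / 4" for j s
  proof -
    have "dist x (?p s) \<le> dist x (stretch (n i) (b i) 0 x) + dist (stretch (n i) (b i) 0 x) (?p s)"
      by (rule dist_triangle)
    also have "\<dots> = \<bar>height i x\<bar> + \<bar>s\<bar>"
      using norm_normal[OF i] dist_stretch[OF i, of x 0] by (simp add: dist_norm)
    finally have "height j x * height j (?p s) > 0"
      using x(1) x(2)[OF j] s by (intro same_sideI j) linarith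
    then show ?thesis using xy[OF j] by (auto simp: zero_less_mult_iff)
  qed
  have "face_jump \<delta> i y = jump (?p (- (\<delta> / 4))) (?p (\<delta> / 4))"
  proof (rule face_jump_eq[OF \<delta> i y(1)])
    show "height i (?p (- (\<delta> / 4))) < 0" "height i (?p (\<delta> / 4)) > 0" unfolding hi using \<delta> by auto
    show "height j y * height j (?p (- (\<delta> / 4))) > 0" "height j y * height j (?p (\<delta> / 4)) > 0"
      if "j \<in> I" "j \<noteq> i" for j
      using hj[OF that, of "- (\<delta> / 4)"] hj[OF that, of "\<delta> / 4"] \<delta> by auto
  qed (use y(2) in \<open>auto intro: less_imp_le\<close>)
  then show ?thesis by (simp add: face_jump_def)
qed

lemma calibration_smooth:
  assumes \<delta>: "0 < \<delta>"
  shows "smooth_on S (calibration c \<delta>)"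
  unfolding smooth_on_def
proof
  fix k
  have loc: "\<exists>T g. open T \<and> x \<in> T \<and> elementary_smooth g \<and>
     (\<forall>y\<in>T. - c * face_jump \<delta> i y * cutoff \<delta> i y = g y)" if i: "i \<in> I" for i x
  proof (cases "\<bar>height i x\<bar> < \<delta> / 2 \<and> (\<forall>j\<in>I - {i}. 3 * \<delta> / 4 < \<bar>height j x\<bar>)")
    case True
    let ?T = "{y. \<bar>height i y\<bar> < \<delta> / 2} \<inter> (\<Inter>j\<in>I - {i}. {y. 3 * \<delta> / 4 < \<bar>height j y\<bar>} \<inter> {y. 0 < height j x * height j y})"
    have oT: "open ?T"
      using finite_index by (intro open_Int open_INT ballI open_Collect_less continuous_intros) auto
    have "0 < height j x * height j x" if j: "j \<in> I - {i}" for j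
    proof (rule same_sideI)
      from True j have "3 * \<delta> / 4 < \<bar>height j x\<bar>" by blast
      with \<delta> have "0 < \<bar>height j x\<bar>" by linarith
      then show "dist x x < \<bar>height j x\<bar>" by (simp only: dist_self)
    qed (use j in simp)
    then have xT: "x \<in> ?T" using True by simp
    have es: "elementary_smooth (\<lambda>y. (- c * face_jump \<delta> i x) * cutoff \<delta> i y)"
      by (intro elementary_smooth.mult elementary_smooth.const cutoff_elementary)
    have fj: "face_jump \<delta> i y = face_jump \<delta> i x" if "y \<in> ?T" for y
      by (rule face_jump_locally_constant[OF \<delta> i]) (use True that in auto)
    show ?thesis
      by (rule exI[of _ ?T], rule exI, intro conjI, rule oT, rule xT, rule es)
        (rule ballI, subst fj, assumption, rule refl)
  next
    case False
    let ?T = "{y. \<delta> / 5 < \<bar>height i y\<bar>} \<union> (\<Union>j\<in>I - {i}. {y. \<bar>height j y\<bar> < \<delta>})"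
    have "open ?T"
      by (intro open_Un open_UN ballI open_Collect_less continuous_intros)
    moreover have "x \<in> ?T"
    proof (rule ccontr)
      assume "x \<notin> ?T"
      then have "\<bar>height i x\<bar> \<le> \<delta> / 5" "\<And>j. j \<in> I - {i} \<Longrightarrow> \<delta> \<le> \<bar>height j x\<bar>" by (auto simp: not_less)
      moreover have "\<delta> / 5 < \<delta> / 2" "3 * \<delta> / 4 < \<delta>" using \<delta> by auto
      ultimately show False using False by (meson le_less_trans less_le_trans)
    qed
    moreover have "cutoff \<delta> i y = 0" if "y \<in> ?T" for y
      using cutoff_support[OF \<delta>, of i y] that by fastforce
    ultimately show ?thesis by (intro exI[of _ ?T] exI[of _ "\<lambda>_. 0"]) (auto intro: elementary_smooth.const)
  qed
  show "Ck_on k S (calibration c \<delta>)"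
  proof (rule Ck_on_if_locally_elementary[where J = I and w = n])
    fix x
    have "\<forall>i\<in>I. \<exists>Tg. open (fst Tg) \<and> x \<in> fst Tg \<and> elementary_smooth (snd Tg) \<and>
       (\<forall>y\<in>fst Tg. - c * face_jump \<delta> i y * cutoff \<delta> i y = snd Tg y)"
    proof
      fix i assume "i \<in> I"
      from loc[OF this, of x] obtain T g where "open T \<and> x \<in> T \<and> elementary_smooth g \<and>
         (\<forall>y\<in>T. - c * face_jump \<delta> i y * cutoff \<delta> i y = g y)" by (elim exE)
      then show "\<exists>Tg. open (fst Tg) \<and> x \<in> fst Tg \<and> elementary_smooth (snd Tg) \<and>
         (\<forall>y\<in>fst Tg. - c * face_jump \<delta> i y * cutoff \<delta> i y = snd Tg y)"
        by (intro exI[of _ "(T, g)"]) simp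
    qed
    from bchoice[OF this] obtain Tg where Tg: "\<forall>i\<in>I. open (fst (Tg i)) \<and> x \<in> fst (Tg i) \<and> elementary_smooth (snd (Tg i)) \<and>
       (\<forall>y\<in>fst (Tg i). - c * face_jump \<delta> i y * cutoff \<delta> i y = snd (Tg i) y)" by (elim exE)
    show "\<exists>T g. open T \<and> x \<in> T \<and> (\<forall>j\<in>I. elementary_smooth (g j)) \<and>
      (\<forall>y\<in>T. calibration c \<delta> y = (\<Sum>j\<in>I. g j y *\<^sub>R n j))"
    proof (intro exI[of _ "\<Inter>i\<in>I. fst (Tg i)"] exI[of _ "\<lambda>i. snd (Tg i)"] conjI ballI)
      show "open (\<Inter>i\<in>I. fst (Tg i))" using finite_index Tg by (intro open_INT) auto
      fix y assume "y \<in> (\<Inter>i\<in>I. fst (Tg i))"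
      then show "calibration c \<delta> y = (\<Sum>j\<in>I. snd (Tg j) y *\<^sub>R n j)"
        unfolding calibration_def using Tg by (intro sum.cong refl) auto
    qed (use Tg in auto)
  qed
qed

lemma calibration_single_face:
  assumes \<delta>: "0 < \<delta>" and i: "i \<in> I" and small: "\<bar>height i x\<bar> \<le> \<delta>"
  shows "calibration c \<delta> x = (- c * face_jump \<delta> i x * cutoff \<delta> i x) *\<^sub>R n i"
proof -
  have "cutoff \<delta> j x = 0" if "j \<in> I - {i}" for j
    using cutoff_support(2)[OF \<delta>, of j x i] i that small by fastforce
  then show ?thesis
    unfolding calibration_def using finite_index i
    by (subst sum.remove[OF finite_index i]) simp
qed

lemma calibration_nonzero:
  assumes \<delta>: "0 < \<delta>" and "calibration c \<delta> x \<noteq> 0"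
  obtains i where "i \<in> I" "cutoff \<delta> i x \<noteq> 0" "face_jump \<delta> i x \<noteq> 0"
proof -
  have "\<exists>i\<in>I. (- c * face_jump \<delta> i x * cutoff \<delta> i x) *\<^sub>R n i \<noteq> 0"
    using assms(2) unfolding calibration_def by (meson sum.neutral)
  then show ?thesis using that by auto
qed

text \<open>At most one face contributes at any given point.\<close>

lemma calibration_norm_le:
  assumes \<delta>: "0 < \<delta>" and c: "0 \<le> c"
  shows "norm (calibration c \<delta> x) \<le> c"
proof (cases "calibration c \<delta> x = 0")
  case False
  then obtain i where i: "i \<in> I" "cutoff \<delta> i x \<noteq> 0" using calibration_nonzero[OF \<delta>] by metis
  have "\<bar>height i x\<bar> \<le> \<delta>" using cutoff_support(1)[OF \<delta> i(2)] \<delta> by linarith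
  then have "norm (calibration c \<delta> x) = c * (\<bar>face_jump \<delta> i x\<bar> * cutoff \<delta> i x)"
    using c cutoff_range[of \<delta> i x] norm_normal[OF i(1)]
    by (simp add: calibration_single_face[OF \<delta> i(1)] abs_mult)
  also have "\<dots> \<le> c * 1"
    using c flux.D_bound cutoff_range[of \<delta> i x]
    by (intro mult_left_mono mult_le_one) (auto simp: face_jump_def)
  finally show ?thesis by simp
qed (use c in simp)

text \<open>If the field is nonzero at \<open>x\<close>, then the two points that define the jump lie in \<open>X\<close>, and every
point of the small ball that is off the hyperplane shares a cell with one of them.  The
points on the hyperplane follow from the convexity of \<open>X\<close>.  In particular the hyperplane does not
carry a boundary face of \<open>X\<close> at this place.\<close>

lemma calibration_support:
  assumes \<delta>: "0 < \<delta>" and nz: "calibration c \<delta> x \<noteq> 0"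
  shows "cball x (\<delta> / 8) \<subseteq> X"
proof
  obtain i where i: "i \<in> I" "cutoff \<delta> i x \<noteq> 0" "face_jump \<delta> i x \<noteq> 0"
    using calibration_nonzero[OF \<delta> nz] by metis
  note far = cutoff_support(2)[OF \<delta> i(2)]
  have side: "y \<in> X" if "height i y \<noteq> 0" "dist x y < \<delta>" for y
  proof -
    define s where "s = sgn (height i y) * (\<delta> / 4)"
    have "same_cell y (stretch (n i) (b i) 0 x + s *\<^sub>R n i)"
    proof (rule same_cell_face_points[OF i(1), where r = \<delta>])
      show "0 < height j x * height j y" if "j \<in> I" "j \<noteq> i" for j
        using far[OF that] \<open>dist x y < \<delta>\<close> by (intro same_sideI that) auto
      show "\<bar>height i x\<bar> + \<bar>s\<bar> < \<delta>"
        using cutoff_support(1)[OF \<delta> i(2)] \<delta> that by (auto simp: s_def abs_mult sgn_if)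
      show "0 < s * height i y" using that \<delta> by (auto simp: s_def sgn_if mult_pos_neg)
      show "\<delta> \<le> \<bar>height j x\<bar>" if "j \<in> I" "j \<noteq> i" for j using far[OF that] by simp
    qed (use that \<delta> in \<open>auto simp: s_def sgn_if\<close>)
    moreover have "stretch (n i) (b i) 0 x + s *\<^sub>R n i \<in> X"
      using i(3) that by (auto simp: face_jump_def jump_def s_def sgn_if indicator_def split: if_splits)
    ultimately show ?thesis using same_cell_mem_iff by blast
  qed
  fix y assume y: "y \<in> cball x (\<delta> / 8)"
  show "y \<in> X"
  proof (cases "height i y = 0")
    case False
    then show ?thesis using side[of y] y \<delta> by auto
  next
    case True
    \<comment> \<open>A point of the hyperplane is the midpoint of two points of \<open>X\<close>, one on each side.\<close>
    let ?q = "\<lambda>s. y + s *\<^sub>R n i"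
    have "?q s \<in> X" if s: "\<bar>s\<bar> = \<delta> / 8" for s
    proof (rule side)
      have "height i (?q s) = s" using True norm_normal[OF i(1)] by (simp add: inner_add_right norm_eq_1)
      then show "height i (?q s) \<noteq> 0" using s \<delta> by auto
      have "dist x (?q s) \<le> dist x y + dist y (?q s)" by (rule dist_triangle)
      then show "dist x (?q s) < \<delta>" using s \<delta> y norm_normal[OF i(1)] by (simp add: dist_norm)
    qed
    from this[of "\<delta> / 8"] this[of "- (\<delta> / 8)"] have "?q (\<delta> / 8) \<in> X" "?q (- (\<delta> / 8)) \<in> X" using \<delta> by auto
    from convexD[OF X_convex this, of "1/2" "1/2"] show ?thesis
      by (simp add: algebra_simps flip: scaleR_left_distrib)
  qed
qed

lemma calibration_test_field:
  assumes \<delta>: "0 < \<delta>"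
  shows "calibration c \<delta> \<in> test_fields X"
proof -
  let ?S = "{x\<in>X. calibration c \<delta> x \<noteq> 0}"
  have "closure ?S \<subseteq> X"
  proof
    fix y assume "y \<in> closure ?S"
    then obtain x where "x \<in> ?S" "dist x y < \<delta> / 8" using \<delta> by (auto simp: closure_approachable dest!: spec[of _ "\<delta> / 8"])
    then show "y \<in> X" using calibration_support[OF \<delta>, of c x] by auto
  qed
  moreover have "compact (closure ?S)"
    using X_bounded by (auto simp: compact_closure intro: bounded_subset[OF bounded_cball, of _ 0 R])
  ultimately show ?thesis using calibration_smooth[OF \<delta>] by (simp add: test_fields_def)
qed

text \<open>In a layer thinner than the plateau of the cut-off function, the flux of the field is \<open>-c\<close> times the
square of the jump wherever the cut-off function is \<open>1\<close>, that is, except close to a second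
hyperplane.\<close>

lemma calibration_flux:
  assumes \<delta>: "0 < \<delta>" and c: "0 \<le> c" and i: "i \<in> I" and t: "0 < t" "t \<le> \<delta> / 8"
  shows "c * variation.slab_integral (\<lambda>_. 1) i t - c * measure lborel (near_two R t (2 * \<delta>))
    \<le> - flux.slab_integral (\<lambda>x. if x \<in> X then n i \<bullet> calibration c \<delta> x else 0) i t"
proof -
  let ?J = "{x. 0 < height i x \<and> height i x < t}" and ?N = "near_two R t (2 * \<delta>)"
  let ?j = "\<lambda>x. jump (mirror i x) x"
  let ?a = "\<lambda>x. indicator ?J x * (\<bar>?j x\<bar> * 1) :: real"
  have eq: "indicator ?J x * (?j x * (if x \<in> X then n i \<bullet> calibration c \<delta> x else 0)) = - c * (?a x * cutoff \<delta> i x)" for x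
  proof (cases "x \<in> ?J \<and> ?j x \<noteq> 0")
    case True
    then have x: "0 < height i x" "height i x < t" "x \<in> X" by (auto simp: jump_def indicator_def split: if_splits)
    have "n i \<bullet> calibration c \<delta> x = - c * face_jump \<delta> i x * cutoff \<delta> i x"
      using x t \<delta> norm_normal[OF i] by (subst calibration_single_face[OF \<delta> i]) (auto simp: norm_eq_1)
    moreover have "face_jump \<delta> i x = ?j x" if nz: "cutoff \<delta> i x \<noteq> 0"
    proof (rule face_jump_eq[OF \<delta> i])
      note far = cutoff_support(2)[OF \<delta> nz]
      show "\<bar>height i x\<bar> < \<delta> / 2" using x t \<delta> by auto
      show "3 * \<delta> / 4 \<le> \<bar>height j x\<bar>" if "j \<in> I" "j \<noteq> i" for j using far[OF that] \<delta> by linarith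
      show "height i (mirror i x) < 0" unfolding height_stretch[OF i] using x by simp
      show "height j x * height j (mirror i x) > 0" if "j \<in> I" "j \<noteq> i" for j
        using far[OF that] x t \<delta> by (intro same_sideI that) (simp add: dist_stretch[OF i])
      show "height j x * height j x > 0" if "j \<in> I" "j \<noteq> i" for j
        using far[OF that] \<delta> by (auto simp: zero_less_mult_iff linorder_neq_iff)
    qed (use x in simp)
    moreover have "?j x * ?j x = \<bar>?j x\<bar>" by (simp add: jump_def indicator_def)
    ultimately show ?thesis using x by (cases "cutoff \<delta> i x = 0") (auto simp: mult_ac)
  qed auto
  have m [measurable]: "?a \<in> borel_measurable borel" by measurable
  have int: "integrable lborel (\<lambda>x. ?a x * cutoff \<delta> i x)"
  proof (rule integrable_bounded_on_cball)
    show "\<bar>?a x * cutoff \<delta> i x\<bar> \<le> 1" for x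
      using flux.D_bound[of "mirror i x" x] cutoff_range[of \<delta> i x]
      by (auto simp: indicator_def abs_mult intro!: mult_le_one)
    show "x \<in> cball 0 R" if "?a x * cutoff \<delta> i x \<noteq> 0" for x
      using that flux.D_support[of "mirror i x" x] by auto
  qed measurable
  have ia: "integrable lborel (\<lambda>x. c * ?a x)"
    by (intro integrable_mult_right integrable_variation_slab)
  have iN: "integrable lborel (\<lambda>x. c * indicator ?N x)"
    using near_two_fmeasurable[of R t "2 * \<delta>"]
    by (intro integrable_mult_right integrable_real_indicator) (auto simp: fmeasurable_def)
  have "(\<integral>x. c * ?a x - c * indicator ?N x \<partial>lborel) \<le> (\<integral>x. c * (?a x * cutoff \<delta> i x) \<partial>lborel)"
  proof (rule integral_mono)
    show "integrable lborel (\<lambda>x. c * ?a x - c * indicator ?N x)"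
      by (rule Bochner_Integration.integrable_diff[OF ia iN])
    show "integrable lborel (\<lambda>x. c * (?a x * cutoff \<delta> i x))" by (intro integrable_mult_right int)
    fix x
    have "?a x - indicator ?N x \<le> ?a x * cutoff \<delta> i x"
    proof (cases "x \<in> ?J \<and> ?j x \<noteq> 0 \<and> x \<notin> ?N")
      case True
      then have "x \<in> cball 0 R" using flux.D_support[of "mirror i x" x] by auto
      have "2 * \<delta> \<le> \<bar>height j x\<bar>" if j: "j \<in> I" "j \<noteq> i" for j
      proof (rule ccontr)
        assume "\<not> 2 * \<delta> \<le> \<bar>height j x\<bar>"
        then have "x \<in> ?N"
          unfolding near_two_def using \<open>x \<in> cball 0 R\<close> True j by (intro UN_I[OF i] UN_I[of j]) auto
        then show False using True by simp
      qed
      then have "cutoff \<delta> i x = 1"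
        using True t by (intro cutoff_eq_1[OF \<delta>]) auto
      then show ?thesis by simp
    next
      case False
      then have "?a x = 0 \<or> x \<in> ?N" by (auto simp: indicator_def)
      moreover have "0 \<le> ?a x" "?a x \<le> 1" using flux.D_bound[of "mirror i x" x] by (auto simp: indicator_def)
      moreover have "0 \<le> ?a x * cutoff \<delta> i x" using cutoff_range[of \<delta> i x] by (auto simp: indicator_def)
      ultimately show ?thesis by (auto simp: indicator_def)
    qed
    then show "c * ?a x - c * indicator ?N x \<le> c * (?a x * cutoff \<delta> i x)"
      using mult_left_mono[OF _ c] unfolding right_diff_distrib[symmetric] by blast
  qed
  also have "(\<integral>x. c * ?a x - c * indicator ?N x \<partial>lborel) = c * variation.slab_integral (\<lambda>_. 1) i t - c * measure lborel ?N"
    unfolding variation.slab_integral_def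
    by (simp only: Bochner_Integration.integral_diff[OF ia iN] Bochner_Integration.integral_mult_right_zero)
      simp
  also have "(\<integral>x. c * (?a x * cutoff \<delta> i x) \<partial>lborel) = - flux.slab_integral (\<lambda>x. if x \<in> X then n i \<bullet> calibration c \<delta> x else 0) i t"
    unfolding flux.slab_integral_def eq by simp
  finally show ?thesis .
qed

lemma calibration_divergence_ge:
  assumes P: "\<And>i. i \<in> I \<Longrightarrow> ((\<lambda>t. variation.slab_integral (\<lambda>_. 1) i t / t) \<longlongrightarrow> P i) (at_right 0)" and c: "0 \<le> c"
  obtains A where "A \<ge> 0" "\<And>\<delta>. 0 < \<delta> \<Longrightarrow>
    c * (\<Sum>i\<in>I. P i) - A * \<delta> \<le> (LINT x:X|lebesgue. indicator F x * divergence (calibration c \<delta>) x)"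
proof -
  obtain A where A: "A \<ge> 0" "\<And>s t. 0 \<le> s \<Longrightarrow> 0 \<le> t \<Longrightarrow> measure lborel (near_two R s t) \<le> A * (s * t)"
    using near_two_measure_le[of R] by metis
  show thesis
  proof (rule that[of "real (card I) * (c * (2 * A))"])
    fix \<delta> :: real assume \<delta>: "0 < \<delta>"
    let ?g = "\<lambda>i x. if x \<in> X then n i \<bullet> calibration c \<delta> x else 0"
    have lim: "((\<lambda>t. - (\<Sum>i\<in>I. flux.slab_integral (?g i) i t / t)) \<longlongrightarrow>
        (LINT x:X|lebesgue. indicator F x * divergence (calibration c \<delta>) x)) (at_right 0)"
      using tendsto_minus[OF integral_divergence[OF calibration_test_field[OF \<delta>]]] by simp
    have lim2: "((\<lambda>t. \<Sum>i\<in>I. c * (variation.slab_integral (\<lambda>_. 1) i t / t) - c * (2 * A) * \<delta>)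
        \<longlongrightarrow> (\<Sum>i\<in>I. c * P i - c * (2 * A) * \<delta>)) (at_right 0)"
      by (intro tendsto_sum tendsto_diff tendsto_mult tendsto_const P)
    have "eventually (\<lambda>t::real. t \<in> {0<..<\<delta> / 8}) (at_right 0)"
      by (rule eventually_at_right_real) (use \<delta> in simp)
    then have "eventually (\<lambda>t. (\<Sum>i\<in>I. c * (variation.slab_integral (\<lambda>_. 1) i t / t) - c * (2 * A) * \<delta>)
        \<le> - (\<Sum>i\<in>I. flux.slab_integral (?g i) i t / t)) (at_right 0)"
    proof eventually_elim
      case (elim t)
      then have t: "0 < t" "t \<le> \<delta> / 8" by auto
      show ?case
        unfolding sum_negf[symmetric]
      proof (rule sum_mono)
        fix i assume i: "i \<in> I"
        have "c * measure lborel (near_two R t (2 * \<delta>)) \<le> c * (A * (t * (2 * \<delta>)))"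
          using A t \<delta> c by (intro mult_left_mono) auto
        then have "c * variation.slab_integral (\<lambda>_. 1) i t - c * (A * (t * (2 * \<delta>))) \<le> - flux.slab_integral (?g i) i t"
          using calibration_flux[OF \<delta> c i t] by linarith
        then have "(c * variation.slab_integral (\<lambda>_. 1) i t - c * (A * (t * (2 * \<delta>)))) / t \<le> (- flux.slab_integral (?g i) i t) / t"
          using t by (intro divide_right_mono) auto
        then show "c * (variation.slab_integral (\<lambda>_. 1) i t / t) - c * (2 * A) * \<delta> \<le> - (flux.slab_integral (?g i) i t / t)"
          using t by (simp add: diff_divide_distrib mult_ac)
      qed
    qed
    then have "(\<Sum>i\<in>I. c * P i - c * (2 * A) * \<delta>) \<le> (LINT x:X|lebesgue. indicator F x * divergence (calibration c \<delta>) x)"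
      by (rule tendsto_le[OF trivial_limit_at_right_real lim lim2])
    then show "c * (\<Sum>i\<in>I. P i) - real (card I) * (c * (2 * A)) * \<delta>
        \<le> (LINT x:X|lebesgue. indicator F x * divergence (calibration c \<delta>) x)"
      by (simp add: sum_subtractf sum_distrib_left mult.assoc)
  qed (use A c in auto)
qed

end

section \<open>The total variation and the nonlocal energy\<close>

lemma sigma_ball_lborel:
  "sigma (indicator (ball 0 1)) \<nu> = (\<integral>x. indicator (ball 0 1) x * \<bar>x \<bullet> \<nu>\<bar> \<partial>(lborel :: (real^'d) measure))"
  unfolding sigma_def
proof (rule integral_completion)
  have [measurable]: "ball (0::real^'d) 1 \<in> sets borel" by simp
  show "(\<lambda>x. indicator (ball 0 1) x * \<bar>x \<bullet> \<nu>\<bar>) \<in> borel_measurable (lborel :: (real^'d) measure)" by measurable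
qed

lemma sigma_ball_orthogonal:
  fixes Q :: "real^'d \<Rightarrow> real^'d"
  assumes Q: "orthogonal_transformation Q"
  shows "sigma (indicator (ball 0 1)) (Q \<nu>) = sigma (indicator (ball 0 1)) \<nu>"
proof -
  let ?g = "\<lambda>x. indicator (ball 0 1) x * \<bar>x \<bullet> Q \<nu>\<bar> :: real"
  have [measurable]: "ball (0::real^'d) 1 \<in> sets borel" by simp
  have [measurable]: "Q \<in> borel_measurable borel"
    using Q by (intro borel_measurable_continuous_onI linear_continuous_on)
      (simp add: linear_linear orthogonal_transformation_linear)
  have "(\<integral>x. ?g x \<partial>lborel) = (\<integral>x. ?g x \<partial>distr lborel borel Q)"
    by (simp add: lborel_distr_orthogonal[OF Q])
  also have "\<dots> = (\<integral>x. ?g (Q x) \<partial>lborel)"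
    by (rule integral_distr) auto
  also have "(\<lambda>x. ?g (Q x)) = (\<lambda>x. indicator (ball 0 1) x * \<bar>x \<bullet> \<nu>\<bar>)"
    using Q by (auto simp: orthogonal_transformation_norm orthogonal_transformation_def indicator_def fun_eq_iff norm_eq_sqrt_inner)
  finally show ?thesis by (simp add: sigma_ball_lborel)
qed

text \<open>Rotation invariance reduces all directions to one coordinate axis.\<close>

lemma sigma_ball_radial:
  obtains c where "0 \<le> c" "\<And>\<nu> :: real^'d. sigma (indicator (ball 0 1)) \<nu> = c * norm \<nu>"
proof -
  fix k :: 'd
  let ?e = "axis k 1 :: real^'d" and ?s = "sigma (indicator (ball 0 1)) :: real^'d \<Rightarrow> real"
  have "?s \<nu> = ?s ?e * norm \<nu>" for \<nu>
  proof -
    obtain Q where Q: "orthogonal_transformation Q" "Q (norm \<nu> *\<^sub>R ?e) = \<nu>"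
      using orthogonal_transformation_exists[of "norm \<nu> *\<^sub>R ?e" \<nu>] by auto
    have "?s \<nu> = ?s (norm \<nu> *\<^sub>R ?e)" using sigma_ball_orthogonal[OF Q(1)] Q(2) by metis
    also have "\<dots> = (\<integral>x. norm \<nu> * (indicator (ball 0 1) x * \<bar>x \<bullet> ?e\<bar>) \<partial>(lborel :: (real^'d) measure))"
      unfolding sigma_ball_lborel by (intro Bochner_Integration.integral_cong) (auto simp: abs_mult mult_ac)
    also have "\<dots> = ?s ?e * norm \<nu>" unfolding sigma_ball_lborel by simp
    finally show ?thesis .
  qed
  moreover have "0 \<le> ?s ?e" unfolding sigma_ball_lborel by (intro Bochner_Integration.integral_nonneg) simp
  ultimately show thesis using that by blast
qed

lemma sigma_star_le_0:
  fixes p :: "real^'d"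
  assumes "\<And>\<nu>. sigma \<eta> \<nu> = c * norm \<nu>" "norm p \<le> c"
  shows "sigma_star \<eta> p \<le> 0"
  unfolding sigma_star_def
proof (rule SUP_least)
  fix \<nu> :: "real^'d"
  have "\<nu> \<bullet> p \<le> norm \<nu> * norm p" by (rule norm_cauchy_schwarz)
  also have "\<dots> \<le> norm \<nu> * c" by (rule mult_left_mono[OF assms(2)]) simp
  finally show "ereal (\<nu> \<bullet> p - sigma \<eta> \<nu>) \<le> 0" by (simp add: assms(1) mult.commute)
qed

text \<open>If \<open>|p| > c\<close>, the supremum is unbounded along the multiples of \<open>p\<close>.\<close>

lemma norm_le_if_sigma_star_finite:
  fixes p :: "real^'d"
  assumes s: "\<And>\<nu>. sigma \<eta> \<nu> = c * norm \<nu>" and c: "0 \<le> c" and fin: "sigma_star \<eta> p < \<infinity>"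
  shows "norm p \<le> c"
proof (rule ccontr)
  assume "\<not> norm p \<le> c"
  moreover from this have "0 < norm p" using c by auto
  ultimately have e: "0 < norm p * (norm p - c)" by simp
  have le: "ereal (\<nu> \<bullet> p - sigma \<eta> \<nu>) \<le> sigma_star \<eta> p" for \<nu>
    unfolding sigma_star_def by (rule SUP_upper) simp
  have "0 \<le> sigma_star \<eta> p" using le[of 0] by (simp add: s zero_ereal_def)
  with fin obtain m where m: "sigma_star \<eta> p = ereal m" "0 \<le> m" by (cases "sigma_star \<eta> p") auto
  \<comment> \<open>The value at \<open>t *\<^sub>R p\<close> grows like \<open>t * K\<close>; the choice of \<open>t\<close> makes it exceed the finite supremum \<open>m\<close>.\<close>
  define K where "K = norm p * (norm p - c)"
  define t where "t = (m + 1) / K"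
  have K: "0 < K" using e by (simp add: K_def)
  then have "0 \<le> t" using m by (simp add: t_def)
  then have "(t *\<^sub>R p) \<bullet> p - sigma \<eta> (t *\<^sub>R p) = t * K"
    by (simp add: s K_def power2_norm_eq_inner[symmetric] power2_eq_square algebra_simps)
  also have "\<dots> = m + 1" using K by (simp add: t_def)
  finally show False using le[of "t *\<^sub>R p"] m by simp
qed

lemma eta_scaled_borel [measurable]: "eta_scaled e \<in> borel_measurable borel"
proof -
  have "{x::real^'d. norm x \<le> e} \<in> sets borel" by simp
  then show ?thesis unfolding eta_scaled_def[abs_def] by measurable
qed

lemma distr_uniform:
  fixes \<xi> :: "'w \<Rightarrow> real^'d"
  assumes X: "X \<in> sets borel" and rho: "\<And>x. x \<in> X \<Longrightarrow> \<rho> x = (1::real)"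
    and dens: "distributed M (restrict_space lborel X) \<xi> (\<lambda>x. ennreal (\<rho> x))"
  shows "\<xi> \<in> borel_measurable M" "\<And>\<omega>. \<omega> \<in> space M \<Longrightarrow> \<xi> \<omega> \<in> X"
    "distr M borel \<xi> = density lborel (\<lambda>x. ennreal (indicator X x))"
proof -
  have \<xi>: "\<xi> \<in> measurable M (restrict_space lborel X)" by (rule distributed_measurable[OF dens])
  then have "\<xi> \<in> measurable M lborel" "\<xi> \<in> space M \<rightarrow> X"
    using X measurable_restrict_space2_iff[of \<xi> M lborel X] by auto
  then show m [measurable]: "\<xi> \<in> borel_measurable M" and inX: "\<And>\<omega>. \<omega> \<in> space M \<Longrightarrow> \<xi> \<omega> \<in> X"
    by auto
  show "distr M borel \<xi> = density lborel (\<lambda>x. ennreal (indicator X x))"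
  proof (rule measure_eqI)
    fix A assume "A \<in> sets (distr M borel \<xi>)"
    then have A [measurable]: "A \<in> sets borel" by simp
    have [measurable]: "X \<in> sets borel" by (rule X)
    have "emeasure (distr M borel \<xi>) A = emeasure M (\<xi> -` (A \<inter> X) \<inter> space M)"
      using inX by (subst emeasure_distr) (auto intro!: arg_cong[of _ _ "emeasure M"])
    also have "\<dots> = (\<integral>\<^sup>+x. ennreal (\<rho> x) * indicator (A \<inter> X) x \<partial>restrict_space lborel X)"
      by (rule distributed_emeasure[OF dens]) (use X A in \<open>auto simp: sets_restrict_space\<close>)
    also have "\<dots> = (\<integral>\<^sup>+x. indicator A x * indicator X x \<partial>lborel)"
      using X by (subst nn_integral_restrict_space) (auto intro!: nn_integral_cong simp: indicator_def rho)
    also have "\<dots> = emeasure (density lborel (\<lambda>x. ennreal (indicator X x))) A"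
      by (subst emeasure_density) (auto intro!: nn_integral_cong simp: indicator_def)
    finally show "emeasure (distr M borel \<xi>) A = emeasure (density lborel (\<lambda>x. ennreal (indicator X x))) A" .
  qed simp
qed

context polyhedral_domain
begin

text \<open>Up to the factor \<open>e\<close>, the deterministic functional of which the graph total variation is an
unbiased estimator.\<close>

definition nonlocal_energy :: "real \<Rightarrow> real" where
  "nonlocal_energy e = (\<integral>z. indicator (cball 0 1) z * (\<integral>x. \<bar>jump x (x + e *\<^sub>R z)\<bar> \<partial>lborel) \<partial>(lborel :: (real^'d) measure))"

text \<open>The substitution \<open>y = x + e *\<^sub>R z\<close> absorbs the normalising factor of \<open>eta_scaled\<close>.\<close>

lemma pair_integral_eq_nonlocal_energy:
  assumes e: "0 < e"
  shows "(\<integral>x. \<integral>y. eta_scaled e (x - y) * \<bar>jump x y\<bar> \<partial>lborel \<partial>lborel) = nonlocal_energy e"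
proof -
  have [measurable]: "cball (0::real^'d) 1 \<in> sets borel" by simp
  have [measurable]: "(\<lambda>x. eta_scaled e (x - y)) \<in> borel_measurable borel"
    "(\<lambda>y. eta_scaled e (x - y)) \<in> borel_measurable borel" for x y :: "real^'d"
    by (rule measurable_compose[OF _ eta_scaled_borel], measurable)+
  have inner: "(\<integral>y. eta_scaled e (x - y) * \<bar>jump x y\<bar> \<partial>lborel)
      = (\<integral>z. indicator (cball 0 1) z * \<bar>jump x (x + e *\<^sub>R z)\<bar> \<partial>lborel)" for x
  proof -
    let ?f = "\<lambda>y. eta_scaled e (x - y) * \<bar>jump x y\<bar>"
    have "(\<integral>y. ?f y \<partial>lborel) = (\<integral>y. ?f y \<partial>density (distr lborel borel (\<lambda>z. x + e *\<^sub>R z)) (\<lambda>_. ennreal (\<bar>e\<bar> ^ DIM(real^'d))))"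
      using lborel_affine[of e x] e by simp
    also have "\<dots> = (\<integral>y. (\<bar>e\<bar> ^ DIM(real^'d)) *\<^sub>R ?f y \<partial>distr lborel borel (\<lambda>z. x + e *\<^sub>R z))"
      by (rule integral_density) auto
    also have "\<dots> = (\<integral>z. (\<bar>e\<bar> ^ DIM(real^'d)) *\<^sub>R ?f (x + e *\<^sub>R z) \<partial>lborel)"
      by (rule integral_distr) auto
    also have "\<dots> = (\<integral>z. indicator (cball 0 1) z * \<bar>jump x (x + e *\<^sub>R z)\<bar> \<partial>lborel)"
      using e by (intro Bochner_Integration.integral_cong refl) (simp add: eta_scaled_def indicator_def)
    finally show ?thesis .
  qed
  let ?h = "\<lambda>x z. indicator (cball 0 1) z * \<bar>jump x (x + e *\<^sub>R z)\<bar> :: real"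
  have "integrable lborel (\<lambda>(x, z). ?h x z)"
  proof (rule integrable_bounded_on_cball[where B = 1 and R = "R + 1"])
    have m: "(\<lambda>p::(real^'d) \<times> (real^'d). indicator (cball 0 1) (snd p) :: real) \<in> borel_measurable borel"
      by (rule measurable_compose[of snd borel borel])
        (auto intro!: borel_measurable_continuous_onI continuous_on_snd continuous_on_id borel_measurable_indicator)
    have "(\<lambda>p::(real^'d) \<times> (real^'d). \<bar>jump (fst p) (fst p + e *\<^sub>R snd p)\<bar>) \<in> borel_measurable borel"
      by (intro borel_measurable_abs jump_borel borel_measurable_continuous_onI continuous_intros)
    with m show "(\<lambda>(x, z). ?h x z) \<in> borel_measurable borel"
      by (simp add: case_prod_beta borel_measurable_times)
    show "\<bar>case p of (x, z) \<Rightarrow> ?h x z\<bar> \<le> 1" for p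
      using flux.D_bound by (auto simp: indicator_def split: prod.split)
    show "p \<in> cball 0 (R + 1)" if "(case p of (x, z) \<Rightarrow> ?h x z) \<noteq> 0" for p
    proof -
      have "norm (fst p) \<le> R" "norm (snd p) \<le> 1"
        using that flux.D_support[of "fst p" "fst p + e *\<^sub>R snd p"]
        by (auto simp: indicator_def split: prod.splits if_splits)
      then show ?thesis using norm_Pair_le[of "fst p" "snd p"] by simp
    qed
  qed
  then have int: "integrable (lborel \<Otimes>\<^sub>M lborel) (\<lambda>(x, z). ?h x z)" by (simp add: lborel_prod)
  show ?thesis
    unfolding inner nonlocal_energy_def
    by (subst lborel_pair.Fubini_integral[OF int, symmetric]) simp
qed

text \<open>The coefficients \<open>P i\<close> are characterised by their limits, which identifies them with those in the
formula for the total variation.\<close>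

lemma nonlocal_energy_expansion:
  assumes c: "\<And>\<nu> :: real^'d. sigma (indicator (ball 0 1)) \<nu> = c * norm \<nu>"
  shows "\<exists>C P. 0 \<le> C \<and> (\<forall>i\<in>I. ((\<lambda>t. variation.slab_integral (\<lambda>_. 1) i t / t) \<longlongrightarrow> P i) (at_right 0)) \<and>
    (\<forall>e. 0 < e \<longrightarrow> e \<le> 1 \<longrightarrow> \<bar>nonlocal_energy e - e * (c * (\<Sum>i\<in>I. P i))\<bar> \<le> C * e\<^sup>2)"
proof -
  have [measurable]: "cball (0::real^'d) 1 \<in> sets borel" "ball (0::real^'d) 1 \<in> sets borel" by simp_all
  have bd: "\<bar>1::real\<bar> \<le> 1" by simp
  have lip: "0-lipschitz_on UNIV (\<lambda>_::real^'d. 1::real)" by (rule lipschitz_onI) auto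
  obtain C P where C: "0 \<le> C" and P: "\<forall>i\<in>I. ((\<lambda>t. variation.slab_integral (\<lambda>_. 1) i t / t) \<longlongrightarrow> P i) (at_right 0)"
    and CP: "\<forall>t z. 0 < t \<longrightarrow> t \<le> 1 \<longrightarrow> norm z \<le> 1 \<longrightarrow>
      \<bar>(\<integral>x. \<bar>jump x (x + t *\<^sub>R z)\<bar> * 1 \<partial>lborel)
        - t * (\<Sum>i\<in>I. (if (1::real) = 1 then \<bar>n i \<bullet> z\<bar> else n i \<bullet> z) * P i)\<bar> \<le> C * t\<^sup>2"
    using variation.translation_jump_expansion[OF lip bd] by (elim exE conjE)
  define V where "V = measure lborel (cball (0::real^'d) 1)"
  have \<sigma>: "(\<integral>z. indicator (cball 0 1) z * \<bar>n i \<bullet> z\<bar> \<partial>lborel) = c" if "i \<in> I" for i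
  proof -
    have "AE z in lborel. z \<notin> sphere (0::real^'d) 1"
    proof (rule AE_not_in)
      have "sphere (0::real^'d) 1 \<in> null_sets lebesgue"
        using negligible_sphere by (simp add: negligible_iff_null_sets)
      then show "sphere (0::real^'d) 1 \<in> null_sets lborel"
        by (simp add: null_sets_def emeasure_completion)
    qed
    then have "AE z in lborel. indicator (cball 0 1) z * \<bar>n i \<bullet> z\<bar> = indicator (ball 0 1) z * \<bar>z \<bullet> n i\<bar>"
      by eventually_elim (auto simp: indicator_def inner_commute)
    then have "(\<integral>z. indicator (cball 0 1) z * \<bar>n i \<bullet> z\<bar> \<partial>lborel) = sigma (indicator (ball 0 1)) (n i)"
      unfolding sigma_ball_lborel by (intro integral_cong_AE) measurable
    then show ?thesis using c norm_normal[OF that] by simp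
  qed
  have intn: "integrable lborel (\<lambda>z. indicator (cball 0 1) z * \<bar>n i \<bullet> z\<bar>)" if "i \<in> I" for i
  proof (rule integrable_bounded_on_cball[where B = 1 and R = 1])
    show "\<bar>indicator (cball 0 1) z * \<bar>n i \<bullet> z\<bar>\<bar> \<le> 1" for z
      using Cauchy_Schwarz_ineq2[of "n i" z] norm_normal[OF that] by (auto simp: indicator_def)
  qed (auto simp: indicator_def split: if_splits)
  have "\<bar>nonlocal_energy e - e * (c * (\<Sum>i\<in>I. P i))\<bar> \<le> (C * V) * e\<^sup>2" if e: "0 < e" "e \<le> 1" for e
  proof -
    let ?g = "\<lambda>z. indicator (cball 0 1) z * (\<integral>x. \<bar>jump x (x + e *\<^sub>R z)\<bar> \<partial>lborel) :: real"
    let ?l = "\<lambda>z. \<Sum>i\<in>I. (e * P i) * (indicator (cball 0 1) z * \<bar>n i \<bullet> z\<bar>) :: real"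
    have intl: "integrable lborel ?l" by (intro Bochner_Integration.integrable_sum integrable_mult_right intn)
    have bound: "\<bar>?g z - ?l z\<bar> \<le> 0 * indicator {} z + (C * e\<^sup>2) * indicator (cball 0 1) z" for z
    proof (cases "z \<in> cball 0 1")
      case True
      then have "?l z = e * (\<Sum>i\<in>I. \<bar>n i \<bullet> z\<bar> * P i)" by (simp add: sum_distrib_left mult_ac)
      then show ?thesis using CP[rule_format, OF e, of z] True by simp
    qed simp
    have intg: "integrable lborel ?g"
    proof (rule integrable_bounded_on_cball[where B = "measure lborel (cball (0::real^'d) R)" and R = 1])
      show "?g \<in> borel_measurable borel"
      proof -
        have "(\<lambda>p::(real^'d) \<times> (real^'d). \<bar>jump (snd p) (snd p + e *\<^sub>R fst p)\<bar>) \<in> borel_measurable (borel \<Otimes>\<^sub>M lborel)"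
          by measurable
        then have "(\<lambda>z. \<integral>x. \<bar>jump x (x + e *\<^sub>R z)\<bar> \<partial>lborel) \<in> borel_measurable borel"
          by (intro lborel.borel_measurable_lebesgue_integral) (simp add: case_prod_beta)
        then show ?thesis by measurable
      qed
      show "\<bar>?g z\<bar> \<le> measure lborel (cball (0::real^'d) R)" for z
      proof -
        have "\<bar>\<integral>x. \<bar>jump x (x + e *\<^sub>R z)\<bar> \<partial>lborel\<bar> \<le> 0 * measure lborel ({}::(real^'d) set) + 1 * measure lborel (cball (0::real^'d) R)"
        proof (rule abs_integral_le_two_sets)
          show "cball (0::real^'d) R \<in> fmeasurable lborel" by (rule lmeasurable_subset_cball[of _ R]) auto
          have "\<bar>\<bar>jump x (x + e *\<^sub>R z)\<bar>\<bar> \<le> 0 * indicator {} x + 1 * indicator (cball 0 R) x" for x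
            using flux.D_bound[of x "x + e *\<^sub>R z"] flux.D_support[of x "x + e *\<^sub>R z"]
            by (cases "jump x (x + e *\<^sub>R z) = 0") (auto simp: indicator_def)
          then show "AE x in lborel. \<bar>\<bar>jump x (x + e *\<^sub>R z)\<bar>\<bar> \<le> 0 * indicator {} x + 1 * indicator (cball 0 R) x" by simp
        qed simp
        then show ?thesis by (auto simp: indicator_def)
      qed
    qed (auto simp: indicator_def split: if_splits)
    have "\<bar>\<integral>z. ?g z - ?l z \<partial>lborel\<bar> \<le> 0 * measure lborel ({}::(real^'d) set) + (C * e\<^sup>2) * measure lborel (cball (0::real^'d) 1)"
      by (rule abs_integral_le_two_sets) (use bound in \<open>auto intro: lmeasurable_subset_cball[of _ 1]\<close>)
    also have "(\<integral>z. ?g z - ?l z \<partial>lborel) = nonlocal_energy e - (\<integral>z. ?l z \<partial>lborel)"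
      unfolding nonlocal_energy_def by (rule Bochner_Integration.integral_diff[OF intg intl])
    also have "(\<integral>z. ?l z \<partial>lborel) = (\<Sum>i\<in>I. (e * P i) * c)"
      by (subst Bochner_Integration.integral_sum) (auto intro!: integrable_mult_right intn sum.cong simp: \<sigma>)
    also have "\<dots> = e * (c * (\<Sum>i\<in>I. P i))" by (simp add: sum_distrib_left mult_ac)
    finally show ?thesis by (simp add: V_def mult_ac)
  qed
  with C P show ?thesis
    by (intro exI[of _ "C * V"] exI[of _ P]) (simp add: V_def)
qed

lemma TV_eq:
  assumes c: "\<And>\<nu>. sigma \<eta> \<nu> = c * norm \<nu>" "0 \<le> c"
    and \<mu>: "\<And>x. x \<in> X \<Longrightarrow> \<mu> x = indicator F x" and \<rho>: "\<And>x. x \<in> X \<Longrightarrow> \<rho> x = 1"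
    and P: "\<And>i. i \<in> I \<Longrightarrow> ((\<lambda>t. variation.slab_integral (\<lambda>_. 1) i t / t) \<longlongrightarrow> P i) (at_right 0)"
  shows "TV X \<mu> \<rho> \<eta> = ereal (c * (\<Sum>i\<in>I. P i))"
proof (rule antisym)
  have eq: "(LINT x:X|lebesgue. \<mu> x * divergence \<phi> x) = (LINT x:X|lebesgue. indicator F x * divergence \<phi> x)" for \<phi>
    unfolding set_lebesgue_integral_def
    by (intro Bochner_Integration.integral_cong) (auto simp: indicator_def \<mu>)
  show "TV X \<mu> \<rho> \<eta> \<le> ereal (c * (\<Sum>i\<in>I. P i))"
    unfolding TV_def
  proof (rule SUP_least)
    fix \<phi> assume "\<phi> \<in> {\<phi> \<in> test_fields X. (SUP x\<in>X. sigma_star \<eta> (- ((1 / (\<rho> x)\<^sup>2) *\<^sub>R \<phi> x))) < \<infinity>}"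
    then have \<phi>: "\<phi> \<in> test_fields X" and fin: "(SUP x\<in>X. sigma_star \<eta> (- ((1 / (\<rho> x)\<^sup>2) *\<^sub>R \<phi> x))) < \<infinity>" by auto
    have "norm (\<phi> x) \<le> c" if "x \<in> X" for x
    proof -
      have "sigma_star \<eta> (- \<phi> x) \<le> (SUP x\<in>X. sigma_star \<eta> (- ((1 / (\<rho> x)\<^sup>2) *\<^sub>R \<phi> x)))"
        by (rule SUP_upper2[OF that]) (simp add: \<rho>[OF that])
      then have "norm (- \<phi> x) \<le> c"
        using fin by (intro norm_le_if_sigma_star_finite[OF c]) (rule le_less_trans)
      then show ?thesis by simp
    qed
    then have "(LINT x:X|lebesgue. indicator F x * divergence \<phi> x) \<le> c * (\<Sum>i\<in>I. P i)"
      by (rule divergence_integral_le[OF \<phi> _ c(2) P])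
    then show "ereal (LINT x:X|lebesgue. \<mu> x * divergence \<phi> x) \<le> ereal (c * (\<Sum>i\<in>I. P i))"
      by (simp add: eq)
  qed
  obtain A where A: "A \<ge> 0" "\<And>\<delta>. 0 < \<delta> \<Longrightarrow>
    c * (\<Sum>i\<in>I. P i) - A * \<delta> \<le> (LINT x:X|lebesgue. indicator F x * divergence (calibration c \<delta>) x)"
    using calibration_divergence_ge[of P c] P c(2) by blast
  have "ereal (c * (\<Sum>i\<in>I. P i) - A * (1 / real (Suc m))) \<le> TV X \<mu> \<rho> \<eta>" for m
  proof -
    define \<delta> where "\<delta> = 1 / real (Suc m)"
    have \<delta>: "0 < \<delta>" by (simp add: \<delta>_def)
    have "(SUP x\<in>X. sigma_star \<eta> (- ((1 / (\<rho> x)\<^sup>2) *\<^sub>R calibration c \<delta> x))) \<le> 0"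
    proof (rule SUP_least)
      fix x assume "x \<in> X"
      then show "sigma_star \<eta> (- ((1 / (\<rho> x)\<^sup>2) *\<^sub>R calibration c \<delta> x)) \<le> 0"
        using calibration_norm_le[OF \<delta> c(2), of x] by (intro sigma_star_le_0[OF c(1)]) (simp add: \<rho>)
    qed
    then have "(SUP x\<in>X. sigma_star \<eta> (- ((1 / (\<rho> x)\<^sup>2) *\<^sub>R calibration c \<delta> x))) < \<infinity>"
      by (rule le_less_trans) simp
    then have "ereal (LINT x:X|lebesgue. \<mu> x * divergence (calibration c \<delta>) x) \<le> TV X \<mu> \<rho> \<eta>"
      unfolding TV_def by (intro SUP_upper) (simp add: calibration_test_field[OF \<delta>])
    moreover have "ereal (c * (\<Sum>i\<in>I. P i) - A * \<delta>) \<le> ereal (LINT x:X|lebesgue. \<mu> x * divergence (calibration c \<delta>) x)"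
      using A(2)[OF \<delta>] by (simp add: eq)
    ultimately show ?thesis unfolding \<delta>_def[symmetric] by (rule order_trans[rotated])
  qed
  moreover have "(\<lambda>m. ereal (c * (\<Sum>i\<in>I. P i) - A * (1 / real (Suc m)))) \<longlonglongrightarrow> ereal (c * (\<Sum>i\<in>I. P i) - A * 0)"
    by (intro tendsto_intros LIMSEQ_inverse_real_of_nat[unfolded inverse_eq_divide])
  ultimately show "ereal (c * (\<Sum>i\<in>I. P i)) \<le> TV X \<mu> \<rho> \<eta>"
    by (intro LIMSEQ_le_const2[of "\<lambda>m. ereal (c * (\<Sum>i\<in>I. P i) - A * (1 / real (Suc m)))"]) auto
qed

text \<open>Distinct sample points are independent and uniform on \<open>X\<close>; the jump vanishes unless both points
lie in \<open>X\<close>, so the uniform measure can be replaced by Lebesgue measure.\<close>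

lemma expectation_pair:
  fixes \<xi> :: "nat \<Rightarrow> 'w \<Rightarrow> real^'d"
  assumes M: "prob_space M" and indep: "prob_space.indep_vars M (\<lambda>_. borel) \<xi> J"
    and J: "i \<in> J" "j \<in> J" "i \<noteq> j" and \<rho>: "\<And>x. x \<in> X \<Longrightarrow> \<rho> x = (1::real)"
    and dens: "\<And>i. i \<in> J \<Longrightarrow> distributed M (restrict_space lborel X) (\<xi> i) (\<lambda>x. ennreal (\<rho> x))"
    and e: "0 < e"
  shows "integrable M (\<lambda>\<omega>. eta_scaled e (\<xi> i \<omega> - \<xi> j \<omega>) * \<bar>jump (\<xi> i \<omega>) (\<xi> j \<omega>)\<bar>)"
    "(\<integral>\<omega>. eta_scaled e (\<xi> i \<omega> - \<xi> j \<omega>) * \<bar>jump (\<xi> i \<omega>) (\<xi> j \<omega>)\<bar> \<partial>M) = nonlocal_energy e"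
proof -
  interpret prob_space M by (rule M)
  define U where "U = density lborel (\<lambda>x. ennreal (indicator X x :: real))"
  let ?h = "\<lambda>x y. eta_scaled e (x - y) * \<bar>jump x y\<bar>"
  note dX = distr_uniform[OF sets_XF(1) \<rho> dens]
  have m [measurable]: "\<xi> i \<in> borel_measurable M" "\<xi> j \<in> borel_measurable M"
    using dX(1) J by auto
  have dU: "distr M borel (\<xi> i) = U" "distr M borel (\<xi> j) = U"
    using dX(3) J by (auto simp: U_def)
  have U: "prob_space U" using prob_space_distr[OF m(1)] by (simp add: dU)
  interpret U: prob_space U by (rule U)
  interpret UU: pair_prob_space U U ..
  have sU [measurable_cong, simp]: "sets U = sets borel" by (simp add: U_def)
  have "indep_var borel ((\<lambda>f. f i) \<circ> (\<lambda>\<omega>. restrict (\<lambda>i. \<xi> i \<omega>) {i}))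
      borel ((\<lambda>f. f j) \<circ> (\<lambda>\<omega>. restrict (\<lambda>i. \<xi> i \<omega>) {j}))"
    using J by (intro indep_var_compose[OF indep_var_restrict[OF indep]] measurable_component_singleton) auto
  then have "indep_var borel (\<xi> i) borel (\<xi> j)" by (simp add: comp_def)
  then have joint: "distr M (borel \<Otimes>\<^sub>M borel) (\<lambda>\<omega>. (\<xi> i \<omega>, \<xi> j \<omega>)) = U \<Otimes>\<^sub>M U"
    by (simp add: indep_var_distribution_eq dU)
  have mh [measurable]: "(\<lambda>(x, y). ?h x y) \<in> borel_measurable (borel \<Otimes>\<^sub>M borel)"
    unfolding case_prod_beta
    by (intro borel_measurable_times borel_measurable_abs jump_borel measurable_compose[OF _ eta_scaled_borel]) measurable
  have bound: "norm (?h x y) \<le> 1 / e ^ CARD('d)" for x y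
    using flux.D_bound[of x y] e by (auto simp: eta_scaled_def indicator_def abs_mult divide_right_mono)
  show int: "integrable M (\<lambda>\<omega>. ?h (\<xi> i \<omega>) (\<xi> j \<omega>))"
  proof (rule integrable_const_bound)
    show "AE \<omega> in M. norm (?h (\<xi> i \<omega>) (\<xi> j \<omega>)) \<le> 1 / e ^ CARD('d)" using bound by simp
    have "(\<lambda>\<omega>. (\<lambda>(x, y). ?h x y) (\<xi> i \<omega>, \<xi> j \<omega>)) \<in> borel_measurable M"
      by (rule measurable_compose[OF _ mh]) measurable
    then show "(\<lambda>\<omega>. ?h (\<xi> i \<omega>) (\<xi> j \<omega>)) \<in> borel_measurable M" by simp
  qed
  have mhU: "(\<lambda>(x, y). ?h x y) \<in> borel_measurable (U \<Otimes>\<^sub>M U)"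
    using mh by (simp cong: measurable_cong_sets sets_pair_measure_cong)
  have intU: "integrable (U \<Otimes>\<^sub>M U) (\<lambda>(x, y). ?h x y)"
    by (rule UU.integrable_const_bound[where B = "1 / e ^ CARD('d)"]) (use bound mhU in auto)
  have "(\<integral>\<omega>. ?h (\<xi> i \<omega>) (\<xi> j \<omega>) \<partial>M) = (\<integral>p. (case p of (x, y) \<Rightarrow> ?h x y) \<partial>distr M (borel \<Otimes>\<^sub>M borel) (\<lambda>\<omega>. (\<xi> i \<omega>, \<xi> j \<omega>)))"
    by (subst integral_distr) (use mh in auto)
  also have "\<dots> = (\<integral>x. \<integral>y. ?h x y \<partial>U \<partial>U)"
    unfolding joint using UU.integral_fst'[OF intU] by simp
  also have "\<dots> = (\<integral>x. \<integral>y. ?h x y \<partial>lborel \<partial>lborel)"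
  proof -
    have UI: "(\<integral>x. f x \<partial>U) = (\<integral>x. f x \<partial>lborel)" if "f \<in> borel_measurable borel" "\<And>x. x \<notin> X \<Longrightarrow> f x = 0" for f :: "real^'d \<Rightarrow> real"
    proof -
      have "(\<integral>x. f x \<partial>U) = (\<integral>x. indicator X x *\<^sub>R f x \<partial>lborel)"
        unfolding U_def by (rule integral_density) (use that in auto)
      also have "\<dots> = (\<integral>x. f x \<partial>lborel)"
        using that(2) by (intro Bochner_Integration.integral_cong) (auto simp: indicator_def)
      finally show ?thesis .
    qed
    have "(\<integral>y. ?h x y \<partial>U) = (\<integral>y. ?h x y \<partial>lborel)" for x
    proof (rule UI)
      show "?h x \<in> borel_measurable borel"
        by (intro borel_measurable_times borel_measurable_abs jump_borel measurable_compose[OF _ eta_scaled_borel]) measurable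
    qed (simp add: jump_def)
    then have "(\<integral>x. \<integral>y. ?h x y \<partial>U \<partial>U) = (\<integral>x. \<integral>y. ?h x y \<partial>lborel \<partial>U)" by simp
    also have "\<dots> = (\<integral>x. \<integral>y. ?h x y \<partial>lborel \<partial>lborel)"
    proof (rule UI)
      have "(\<lambda>(x, y). ?h x y) \<in> borel_measurable (borel \<Otimes>\<^sub>M lborel)"
        using mh by (simp cong: measurable_cong_sets sets_pair_measure_cong)
      then show "(\<lambda>x. \<integral>y. ?h x y \<partial>lborel) \<in> borel_measurable borel"
        by (rule lborel.borel_measurable_lebesgue_integral)
    qed (simp add: jump_def)
    finally show ?thesis .
  qed
  also have "\<dots> = nonlocal_energy e" by (rule pair_integral_eq_nonlocal_energy[OF e])
  finally show "(\<integral>\<omega>. ?h (\<xi> i \<omega>) (\<xi> j \<omega>) \<partial>M) = nonlocal_energy e" .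
qed

end

section \<open>The expected graph total variation\<close>

text \<open>All \<open>m * (m - 1)\<close> pairs of distinct points have the same expectation, and the diagonal
terms are \<open>0\<close>.\<close>

lemma (in polyhedral_domain) expectation_GTV:
  fixes \<xi> :: "nat \<Rightarrow> 'w \<Rightarrow> real^'d"
  assumes M: "prob_space M" and indep: "prob_space.indep_vars M (\<lambda>_. borel) \<xi> {1..}"
    and \<rho>: "\<And>x. x \<in> X \<Longrightarrow> \<rho> x = (1::real)"
    and dens: "\<And>i. i \<ge> 1 \<Longrightarrow> distributed M (restrict_space lborel X) (\<xi> i) (\<lambda>x. ennreal (\<rho> x))"
    and \<mu>: "\<And>x. x \<in> X \<Longrightarrow> \<mu> x = indicator F x"
    and e: "0 < e" and m: "2 \<le> m"
  shows "(\<integral>\<omega>. GTV e m (\<lambda>i. \<xi> i \<omega>) \<mu> \<partial>M) = nonlocal_energy e / e"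
proof -
  let ?h = "\<lambda>i j \<omega>. eta_scaled e (\<xi> i \<omega> - \<xi> j \<omega>) * \<bar>jump (\<xi> i \<omega>) (\<xi> j \<omega>)\<bar>"
  let ?c = "1 / e * (1 / (real m * (real m - 1)))"
  have dens': "distributed M (restrict_space lborel X) (\<xi> i) (\<lambda>x. ennreal (\<rho> x))" if "i \<in> {1..}" for i
    using dens that by simp
  have inX: "\<xi> i \<omega> \<in> X" if "1 \<le> i" "\<omega> \<in> space M" for i \<omega>
    using distr_uniform(2)[OF sets_XF(1) \<rho> dens] that by blast
  have eq: "GTV e m (\<lambda>i. \<xi> i \<omega>) \<mu> = ?c * (\<Sum>i\<in>{1..m}. \<Sum>j\<in>{1..m} - {i}. ?h i j \<omega>)" if \<omega>: "\<omega> \<in> space M" for \<omega>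
  proof -
    have "(\<Sum>j\<in>{1..m}. eta_scaled e (\<xi> i \<omega> - \<xi> j \<omega>) * \<bar>\<mu> (\<xi> i \<omega>) - \<mu> (\<xi> j \<omega>)\<bar>)
        = (\<Sum>j\<in>{1..m} - {i}. ?h i j \<omega>)" if "i \<in> {1..m}" for i
    proof (rule sum.mono_neutral_cong_right)
      fix j assume "j \<in> {1..m} - {i}"
      then have "\<xi> i \<omega> \<in> X" "\<xi> j \<omega> \<in> X" using inX \<omega> that by auto
      then show "eta_scaled e (\<xi> i \<omega> - \<xi> j \<omega>) * \<bar>\<mu> (\<xi> i \<omega>) - \<mu> (\<xi> j \<omega>)\<bar> = ?h i j \<omega>"
        by (simp add: jump_def \<mu> abs_minus_commute)
    qed auto
    then show ?thesis by (simp add: GTV_def)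
  qed
  have int: "integrable M (?h i j)" and ex: "(\<integral>\<omega>. ?h i j \<omega> \<partial>M) = nonlocal_energy e"
    if "i \<in> {1..m}" "j \<in> {1..m} - {i}" for i j
    using expectation_pair[OF M indep _ _ _ \<rho> dens' e, of i j] that by auto
  have "(\<integral>\<omega>. GTV e m (\<lambda>i. \<xi> i \<omega>) \<mu> \<partial>M) = (\<integral>\<omega>. ?c * (\<Sum>i\<in>{1..m}. \<Sum>j\<in>{1..m} - {i}. ?h i j \<omega>) \<partial>M)"
    using eq by (intro Bochner_Integration.integral_cong) auto
  also have "\<dots> = ?c * (\<Sum>i\<in>{1..m}. \<Sum>j\<in>{1..m} - {i}. nonlocal_energy e)"
    unfolding Bochner_Integration.integral_mult_right_zero
  proof (rule arg_cong[where f = "(*) ?c"])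
    have "(\<integral>\<omega>. (\<Sum>i\<in>{1..m}. \<Sum>j\<in>{1..m} - {i}. ?h i j \<omega>) \<partial>M) = (\<Sum>i\<in>{1..m}. \<integral>\<omega>. (\<Sum>j\<in>{1..m} - {i}. ?h i j \<omega>) \<partial>M)"
      by (intro Bochner_Integration.integral_sum Bochner_Integration.integrable_sum int)
    also have "\<dots> = (\<Sum>i\<in>{1..m}. \<Sum>j\<in>{1..m} - {i}. nonlocal_energy e)"
    proof (rule sum.cong[OF refl])
      fix i assume i: "i \<in> {1..m}"
      show "(\<integral>\<omega>. (\<Sum>j\<in>{1..m} - {i}. ?h i j \<omega>) \<partial>M) = (\<Sum>j\<in>{1..m} - {i}. nonlocal_energy e)"
        using i by (subst Bochner_Integration.integral_sum) (auto intro: int simp: ex)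
    qed
    finally show "(\<integral>\<omega>. (\<Sum>i\<in>{1..m}. \<Sum>j\<in>{1..m} - {i}. ?h i j \<omega>) \<partial>M) = (\<Sum>i\<in>{1..m}. \<Sum>j\<in>{1..m} - {i}. nonlocal_energy e)" .
  qed
  also have "(\<Sum>i\<in>{1..m}. \<Sum>j\<in>{1..m} - {i}. nonlocal_energy e) = real m * (real m - 1) * nonlocal_energy e"
    using m by (simp add: of_nat_diff)
  also have "?c * (real m * (real m - 1) * nonlocal_energy e) = nonlocal_energy e / e"
    using m e by simp
  finally show ?thesis .
qed

lemma affine_hyperplane_unit_normal:
  assumes "affine_hyperplane (H :: (real^'d) set)"
  shows "\<exists>a c. norm a = 1 \<and> H = {x. a \<bullet> x = c}"
proof -
  obtain a c where a: "a \<noteq> 0" and H: "H = {x. a \<bullet> x = c}"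
    using assms by (auto simp: affine_hyperplane_def)
  have "H = {x. (a /\<^sub>R norm a) \<bullet> x = c / norm a}"
    using a by (auto simp: H field_simps)
  moreover have "norm (a /\<^sub>R norm a) = 1" using a by simp
  ultimately show ?thesis by blast
qed

text \<open>The facets of the cube lie in the \<open>2 d\<close> coordinate hyperplanes added to those of \<open>F\<close>.
Indexing the hyperplanes by themselves makes them distinct.\<close>

lemma polyhedral_domain_unit_cube:
  fixes F :: "(real^'d) set"
  assumes F: "polyhedral_set F"
  defines "X \<equiv> {x :: real^'d. \<forall>i. 0 < x $ i \<and> x $ i < 1}"
  shows "\<exists>I n b R. polyhedral_domain (I :: (real^'d) set set) n b X F R"
proof -
  obtain \<H> where \<H>: "finite \<H>" "\<forall>H\<in>\<H>. affine_hyperplane H" "frontier F \<subseteq> \<Union>\<H>"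
    using F by (auto simp: polyhedral_set_def)
  let ?G = "\<lambda>c::real. range (\<lambda>k. {x :: real^'d. axis k 1 \<bullet> x = c})"
  define I where "I = \<H> \<union> ?G 0 \<union> ?G 1"
  have "affine_hyperplane {x :: real^'d. axis k 1 \<bullet> x = c}" for k c
    unfolding affine_hyperplane_def by (intro exI[of _ "axis k 1"] exI[of _ c]) (simp add: axis_eq_0_iff)
  then have "\<forall>H\<in>I. affine_hyperplane H" using \<H> by (auto simp: I_def)
  then have "\<forall>H\<in>I. \<exists>a c. norm a = 1 \<and> H = {x. a \<bullet> x = c}"
    using affine_hyperplane_unit_normal by blast
  then obtain n b where nb: "\<And>H. H \<in> I \<Longrightarrow> norm (n H) = 1 \<and> H = {x. n H \<bullet> x = b H}"
    by metis
  have X: "X = box 0 1" by (auto simp: X_def mem_box_cart)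
  obtain R where R: "X \<subseteq> cball 0 R"
    using bounded_box[of "0::real^'d" 1] unfolding X bounded_iff by (auto simp: subset_iff)
  have fX: "frontier X \<subseteq> \<Union>I"
  proof
    fix x assume x: "x \<in> frontier X"
    have "closure X \<subseteq> cbox 0 1" unfolding X by (intro closure_minimal box_subset_cbox closed_cbox)
    moreover have "interior X = X" unfolding X by (rule interior_open) (rule open_box)
    ultimately have "x \<in> cbox 0 1" "x \<notin> X" using x by (auto simp: frontier_def)
    then obtain k where "x $ k = 0 \<or> x $ k = 1"
      by (auto simp: X_def mem_box_cart not_less) (metis order_antisym)+
    then have "x \<in> {x. axis k 1 \<bullet> x = 0} \<or> x \<in> {x. axis k 1 \<bullet> x = 1}"
      by (simp add: inner_axis')
    then show "x \<in> \<Union>I" by (auto simp: I_def)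
  qed
  have "polyhedral_domain I n b X F R"
  proof
    show "finite I" using \<H> by (simp add: I_def)
    show "norm (n H) = 1" if "H \<in> I" for H using nb[OF that] by simp
    show "{x. n H \<bullet> x = b H} \<noteq> {x. n H' \<bullet> x = b H'}" if "H \<in> I" "H' \<in> I" "H \<noteq> H'" for H H'
      using nb[OF that(1)] nb[OF that(2)] that(3) by simp
    show "open X" unfolding X by (rule open_box)
    show "convex X" unfolding X by (rule convex_box)
    show "X \<subseteq> cball 0 R" by (rule R)
    show "open F" using F by (simp add: polyhedral_set_def)
    show "frontier X \<union> frontier F \<subseteq> {x. \<exists>H\<in>I. n H \<bullet> x - b H = 0}"
    proof
      fix x assume "x \<in> frontier X \<union> frontier F"
      moreover have "\<H> \<subseteq> I" by (auto simp: I_def)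
      ultimately obtain H where "H \<in> I" "x \<in> H" using fX \<H>(3) by blast
      then show "x \<in> {x. \<exists>H\<in>I. n H \<bullet> x - b H = 0}" using nb[of H] by auto
    qed
  qed
  then show ?thesis by blast
qed

theorem theorem6p1:
  fixes X :: "(real^'d) set" and \<rho> \<mu> \<eta> :: "real^'d \<Rightarrow> real" and \<epsilon> :: "nat \<Rightarrow> real"
    and M :: "'w measure" and \<xi> :: "nat \<Rightarrow> 'w \<Rightarrow> real^'d"
  assumes dim: "CARD('d) \<ge> 2"
    and X: "X = {x. \<forall>i. 0 < x $ i \<and> x $ i < 1}"
    and rho: "\<forall>x\<in>X. \<rho> x = 1"
    and eta: "\<eta> = indicator (ball 0 1)"
    and eps_pos: "\<forall>n. \<epsilon> n > 0"
    and eps_lim: "\<epsilon> \<longlonglongrightarrow> 0"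
    and prob: "prob_space M"
    and indep: "prob_space.indep_vars M (\<lambda>_. borel) \<xi> {1..}"
    and density: "\<forall>i\<ge>1. distributed M (restrict_space lborel X) (\<xi> i) (\<lambda>x. ennreal (\<rho> x))"
    and poly: "polyhedral_function X \<mu>"
  shows "\<bar>TV X \<mu> \<rho> \<eta>\<bar> \<noteq> \<infinity> \<and>
         (\<lambda>n. \<bar>prob_space.expectation M (\<lambda>\<omega>. GTV (\<epsilon> n) n (\<lambda>i. \<xi> i \<omega>) \<mu>)
               - real_of_ereal (TV X \<mu> \<rho> \<eta>)\<bar>) \<in> O(\<epsilon>)"
proof -
  obtain F where F: "polyhedral_set F" "\<forall>x \<in> X \<inter> F. \<mu> x = 1" "\<forall>x \<in> X - F. \<mu> x = 0"
    using poly by (auto simp: polyhedral_function_def)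
  then have \<mu>: "\<mu> x = indicator F x" if "x \<in> X" for x
    using that by (cases "x \<in> F") auto
  obtain I :: "(real^'d) set set" and a b R where "polyhedral_domain I a b X F R"
    using polyhedral_domain_unit_cube[OF F(1), folded X] by (elim exE) (rule that)
  then interpret polyhedral_domain I a b X F R .
  obtain c where c: "0 \<le> c" "\<And>\<nu> :: real^'d. sigma (indicator (ball 0 1)) \<nu> = c * norm \<nu>"
    by (rule sigma_ball_radial) (rule that; blast)
  obtain C P where C: "0 \<le> C"
    and P: "\<forall>i\<in>I. ((\<lambda>t. variation.slab_integral (\<lambda>_. 1) i t / t) \<longlongrightarrow> P i) (at_right 0)"
    and energy: "\<forall>e. 0 < e \<longrightarrow> e \<le> 1 \<longrightarrow> \<bar>nonlocal_energy e - e * (c * (\<Sum>i\<in>I. P i))\<bar> \<le> C * e\<^sup>2"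
    using nonlocal_energy_expansion[OF c(2)] by (elim exE conjE)
  define T where "T = c * (\<Sum>i\<in>I. P i)"
  have TV: "TV X \<mu> \<rho> \<eta> = ereal T"
    unfolding T_def eta using P rho by (intro TV_eq[OF c(2,1)] \<mu>) auto
  have "eventually (\<lambda>n. \<epsilon> n < 1) sequentially"
    using eps_lim by (rule order_tendstoD) simp
  then have "eventually (\<lambda>n. norm \<bar>prob_space.expectation M (\<lambda>\<omega>. GTV (\<epsilon> n) n (\<lambda>i. \<xi> i \<omega>) \<mu>) - T\<bar> \<le> C * norm (\<epsilon> n)) sequentially"
    using eventually_ge_at_top[of 2]
  proof eventually_elim
    case (elim m)
    have e: "0 < \<epsilon> m" "\<epsilon> m \<le> 1" using eps_pos elim by auto
    have "prob_space.expectation M (\<lambda>\<omega>. GTV (\<epsilon> m) m (\<lambda>i. \<xi> i \<omega>) \<mu>) = nonlocal_energy (\<epsilon> m) / \<epsilon> m"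
      using rho density by (intro expectation_GTV[where \<rho> = \<rho>, OF prob indep _ _ \<mu> e(1) elim(2)]) auto
    moreover have "\<bar>nonlocal_energy (\<epsilon> m) / \<epsilon> m - T\<bar> \<le> C * \<epsilon> m"
    proof -
      have "nonlocal_energy (\<epsilon> m) / \<epsilon> m - T = (nonlocal_energy (\<epsilon> m) - \<epsilon> m * T) / \<epsilon> m"
        using e by (simp add: field_simps)
      also have "\<bar>\<dots>\<bar> = \<bar>nonlocal_energy (\<epsilon> m) - \<epsilon> m * T\<bar> / \<epsilon> m" using e by simp
      also have "\<dots> \<le> C * (\<epsilon> m)\<^sup>2 / \<epsilon> m"
        using energy[rule_format, OF e] e by (intro divide_right_mono) (auto simp: T_def)
      also have "\<dots> = C * \<epsilon> m" using e by (simp add: power2_eq_square)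
      finally show ?thesis .
    qed
    ultimately show ?case using e by simp
  qed
  then have "(\<lambda>n. \<bar>prob_space.expectation M (\<lambda>\<omega>. GTV (\<epsilon> n) n (\<lambda>i. \<xi> i \<omega>) \<mu>) - T\<bar>) \<in> O(\<epsilon>)"
    by (rule bigoI)
  then show ?thesis by (simp add: TV)
qed

end
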